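(* Suppose the (Riemannian or pseudo-Riemannian) metric $g$ on a surface $M^2$ admits a nontrivial integral $F$ quadratic in momenta. Then, in a neighbourhood of almost every point there exist coordinates $(x,y)$ such that the metric $g$ and the integral $F$ have one of the following three forms, where $(x,y,p_x,p_y)$ are the corresponding canonical coordinates on $T^*M^2$. (1) Liouville case: $$g=(X(x)-Y(y))(dx^2\pm dy^2),\qquad F=\frac{X(x)\,p_y^2\pm Y(y)\,p_x^2}{X(x)-Y(y)},$$ where $X$ is a function of $x$ only, $Y$ is a function of $y$ only, and the sign $\pm$ is the same in both formulas. (2) Complex-Liouville case: $$g=\Im(h)\,dx\,dy,\qquad F=p_x^2-p_y^2+2\,\frac{\Re(h)}{\Im(h)}\,p_xp_y,$$ where $h=\Re(h)+i\cdot\Im(h)$ is a holomorphic function of the variable $z=x+iy$. (3) Jordan-block case: $$g=(1+xY'(y))\,dx\,dy,\qquad F=p_x^2-2\,\frac{Y(y)}{1+xY'(y)}\,p_xp_y,$$ where $Y$ is a function of $y$ only.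
   Context: Metrics may be Riemannian or pseudo-Riemannian, and they are written as quadratic forms $ds^2$ in the local coordinates $(x,y)$. Let $H=\tfrac12 g^{ij}p_ip_j:T^*M^2\to\mathbb{R}$ be the kinetic energy corresponding to the metric $g$, and let $\{\ ,\ \}$ be the standard Poisson bracket on $T^*M^2$. A function $F:T^*M^2\to\mathbb{R}$ is an integral of the geodesic flow of $g$ (for short, $g$ admits the integral $F$) if $\{H,F\}=0$. The integral $F$ is quadratic in momenta if for every local coordinate system $(x,y)$ on $M^2$ it has the form $$F(x,y,p_x,p_y)=a(x,y)p_x^2+b(x,y)p_xp_y+c(x,y)p_y^2$$ in the canonical coordinates $(x,y,p_x,p_y)$ on $T^*M^2$. It is nontrivial if $F\neq\mathrm{const}\cdot H$ for all $\mathrm{const}\in\mathbb{R}$. $\Re$ and $\Im$ denote real and imaginary parts.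
   Formalization: In the Liouville case with sign "−" and in the Jordan-block case, F is brought to the stated form only up to replacing F by −F (g=dx²−dy², F=−p_x² defeats the literal claim); M² is assumed connected, and "almost every point" means an open dense set. *)

theory Defs
  imports "HOL-Complex_Analysis.Complex_Analysis"
begin

section \<open>Smooth functions\<close>

text \<open>Only used for open \<open>S\<close>: the derivatives are unrestricted ones, taken at the points of \<open>S\<close>.\<close>

primrec times_differentiable_on ::
    "nat \<Rightarrow> ('a::real_normed_vector \<Rightarrow> 'b::real_normed_vector) \<Rightarrow> 'a set \<Rightarrow> bool" where
  "times_differentiable_on 0 f S \<longleftrightarrow> continuous_on S f"
| "times_differentiable_on (Suc k) f S \<longleftrightarrow>
     (\<forall>x\<in>S. f differentiable (at x)) \<and>
     (\<forall>v. times_differentiable_on k (\<lambda>x. frechet_derivative f (at x) v) S)"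

definition smooth_on ::
    "'a::real_normed_vector set \<Rightarrow> ('a \<Rightarrow> 'b::real_normed_vector) \<Rightarrow> bool" where
  "smooth_on S f \<longleftrightarrow> (\<forall>k. times_differentiable_on k f S)"


section \<open>Surfaces\<close>

text \<open>A chart is a pair \<open>(U, \<phi>)\<close> of its domain and its coordinate map.
  The values of \<open>\<phi>\<close> outside \<open>U\<close> are irrelevant.\<close>

type_synonym 'a chart = "'a set \<times> ('a \<Rightarrow> real \<times> real)"

definition range_of :: "'a chart \<Rightarrow> (real \<times> real) set" where
  "range_of c = snd c ` fst c"

definition is_chart :: "'a topology \<Rightarrow> 'a chart \<Rightarrow> bool" where
  "is_chart T c \<longleftrightarrow> openin T (fst c) \<and> open (range_of c) \<and>
     homeomorphic_map (subtopology T (fst c)) (top_of_set (range_of c)) (snd c)"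

definition transition :: "'a chart \<Rightarrow> 'a chart \<Rightarrow> real \<times> real \<Rightarrow> real \<times> real" where
  "transition c d = snd d \<circ> inv_into (fst c) (snd c)"

definition compatible :: "'a chart \<Rightarrow> 'a chart \<Rightarrow> bool" where
  "compatible c d \<longleftrightarrow>
     smooth_on (snd c ` (fst c \<inter> fst d)) (transition c d) \<and>
     smooth_on (snd d ` (fst c \<inter> fst d)) (transition d c)"

definition smooth_surface :: "'a topology \<Rightarrow> 'a chart set \<Rightarrow> bool" where
  "smooth_surface T A \<longleftrightarrow>
     Hausdorff_space T \<and> second_countable T \<and> connected_space T \<and>
     (\<forall>c\<in>A. is_chart T c) \<and> (\<Union>c\<in>A. fst c) = topspace T \<and>
     (\<forall>c\<in>A. \<forall>d\<in>A. compatible c d)"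

text \<open>The local coordinate systems are the charts of the maximal atlas generated by \<open>A\<close>.\<close>

definition coordinate_system :: "'a topology \<Rightarrow> 'a chart set \<Rightarrow> 'a chart \<Rightarrow> bool" where
  "coordinate_system T A c \<longleftrightarrow> is_chart T c \<and> (\<forall>d\<in>A. compatible c d)"

definition coordinate_systems_at :: "'a topology \<Rightarrow> 'a chart set \<Rightarrow> 'a \<Rightarrow> 'a chart set" where
  "coordinate_systems_at T A p = {c. coordinate_system T A c \<and> p \<in> fst c}"


section \<open>Tangent and cotangent bundle\<close>

text \<open>A (co)tangent vector at \<open>p\<close> is the family of its component pairs in all coordinate systems
  around \<open>p\<close>. The components of tangent vectors transform by the Jacobian of the coordinate
  change, those of covectors in such a way that \<open>p\<^sub>x dx + p\<^sub>y dy\<close> is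
  independent of the coordinates.\<close>

definition jacobian :: "'a chart \<Rightarrow> 'a chart \<Rightarrow> 'a \<Rightarrow> real \<times> real \<Rightarrow> real \<times> real" where
  "jacobian c d p = frechet_derivative (transition c d) (at (snd c p))"

definition tangent_space ::
    "'a topology \<Rightarrow> 'a chart set \<Rightarrow> 'a \<Rightarrow> ('a chart \<Rightarrow> real \<times> real) set" where
  "tangent_space T A p = {v \<in> extensional (coordinate_systems_at T A p).
     \<forall>c\<in>coordinate_systems_at T A p. \<forall>d\<in>coordinate_systems_at T A p. v d = jacobian c d p (v c)}"

definition cotangent_space ::
    "'a topology \<Rightarrow> 'a chart set \<Rightarrow> 'a \<Rightarrow> ('a chart \<Rightarrow> real \<times> real) set" where
  "cotangent_space T A p = {\<omega> \<in> extensional (coordinate_systems_at T A p).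
     \<forall>c\<in>coordinate_systems_at T A p. \<forall>d\<in>coordinate_systems_at T A p.
       \<forall>u. \<omega> c \<bullet> u = \<omega> d \<bullet> jacobian c d p u}"

type_synonym 'a bundle_point = "'a \<times> ('a chart \<Rightarrow> real \<times> real)"

definition tangent_bundle_on ::
    "'a topology \<Rightarrow> 'a chart set \<Rightarrow> 'a set \<Rightarrow> 'a bundle_point set" where
  "tangent_bundle_on T A U = (SIGMA p:U. tangent_space T A p)"

definition cotangent_bundle_on ::
    "'a topology \<Rightarrow> 'a chart set \<Rightarrow> 'a set \<Rightarrow> 'a bundle_point set" where
  "cotangent_bundle_on T A U = (SIGMA p:U. cotangent_space T A p)"

text \<open>The coordinates \<open>((x, y), (dx, dy))\<close>, respectively the canonical coordinates
  \<open>((x, y), (p\<^sub>x, p\<^sub>y))\<close>, that a coordinate system induces on the part of the bundle over its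
  domain; and functions on the bundles expressed in them. These expressions are meaningful
  on \<open>range_of c \<times> UNIV\<close>.\<close>

definition bundle_coords :: "'a chart \<Rightarrow> 'a bundle_point \<Rightarrow> (real \<times> real) \<times> (real \<times> real)" where
  "bundle_coords c = (\<lambda>(p, v). (snd c p, v c))"

definition in_tangent_coords ::
    "'a topology \<Rightarrow> 'a chart set \<Rightarrow> 'a chart \<Rightarrow> ('a bundle_point \<Rightarrow> real) \<Rightarrow>
     (real \<times> real) \<times> (real \<times> real) \<Rightarrow> real" where
  "in_tangent_coords T A c f = f \<circ> inv_into (tangent_bundle_on T A (fst c)) (bundle_coords c)"

definition in_canonical_coords ::
    "'a topology \<Rightarrow> 'a chart set \<Rightarrow> 'a chart \<Rightarrow> ('a bundle_point \<Rightarrow> real) \<Rightarrow>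
     (real \<times> real) \<times> (real \<times> real) \<Rightarrow> real" where
  "in_canonical_coords T A c f = f \<circ> inv_into (cotangent_bundle_on T A (fst c)) (bundle_coords c)"


section \<open>Metrics, geodesic flow and quadratic integrals\<close>

text \<open>A metric is given by its quadratic form \<open>ds\<^sup>2\<close>, a function on the tangent bundle.
  It is smooth and nondegenerate; its signature is arbitrary.\<close>

definition pseudo_riemannian_metric ::
    "'a topology \<Rightarrow> 'a chart set \<Rightarrow> ('a bundle_point \<Rightarrow> real) \<Rightarrow> bool" where
  "pseudo_riemannian_metric T A g \<longleftrightarrow> (\<forall>c. coordinate_system T A c \<longrightarrow>
     (\<exists>g11 g12 g22. smooth_on (range_of c) g11 \<and> smooth_on (range_of c) g12 \<and>
        smooth_on (range_of c) g22 \<and>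
        (\<forall>q\<in>range_of c. g11 q * g22 q - (g12 q)\<^sup>2 \<noteq> 0 \<and>
          (\<forall>dx dy. in_tangent_coords T A c g (q, (dx, dy)) =
             g11 q * dx\<^sup>2 + 2 * g12 q * dx * dy + g22 q * dy\<^sup>2))))"

text \<open>The expression \<open>(1/2) g\<^sup>i\<^sup>j p\<^sub>i p\<^sub>j\<close> for a quadratic form \<open>Q\<close>
  in \<open>(dx, dy)\<close>, with the inverse of the \<open>2 \<times> 2\<close> Gram matrix written out.\<close>

definition half_inverse_form :: "(real \<times> real \<Rightarrow> real) \<Rightarrow> real \<times> real \<Rightarrow> real" where
  "half_inverse_form Q = (\<lambda>(px, py).
     let g11 = Q (1, 0); g22 = Q (0, 1); g12 = (Q (1, 1) - g11 - g22) / 2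
     in (g22 * px\<^sup>2 - 2 * g12 * px * py + g11 * py\<^sup>2) / (g11 * g22 - g12\<^sup>2) / 2)"

text \<open>The value does not depend on the coordinate system that is chosen.\<close>

definition kinetic_energy ::
    "'a topology \<Rightarrow> 'a chart set \<Rightarrow> ('a bundle_point \<Rightarrow> real) \<Rightarrow> 'a bundle_point \<Rightarrow> real" where
  "kinetic_energy T A g = (\<lambda>(p, \<omega>).
     let c = (SOME c. c \<in> coordinate_systems_at T A p)
     in half_inverse_form (\<lambda>u. in_tangent_coords T A c g (snd c p, u)) (\<omega> c))"

text \<open>The standard Poisson bracket of functions of \<open>((x, y), (p\<^sub>x, p\<^sub>y))\<close>.\<close>

definition poisson_bracket ::
    "((real \<times> real) \<times> (real \<times> real) \<Rightarrow> real) \<Rightarrow> ((real \<times> real) \<times> (real \<times> real) \<Rightarrow> real) \<Rightarrow>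
     (real \<times> real) \<times> (real \<times> real) \<Rightarrow> real" where
  "poisson_bracket H F z =
     (let DH = frechet_derivative H (at z); DF = frechet_derivative F (at z) in
       DH ((1, 0), (0, 0)) * DF ((0, 0), (1, 0)) - DH ((0, 0), (1, 0)) * DF ((1, 0), (0, 0)) +
       DH ((0, 1), (0, 0)) * DF ((0, 0), (0, 1)) - DH ((0, 0), (0, 1)) * DF ((0, 1), (0, 0)))"

definition geodesic_integral ::
    "'a topology \<Rightarrow> 'a chart set \<Rightarrow> ('a bundle_point \<Rightarrow> real) \<Rightarrow> ('a bundle_point \<Rightarrow> real) \<Rightarrow> bool" where
  "geodesic_integral T A g F \<longleftrightarrow> (\<forall>c. coordinate_system T A c \<longrightarrow>
     (\<forall>z\<in>range_of c \<times> UNIV.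
        poisson_bracket (in_canonical_coords T A c (kinetic_energy T A g))
          (in_canonical_coords T A c F) z = 0))"

definition quadratic_in_momenta ::
    "'a topology \<Rightarrow> 'a chart set \<Rightarrow> ('a bundle_point \<Rightarrow> real) \<Rightarrow> bool" where
  "quadratic_in_momenta T A F \<longleftrightarrow> (\<forall>c. coordinate_system T A c \<longrightarrow>
     (\<exists>a b e. smooth_on (range_of c) a \<and> smooth_on (range_of c) b \<and> smooth_on (range_of c) e \<and>
        (\<forall>q\<in>range_of c. \<forall>px py. in_canonical_coords T A c F (q, (px, py)) =
           a q * px\<^sup>2 + b q * px * py + e q * py\<^sup>2)))"

definition nontrivial_integral ::
    "'a topology \<Rightarrow> 'a chart set \<Rightarrow> ('a bundle_point \<Rightarrow> real) \<Rightarrow> ('a bundle_point \<Rightarrow> real) \<Rightarrow> bool" where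
  "nontrivial_integral T A g F \<longleftrightarrow>
     \<not> (\<exists>k. \<forall>\<xi>\<in>cotangent_bundle_on T A (topspace T). F \<xi> = k * kinetic_energy T A g \<xi>)"


section \<open>Normal forms\<close>

text \<open>Here \<open>D\<close> is the range of the coordinates \<open>(x, y)\<close>, while \<open>G\<close> is the metric as a function of
  \<open>((x, y), (dx, dy))\<close> and \<open>F\<close> the integral as a function of \<open>((x, y), (p\<^sub>x, p\<^sub>y))\<close>.
  The sign \<open>\<plusminus>\<close> is \<open>\<epsilon>\<close>.\<close>

definition liouville_form ::
    "real \<Rightarrow> (real \<times> real) set \<Rightarrow> ((real \<times> real) \<times> (real \<times> real) \<Rightarrow> real) \<Rightarrow>
     ((real \<times> real) \<times> (real \<times> real) \<Rightarrow> real) \<Rightarrow> bool" where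
  "liouville_form \<epsilon> D G F \<longleftrightarrow> (\<exists>X Y :: real \<Rightarrow> real.
     smooth_on (fst ` D) X \<and> smooth_on (snd ` D) Y \<and>
     (\<forall>(x, y)\<in>D.
        (\<forall>dx dy. G ((x, y), (dx, dy)) = (X x - Y y) * (dx\<^sup>2 + \<epsilon> * dy\<^sup>2)) \<and>
        (\<forall>px py. F ((x, y), (px, py)) = (X x * py\<^sup>2 + \<epsilon> * (Y y * px\<^sup>2)) / (X x - Y y))))"

definition complex_liouville_form ::
    "(real \<times> real) set \<Rightarrow> ((real \<times> real) \<times> (real \<times> real) \<Rightarrow> real) \<Rightarrow>
     ((real \<times> real) \<times> (real \<times> real) \<Rightarrow> real) \<Rightarrow> bool" where
  "complex_liouville_form D G F \<longleftrightarrow> (\<exists>h :: complex \<Rightarrow> complex.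
     h holomorphic_on {Complex x y | x y. (x, y) \<in> D} \<and>
     (\<forall>(x, y)\<in>D.
        (\<forall>dx dy. G ((x, y), (dx, dy)) = Im (h (Complex x y)) * dx * dy) \<and>
        (\<forall>px py. F ((x, y), (px, py)) =
           px\<^sup>2 - py\<^sup>2 + 2 * (Re (h (Complex x y)) / Im (h (Complex x y))) * px * py)))"

definition jordan_block_form ::
    "(real \<times> real) set \<Rightarrow> ((real \<times> real) \<times> (real \<times> real) \<Rightarrow> real) \<Rightarrow>
     ((real \<times> real) \<times> (real \<times> real) \<Rightarrow> real) \<Rightarrow> bool" where
  "jordan_block_form D G F \<longleftrightarrow> (\<exists>Y :: real \<Rightarrow> real. smooth_on (snd ` D) Y \<and>
     (\<forall>(x, y)\<in>D.
        (\<forall>dx dy. G ((x, y), (dx, dy)) = (1 + x * deriv Y y) * dx * dy) \<and>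
        (\<forall>px py. F ((x, y), (px, py)) = px\<^sup>2 - 2 * (Y y / (1 + x * deriv Y y)) * px * py)))"

text \<open>The coordinate system \<open>c\<close> brings \<open>g\<close> and \<open>F\<close> to normal form, where in two cases \<open>F\<close> may
  have to be replaced by \<open>- F\<close>. This cannot be avoided. The trace-free part of \<open>F\<close>
  with respect to \<open>g\<close> does not depend on coordinates; it is \<open>(p\<^sub>x\<^sup>2 + p\<^sub>y\<^sup>2) / 2\<close> in the Liouville
  form with \<open>\<epsilon> = - 1\<close>, and \<open>p\<^sub>x\<^sup>2\<close> in the Jordan-block form, hence positive semidefinite.
  For \<open>F = - p\<^sub>x\<^sup>2\<close> it is \<open>- (p\<^sub>x\<^sup>2 + p\<^sub>y\<^sup>2) / 2\<close> if \<open>g = dx\<^sup>2 - dy\<^sup>2\<close>,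
  and \<open>- p\<^sub>x\<^sup>2\<close> if \<open>g = dx dy\<close>.\<close>

definition normal_form_in ::
    "'a topology \<Rightarrow> 'a chart set \<Rightarrow> 'a chart \<Rightarrow> ('a bundle_point \<Rightarrow> real) \<Rightarrow>
     ('a bundle_point \<Rightarrow> real) \<Rightarrow> bool" where
  "normal_form_in T A c g F \<longleftrightarrow>
     (let D = range_of c; G = in_tangent_coords T A c g; f = in_canonical_coords T A c F in
        liouville_form 1 D G f \<or>
        complex_liouville_form D G f \<or>
        (\<exists>\<sigma>\<in>{1, -1}. liouville_form (- 1) D G (\<lambda>z. \<sigma> * f z) \<or>
                      jordan_block_form D G (\<lambda>z. \<sigma> * f z)))"

end

theory Submission
  imports Defs
begin

text \<open>
  In a frame \<open>e1, e2\<close> the momenta \<open>P\<^sub>i = p(e\<^sub>i)\<close> satisfy \<open>{\<phi>, P\<^sub>i} = e\<^sub>i \<phi>\<close> for functions \<open>\<phi>\<close> of the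
  point, and \<open>{P\<^sub>1, P\<^sub>2}\<close> is given by the bracket \<open>[e1, e2]\<close>. Choose the frame pointwise so that the energy \<open>H\<close>
  and \<open>F\<close> have the shape of the normal form: if the metric is definite, diagonalize \<open>F\<close>; if it is
  indefinite, take the two null directions, so that \<open>F\<close> is \<open>A P\<^sub>1\<^sup>2 + C P\<^sub>2\<^sup>2\<close> plus a multiple of \<open>H\<close>, and
  rescale them to make \<open>A\<close> and \<open>C\<close> equal to \<open>\<plusminus> 1\<close> or \<open>0\<close>. The four coefficients of the cubic \<open>{H, F} = 0\<close>
  then say that the frame commutes (in the Jordan-block case after one further rescaling of \<open>e2\<close>) and
  give the equations for \<open>X\<close>, \<open>Y\<close> and \<open>h\<close>. The dual coframe of a commuting frame is closed, so the
  coordinates are integrals of closed 1-forms; no differential equation has to be solved. The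
  construction fails in an open set only if \<open>F = k H\<close> there near some point, with a constant \<open>k\<close>. Since
  \<open>F - k H\<close> is an integral, its coefficients and some of their derivatives satisfy a closed linear
  system, hence \<open>F = k H\<close> on the whole connected surface, which nontriviality excludes.
\<close>

section \<open>Smooth functions\<close>

text \<open>For quadratic \<open>F\<close> the equation \<open>{H, F} = 0\<close> is of finite type:
  six functions, the three coefficients and three of their derivatives, determine \<open>F\<close>
  along any path from their values at one point. This replaces analytic continuation, which merely
  smooth data do not allow. The obstacle in the local part is that zeros and signs of the
  coefficients can be distributed arbitrarily: the square roots used for rescaling are smooth only
  where their argument is positive, and a Jordan block at one point need not persist nearby. Every
  local construction therefore picks, inside a given nonempty open set, a point at which the
  relevant signs are stable, and then shrinks the set. This yields good points in every open set
  rather than at every point. In a real null frame the signs of \<open>A\<close> and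
  \<open>C\<close> select the form: equal signs give Liouville with \<open>\<epsilon> = -1\<close>,
  opposite signs complex Liouville, one coefficient vanishing nearby the Jordan block.\<close>

definition dir_deriv ::
    "('a::real_normed_vector \<Rightarrow> 'b::real_normed_vector) \<Rightarrow> 'a \<Rightarrow> 'a \<Rightarrow> 'b" where
  "dir_deriv f v x = frechet_derivative f (at x) v"

lemma dir_deriv_eqI: "(f has_derivative f') (at x) \<Longrightarrow> dir_deriv f v x = f' v"
  by (simp add: dir_deriv_def frechet_derivative_at[symmetric])

lemma has_derivative_dir_deriv:
  "f differentiable at x \<Longrightarrow> (f has_derivative (\<lambda>v. dir_deriv f v x)) (at x)"
  by (simp add: dir_deriv_def frechet_derivative_works[symmetric])

lemma has_derivative_cong_open:
  assumes "open S" "x \<in> S" "\<And>y. y \<in> S \<Longrightarrow> f y = g y"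
  shows "(f has_derivative f') (at x) \<longleftrightarrow> (g has_derivative f') (at x)"
  using has_derivative_transform_within_open[of f f' x UNIV S g]
    has_derivative_transform_within_open[of g f' x UNIV S f] assms by auto

lemma dir_deriv_cong:
  assumes "open S" "x \<in> S" "\<And>y. y \<in> S \<Longrightarrow> f y = g y"
  shows "dir_deriv f v x = dir_deriv g v x"
  using has_derivative_cong_open[OF assms]
  by (simp add: dir_deriv_def frechet_derivative_def)

lemma differentiable_cong_open:
  assumes "open S" "x \<in> S" "\<And>y. y \<in> S \<Longrightarrow> f y = g y"
  shows "f differentiable at x \<longleftrightarrow> g differentiable at x"
  using has_derivative_cong_open[OF assms] by (simp add: differentiable_def)

lemma times_differentiable_on_Suc:
  "times_differentiable_on (Suc k) f S \<longleftrightarrow>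
     (\<forall>x\<in>S. f differentiable (at x)) \<and> (\<forall>v. times_differentiable_on k (dir_deriv f v) S)"
  by (simp add: dir_deriv_def[abs_def])

declare times_differentiable_on.simps(2) [simp del]

lemma times_differentiable_on_cong_imp:
  assumes "open S" "\<And>x. x \<in> S \<Longrightarrow> f x = g x" "times_differentiable_on k f S"
  shows "times_differentiable_on k g S"
  using assms(2,3)
proof (induction k arbitrary: f g)
  case 0
  then show ?case by (simp cong: continuous_on_cong)
next
  case (Suc k)
  have "times_differentiable_on k (dir_deriv g v) S" for v
  proof (rule Suc.IH)
    show "dir_deriv f v x = dir_deriv g v x" if "x \<in> S" for x
      using dir_deriv_cong[OF \<open>open S\<close> that] Suc.prems(1) .
    show "times_differentiable_on k (dir_deriv f v) S"
      using Suc.prems(2) by (simp add: times_differentiable_on_Suc)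
  qed
  moreover have "\<forall>x\<in>S. g differentiable (at x)"
    using Suc.prems differentiable_cong_open[OF \<open>open S\<close>, of _ f g]
    by (auto simp: times_differentiable_on_Suc)
  ultimately show ?case by (simp add: times_differentiable_on_Suc)
qed

lemma times_differentiable_on_lower:
  "times_differentiable_on (Suc k) f S \<Longrightarrow> times_differentiable_on k f S"
proof (induction k arbitrary: f)
  case 0
  then show ?case
    by (auto simp: times_differentiable_on_Suc intro!: differentiable_imp_continuous_on
        simp: differentiable_on_def differentiable_at_withinI)
next
  case (Suc k)
  then show ?case by (metis times_differentiable_on_Suc)
qed

lemma times_differentiable_on_subset:
  "times_differentiable_on k f S \<Longrightarrow> S' \<subseteq> S \<Longrightarrow> times_differentiable_on k f S'"
  by (induction k arbitrary: f)
    (auto simp: times_differentiable_on_Suc intro: continuous_on_subset)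

lemma times_differentiable_on_local:
  assumes "\<And>x. x \<in> S \<Longrightarrow> \<exists>U. open U \<and> x \<in> U \<and> times_differentiable_on k f U"
  shows "times_differentiable_on k f S"
  using assms
proof (induction k arbitrary: f)
  case 0
  have "isCont f x" if "x \<in> S" for x
    using 0[OF that] by (auto simp: continuous_on_eq_continuous_at)
  then show ?case by (simp add: continuous_at_imp_continuous_on)
next
  case (Suc k)
  have "times_differentiable_on k (dir_deriv f v) S" for v
    by (rule Suc.IH) (use Suc.prems in \<open>metis times_differentiable_on_Suc\<close>)
  moreover have "\<forall>x\<in>S. f differentiable (at x)"
    using Suc.prems by (metis times_differentiable_on_Suc)
  ultimately show ?case by (simp add: times_differentiable_on_Suc)
qed

text \<open>The induction step of the closure lemmas below: the product, quotient or chain rule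
  supplies \<open>f'\<close>, and the induction hypothesis makes it \<open>k\<close> times
  differentiable for each fixed direction \<open>v\<close>.\<close>

lemma times_differentiable_on_SucI:
  assumes "open S" "\<And>x. x \<in> S \<Longrightarrow> (f has_derivative (\<lambda>v. f' v x)) (at x)"
    "\<And>v. times_differentiable_on k (f' v) S"
  shows "times_differentiable_on (Suc k) f S"
  unfolding times_differentiable_on_Suc
proof (intro conjI ballI allI)
  show "f differentiable at x" if "x \<in> S" for x
    using assms(2)[OF that] by (auto simp: differentiable_def)
  show "times_differentiable_on k (dir_deriv f v) S" for v
    by (rule times_differentiable_on_cong_imp[OF assms(1) _ assms(3)[of v]])
      (use dir_deriv_eqI[OF assms(2)] in auto)
qed

lemma times_differentiable_on_has_derivative:
  "times_differentiable_on (Suc k) f S \<Longrightarrow> x \<in> S \<Longrightarrow>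
     (f has_derivative (\<lambda>v. dir_deriv f v x)) (at x)"
  by (auto simp: times_differentiable_on_Suc intro: has_derivative_dir_deriv)

section \<open>Finite differentiability under algebraic operations and composition\<close>

lemma times_differentiable_on_const: "open S \<Longrightarrow> times_differentiable_on k (\<lambda>x. c) S"
proof (induction k arbitrary: c)
  case (Suc k)
  show ?case by (rule times_differentiable_on_SucI[where f' = "\<lambda>v x. 0"]) (use Suc in auto)
qed auto

lemma times_differentiable_on_add:
  assumes "open S" "times_differentiable_on k f S" "times_differentiable_on k g S"
  shows "times_differentiable_on k (\<lambda>x. f x + g x) S"
  using assms(2,3)
proof (induction k arbitrary: f g)
  case 0
  then show ?case by (auto intro: continuous_on_add)
next
  case (Suc k)
  show ?case
    by (rule times_differentiable_on_SucI[OF \<open>open S\<close>,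
          where f' = "\<lambda>v x. dir_deriv f v x + dir_deriv g v x"])
      (use Suc in \<open>auto intro!: derivative_intros times_differentiable_on_has_derivative
        simp: times_differentiable_on_Suc\<close>)
qed

lemma times_differentiable_on_linear:
  assumes "open S" "bounded_linear L" "times_differentiable_on k f S"
  shows "times_differentiable_on k (\<lambda>x. L (f x)) S"
  using assms(3)
proof (induction k arbitrary: f)
  case 0
  then show ?case using bounded_linear.continuous_on[OF assms(2)] by auto
next
  case (Suc k)
  show ?case
    by (rule times_differentiable_on_SucI[OF \<open>open S\<close>, where f' = "\<lambda>v x. L (dir_deriv f v x)"])
      (use Suc in \<open>auto intro!: bounded_linear.has_derivative[OF assms(2)]
        times_differentiable_on_has_derivative simp: times_differentiable_on_Suc\<close>)
qed

text \<open>Treats products and scaling by a function at once. The product rule gives terms of the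
  same bilinear shape with one factor differentiated; the other factor is brought down to order
  \<open>k\<close> by \<open>times_differentiable_on_lower\<close>.\<close>

lemma times_differentiable_on_bilinear:
  assumes "open S" "bounded_bilinear B" "times_differentiable_on k f S" "times_differentiable_on k g S"
  shows "times_differentiable_on k (\<lambda>x. B (f x) (g x)) S"
  using assms(3,4)
proof (induction k arbitrary: f g)
  case 0
  then show ?case using bounded_bilinear.continuous_on[OF assms(2)] by auto
next
  case (Suc k)
  show ?case
  proof (rule times_differentiable_on_SucI[OF \<open>open S\<close>])
    show "((\<lambda>x. B (f x) (g x)) has_derivative
        (\<lambda>v. B (f x) (dir_deriv g v x) + B (dir_deriv f v x) (g x))) (at x)" if "x \<in> S" for x
      by (rule bounded_bilinear.FDERIV[OF assms(2)
            times_differentiable_on_has_derivative[OF Suc.prems(1) that]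
            times_differentiable_on_has_derivative[OF Suc.prems(2) that]])
    show "times_differentiable_on k (\<lambda>x. B (f x) (dir_deriv g v x) + B (dir_deriv f v x) (g x)) S" for v
      by (intro times_differentiable_on_add Suc.IH \<open>open S\<close>)
        (use Suc.prems times_differentiable_on_lower in \<open>auto simp: times_differentiable_on_Suc\<close>)
  qed
qed

text \<open>The derivative contains the reciprocal itself. The induction hypothesis provides it to
  order \<open>k\<close>, which is all that order \<open>Suc k\<close> of the claim asks for;
  \<open>times_differentiable_on_sqrt\<close> works in the same way.\<close>

lemma times_differentiable_on_inverse:
  fixes f :: "'a::real_normed_vector \<Rightarrow> real"
  assumes "open S" "\<And>x. x \<in> S \<Longrightarrow> f x \<noteq> 0" "times_differentiable_on k f S"
  shows "times_differentiable_on k (\<lambda>x. inverse (f x)) S"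
  using assms(3)
proof (induction k)
  case 0
  then show ?case using assms(2) by (auto intro: continuous_on_inverse)
next
  case (Suc k)
  show ?case
  proof (rule times_differentiable_on_SucI[OF \<open>open S\<close>])
    show "((\<lambda>x. inverse (f x)) has_derivative
        (\<lambda>v. - (inverse (f x) * dir_deriv f v x * inverse (f x)))) (at x)" if "x \<in> S" for x
      by (rule Deriv.has_derivative_inverse[OF assms(2)[OF that]
            times_differentiable_on_has_derivative[OF Suc.prems that]])
    have "times_differentiable_on k (\<lambda>x. inverse (f x)) S"
      using Suc times_differentiable_on_lower by blast
    then show "times_differentiable_on k (\<lambda>x. - (inverse (f x) * dir_deriv f v x * inverse (f x))) S" for v
      by (intro times_differentiable_on_linear[where L = uminus]
            times_differentiable_on_bilinear[OF \<open>open S\<close> bounded_bilinear_mult] \<open>open S\<close>)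
        (use Suc.prems in \<open>auto simp: times_differentiable_on_Suc bounded_linear_minus bounded_linear_ident\<close>)
  qed
qed

lemma times_differentiable_on_sqrt:
  fixes f :: "'a::real_normed_vector \<Rightarrow> real"
  assumes "open S" "\<And>x. x \<in> S \<Longrightarrow> f x > 0" "times_differentiable_on k f S"
  shows "times_differentiable_on k (\<lambda>x. sqrt (f x)) S"
  using assms(3)
proof (induction k)
  case 0
  then show ?case by (auto intro: continuous_on_real_sqrt)
next
  case (Suc k)
  show ?case
  proof (rule times_differentiable_on_SucI[OF \<open>open S\<close>])
    show "((\<lambda>x. sqrt (f x)) has_derivative
        (\<lambda>v. dir_deriv f v x * inverse (sqrt (f x)) / 2)) (at x)" if "x \<in> S" for x
    proof -
      have "(f has_derivative (\<lambda>v. dir_deriv f v x)) (at x)"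
        using Suc that by (auto intro: times_differentiable_on_has_derivative)
      then show ?thesis
        using assms(2)[OF that] by (auto intro!: derivative_eq_intros simp: field_simps)
    qed
    have "times_differentiable_on k (\<lambda>x. sqrt (f x)) S"
      using Suc times_differentiable_on_lower by blast
    then have "times_differentiable_on k (\<lambda>x. inverse (sqrt (f x))) S"
      by (intro times_differentiable_on_inverse \<open>open S\<close>) (use assms(2) in force)+
    then show "times_differentiable_on k (\<lambda>x. dir_deriv f v x * inverse (sqrt (f x)) / 2) S" for v
      by (intro times_differentiable_on_linear[where L = "\<lambda>x. x / 2"]
            times_differentiable_on_bilinear[OF \<open>open S\<close> bounded_bilinear_mult] \<open>open S\<close>)
        (use Suc.prems in \<open>auto simp: times_differentiable_on_Suc bounded_linear_divide\<close>)
  qed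
qed

lemma times_differentiable_on_sum:
  assumes "open S" "\<And>i. i \<in> I \<Longrightarrow> times_differentiable_on k (f i) S"
  shows "times_differentiable_on k (\<lambda>x. \<Sum>i\<in>I. f i x) S"
  using assms(2)
  by (induction I rule: infinite_finite_induct)
    (auto intro: times_differentiable_on_add times_differentiable_on_const \<open>open S\<close>)

lemma times_differentiable_on_compose:
  fixes f :: "'a::real_normed_vector \<Rightarrow> 'b::euclidean_space" and g :: "'b \<Rightarrow> 'c::real_normed_vector"
  assumes "open S" "open U" "f ` S \<subseteq> U"
    "times_differentiable_on k f S" "times_differentiable_on k g U"
  shows "times_differentiable_on k (\<lambda>x. g (f x)) S"
  using assms(4,5)
proof (induction k arbitrary: g)
  case 0
  then show ?case using assms(3) by (auto intro: continuous_on_compose2)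
next
  case (Suc k)
  show ?case
  proof (rule times_differentiable_on_SucI[OF \<open>open S\<close>])
    fix x assume "x \<in> S"
    then have f: "(f has_derivative (\<lambda>v. dir_deriv f v x)) (at x)"
      and g: "(g has_derivative (\<lambda>v. dir_deriv g v (f x))) (at (f x))"
      using Suc assms(3) by (auto intro: times_differentiable_on_has_derivative)
    interpret g: bounded_linear "\<lambda>v. dir_deriv g v (f x)"
      using g by (rule has_derivative_bounded_linear)
    have chain: "((\<lambda>x. g (f x)) has_derivative (\<lambda>v. dir_deriv g (dir_deriv f v x) (f x))) (at x)"
      using diff_chain_at[OF f g] by (simp add: o_def)
    \<comment> \<open>The direction in the chain rule varies with \<open>x\<close>, whereas
      differentiability of higher order speaks of fixed directions. Expanding in the basis of the
      middle space leaves finitely many fixed directions of \<open>g\<close>; the induction is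
      general in \<open>g\<close> in order to cover its partial derivatives.\<close>
    have eq: "dir_deriv g w (f x) = (\<Sum>i\<in>Basis. (w \<bullet> i) *\<^sub>R dir_deriv g i (f x))" for w
      by (subst (1) euclidean_representation[symmetric]) (simp only: g.sum g.scaleR)
    show "((\<lambda>x. g (f x)) has_derivative
      (\<lambda>v. \<Sum>i\<in>Basis. (dir_deriv f v x \<bullet> i) *\<^sub>R dir_deriv g i (f x))) (at x)"
      by (rule has_derivative_eq_rhs[OF chain]) (rule ext, rule eq)
  next
    fix v
    show "times_differentiable_on k
        (\<lambda>x. \<Sum>i\<in>Basis. (dir_deriv f v x \<bullet> i) *\<^sub>R dir_deriv g i (f x)) S"
      by (intro times_differentiable_on_sum \<open>open S\<close> Suc.IH
            times_differentiable_on_bilinear[OF \<open>open S\<close> bounded_bilinear_scaleR]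
            times_differentiable_on_linear[where L = "\<lambda>x. x \<bullet> _"] bounded_linear_inner_left)
        (use Suc.prems times_differentiable_on_lower in \<open>auto simp: times_differentiable_on_Suc\<close>)
  qed
qed

section \<open>Calculus of smooth functions\<close>

lemma smooth_on_Suc:
  "smooth_on S f \<longleftrightarrow> (\<forall>x\<in>S. f differentiable (at x)) \<and> (\<forall>v. smooth_on S (dir_deriv f v))"
proof
  assume "smooth_on S f"
  then show "(\<forall>x\<in>S. f differentiable (at x)) \<and> (\<forall>v. smooth_on S (dir_deriv f v))"
    unfolding smooth_on_def by (meson times_differentiable_on_Suc)
next
  assume *: "(\<forall>x\<in>S. f differentiable (at x)) \<and> (\<forall>v. smooth_on S (dir_deriv f v))"
  then have "times_differentiable_on (Suc k) f S" for k
    by (auto simp: smooth_on_def times_differentiable_on_Suc)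
  then show "smooth_on S f"
    unfolding smooth_on_def using times_differentiable_on_lower by blast
qed

lemma smooth_on_dir_deriv: "smooth_on S f \<Longrightarrow> smooth_on S (dir_deriv f v)"
  by (simp add: smooth_on_Suc[of S f])

lemma smooth_on_has_derivative:
  "smooth_on S f \<Longrightarrow> x \<in> S \<Longrightarrow> (f has_derivative (\<lambda>v. dir_deriv f v x)) (at x)"
  by (auto simp: smooth_on_Suc[of S f] intro: has_derivative_dir_deriv)

lemma smooth_on_continuous: "smooth_on S f \<Longrightarrow> continuous_on S f"
  unfolding smooth_on_def by (metis times_differentiable_on.simps(1))

lemma smooth_on_subset: "smooth_on S f \<Longrightarrow> S' \<subseteq> S \<Longrightarrow> smooth_on S' f"
  unfolding smooth_on_def using times_differentiable_on_subset by blast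

lemma smooth_on_local:
  "(\<And>x. x \<in> S \<Longrightarrow> \<exists>U. open U \<and> x \<in> U \<and> smooth_on U f) \<Longrightarrow> smooth_on S f"
  unfolding smooth_on_def by (meson times_differentiable_on_local)

lemma smooth_on_cong:
  assumes "smooth_on S f" "open S" "\<And>x. x \<in> S \<Longrightarrow> f x = g x"
  shows "smooth_on S g"
  using assms times_differentiable_on_cong_imp[of S f g] by (simp add: smooth_on_def)

named_theorems smooth_intros

lemma smooth_on_const [smooth_intros]: "open S \<Longrightarrow> smooth_on S (\<lambda>x. c)"
  by (simp add: smooth_on_def times_differentiable_on_const)

lemma smooth_on_linear:
  "bounded_linear L \<Longrightarrow> open S \<Longrightarrow> smooth_on S f \<Longrightarrow> smooth_on S (\<lambda>x. L (f x))"
  by (simp add: smooth_on_def times_differentiable_on_linear)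

lemma smooth_on_id [smooth_intros]: "open S \<Longrightarrow> smooth_on S (\<lambda>x. x)"
proof -
  assume "open S"
  have "dir_deriv (\<lambda>x::'a. x) v = (\<lambda>x. v)" for v
    by (rule ext) (rule dir_deriv_eqI[OF has_derivative_ident])
  then show ?thesis
    using \<open>open S\<close> by (subst smooth_on_Suc) (simp add: smooth_on_const)
qed

lemma smooth_on_add [smooth_intros]:
  "open S \<Longrightarrow> smooth_on S f \<Longrightarrow> smooth_on S g \<Longrightarrow> smooth_on S (\<lambda>x. f x + g x)"
  by (simp add: smooth_on_def times_differentiable_on_add)

lemma smooth_on_minus [smooth_intros]:
  "open S \<Longrightarrow> smooth_on S f \<Longrightarrow> smooth_on S (\<lambda>x. - f x)"
  by (rule smooth_on_linear[of uminus]) (auto simp: bounded_linear_minus bounded_linear_ident)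

lemma smooth_on_diff [smooth_intros]:
  "open S \<Longrightarrow> smooth_on S f \<Longrightarrow> smooth_on S g \<Longrightarrow> smooth_on S (\<lambda>x. f x - g x)"
  using smooth_on_add[of S f "\<lambda>x. - g x"] smooth_on_minus[of S g] by simp

lemma smooth_on_fst [smooth_intros]: "open S \<Longrightarrow> smooth_on S f \<Longrightarrow> smooth_on S (\<lambda>x. fst (f x))"
  by (rule smooth_on_linear[OF bounded_linear_fst])

lemma smooth_on_snd [smooth_intros]: "open S \<Longrightarrow> smooth_on S f \<Longrightarrow> smooth_on S (\<lambda>x. snd (f x))"
  by (rule smooth_on_linear[OF bounded_linear_snd])

lemma smooth_on_Pair [smooth_intros]:
  assumes "open S" "smooth_on S f" "smooth_on S g"
  shows "smooth_on S (\<lambda>x. (f x, g x))"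
proof -
  have "bounded_linear (\<lambda>a::'b. (a, 0::'c))" "bounded_linear (\<lambda>a::'c. (0::'b, a))"
    by (auto intro!: bounded_linear_Pair bounded_linear_ident bounded_linear_zero)
  then have "smooth_on S (\<lambda>x. (f x, 0) + (0, g x))"
    using assms by (intro smooth_on_add smooth_on_linear[of "\<lambda>a. (a, 0)"] smooth_on_linear[of "\<lambda>a. (0, a)"])
  then show ?thesis by simp
qed

lemma smooth_on_mult [smooth_intros]:
  fixes f g :: "'a::real_normed_vector \<Rightarrow> real"
  shows "open S \<Longrightarrow> smooth_on S f \<Longrightarrow> smooth_on S g \<Longrightarrow> smooth_on S (\<lambda>x. f x * g x)"
  by (simp add: smooth_on_def times_differentiable_on_bilinear bounded_bilinear_mult)

lemma smooth_on_scaleR [smooth_intros]: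
  "open S \<Longrightarrow> smooth_on S f \<Longrightarrow> smooth_on S g \<Longrightarrow> smooth_on S (\<lambda>x. f x *\<^sub>R g x)"
  by (simp add: smooth_on_def times_differentiable_on_bilinear bounded_bilinear_scaleR)

lemma smooth_on_power [smooth_intros]:
  fixes f :: "'a::real_normed_vector \<Rightarrow> real"
  shows "open S \<Longrightarrow> smooth_on S f \<Longrightarrow> smooth_on S (\<lambda>x. f x ^ n)"
  by (induction n) (auto intro!: smooth_intros)

lemma smooth_on_inverse [smooth_intros]:
  fixes f :: "'a::real_normed_vector \<Rightarrow> real"
  shows "open S \<Longrightarrow> smooth_on S f \<Longrightarrow> (\<And>x. x \<in> S \<Longrightarrow> f x \<noteq> 0) \<Longrightarrow> smooth_on S (\<lambda>x. inverse (f x))"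
  by (simp add: smooth_on_def times_differentiable_on_inverse)

lemma smooth_on_divide [smooth_intros]:
  fixes f g :: "'a::real_normed_vector \<Rightarrow> real"
  shows "open S \<Longrightarrow> smooth_on S f \<Longrightarrow> smooth_on S g \<Longrightarrow> (\<And>x. x \<in> S \<Longrightarrow> g x \<noteq> 0) \<Longrightarrow>
    smooth_on S (\<lambda>x. f x / g x)"
  by (simp add: divide_inverse smooth_intros)

lemma smooth_on_sqrt [smooth_intros]:
  fixes f :: "'a::real_normed_vector \<Rightarrow> real"
  shows "open S \<Longrightarrow> smooth_on S f \<Longrightarrow> (\<And>x. x \<in> S \<Longrightarrow> f x > 0) \<Longrightarrow> smooth_on S (\<lambda>x. sqrt (f x))"
  by (simp add: smooth_on_def times_differentiable_on_sqrt)

lemma smooth_on_compose: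
  fixes f :: "'a::real_normed_vector \<Rightarrow> 'b::euclidean_space"
  assumes "smooth_on U g" "smooth_on S f" "open S" "open U" "f ` S \<subseteq> U"
  shows "smooth_on S (\<lambda>x. g (f x))"
  using assms by (simp add: smooth_on_def times_differentiable_on_compose)

text \<open>Two applications of the mean value theorem in each order express the second difference of
  \<open>f\<close> along \<open>v\<close> and \<open>w\<close> by either mixed derivative.\<close>

lemma second_difference_mean_value:
  fixes f :: "'a::real_normed_vector \<Rightarrow> real"
  assumes "smooth_on S f" "s > 0" "\<And>a b. 0 \<le> a \<Longrightarrow> a \<le> s \<Longrightarrow> 0 \<le> b \<Longrightarrow> b \<le> s \<Longrightarrow> x + a *\<^sub>R v + b *\<^sub>R w \<in> S"
  shows "\<exists>a b. 0 < a \<and> a < s \<and> 0 < b \<and> b < s \<and>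
    f (x + s *\<^sub>R v + s *\<^sub>R w) - f (x + s *\<^sub>R v) - f (x + s *\<^sub>R w) + f x =
    s\<^sup>2 * dir_deriv (dir_deriv f v) w (x + a *\<^sub>R v + b *\<^sub>R w)"
proof -
  let ?g = "\<lambda>a. f (x + a *\<^sub>R v + s *\<^sub>R w) - f (x + a *\<^sub>R v)"
  have line: "((\<lambda>a. h (y + a *\<^sub>R u)) has_real_derivative dir_deriv h u (y + a *\<^sub>R u)) (at a)"
    if h: "smooth_on S h" and "y + a *\<^sub>R u \<in> S" for h :: "'a \<Rightarrow> real" and y u a
  proof -
    note d = smooth_on_has_derivative[OF h that(2)]
    interpret bounded_linear "\<lambda>v. dir_deriv h v (y + a *\<^sub>R u)"
      using d by (rule has_derivative_bounded_linear)
    have "((\<lambda>a. y + a *\<^sub>R u) has_derivative (\<lambda>t. t *\<^sub>R u)) (at a)"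
      by (auto intro!: derivative_eq_intros)
    from diff_chain_at[OF this d] show ?thesis
      unfolding has_field_derivative_def o_def
      by (rule has_derivative_eq_rhs) (simp add: fun_eq_iff scaleR)
  qed
  have "\<exists>a. 0 < a \<and> a < s \<and> ?g s - ?g 0 = (s - 0) *
      (dir_deriv f v (x + a *\<^sub>R v + s *\<^sub>R w) - dir_deriv f v (x + a *\<^sub>R v))"
  proof (rule MVT2[OF \<open>s > 0\<close>], rule DERIV_diff)
    fix a assume a: "0 \<le> a" "a \<le> s"
    show "((\<lambda>a. f (x + a *\<^sub>R v + s *\<^sub>R w)) has_real_derivative
        dir_deriv f v (x + a *\<^sub>R v + s *\<^sub>R w)) (at a)"
      using line[OF assms(1), of "x + s *\<^sub>R w" a v] assms(3)[of a s] a \<open>s > 0\<close>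
      by (simp add: algebra_simps)
    show "((\<lambda>a. f (x + a *\<^sub>R v)) has_real_derivative dir_deriv f v (x + a *\<^sub>R v)) (at a)"
      using line[OF assms(1), of x a v] assms(3)[of a 0] a \<open>s > 0\<close> by simp
  qed
  then obtain a where a: "0 < a" "a < s" and ga: "?g s - ?g 0 = s *
      (dir_deriv f v (x + a *\<^sub>R v + s *\<^sub>R w) - dir_deriv f v (x + a *\<^sub>R v))" by auto
  have "\<exists>b. 0 < b \<and> b < s \<and> dir_deriv f v (x + a *\<^sub>R v + s *\<^sub>R w) - dir_deriv f v (x + a *\<^sub>R v + 0 *\<^sub>R w) =
      (s - 0) * dir_deriv (dir_deriv f v) w (x + a *\<^sub>R v + b *\<^sub>R w)"
    by (rule MVT2[OF \<open>s > 0\<close>], rule line) (use a assms(3) smooth_on_dir_deriv[OF assms(1)] in auto)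
  then obtain b where b: "0 < b" "b < s"
    and gb: "dir_deriv f v (x + a *\<^sub>R v + s *\<^sub>R w) - dir_deriv f v (x + a *\<^sub>R v) =
      s * dir_deriv (dir_deriv f v) w (x + a *\<^sub>R v + b *\<^sub>R w)" by auto
  have "f (x + s *\<^sub>R v + s *\<^sub>R w) - f (x + s *\<^sub>R v) - f (x + s *\<^sub>R w) + f x = ?g s - ?g 0"
    by simp
  also have "\<dots> = s\<^sup>2 * dir_deriv (dir_deriv f v) w (x + a *\<^sub>R v + b *\<^sub>R w)"
    using ga gb by (simp add: power2_eq_square)
  finally show ?thesis using a b by blast
qed

text \<open>Both iterated derivatives, each taken at some intermediate point of the parallelogram
  with sides \<open>s n\<close> times \<open>v\<close> and \<open>w\<close>, equal the same second
  difference divided by \<open>(s n)\<^sup>2\<close>. As \<open>s n\<close> tends to 0 these points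
  tend to \<open>x\<close>, and the second derivatives are continuous.\<close>

lemma dir_deriv_commute:
  fixes f :: "'a::real_normed_vector \<Rightarrow> real"
  assumes "open S" "smooth_on S f" "x \<in> S"
  shows "dir_deriv (dir_deriv f v) w x = dir_deriv (dir_deriv f w) v x"
proof -
  have tendsto: "((\<lambda>n. F (x + a n *\<^sub>R v + b n *\<^sub>R w)) \<longlonglongrightarrow> F x)"
    if F: "continuous_on S F" and "\<And>n. 0 < a n \<and> a n < d * inverse (real (Suc n))"
      "\<And>n. 0 < b n \<and> b n < d * inverse (real (Suc n))"
    for F :: "'a \<Rightarrow> real" and a b d
  proof -
    have lim: "(\<lambda>n. d * inverse (real (Suc n))) \<longlonglongrightarrow> 0"
      using tendsto_mult_left[OF LIMSEQ_inverse_real_of_nat, of d] by simp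
    have "a \<longlonglongrightarrow> 0" "b \<longlonglongrightarrow> 0"
      by (rule real_tendsto_sandwich[OF _ _ tendsto_const lim]; use that in \<open>auto intro!: always_eventually less_imp_le\<close>)+
    then have "(\<lambda>n. x + a n *\<^sub>R v + b n *\<^sub>R w) \<longlonglongrightarrow> x + 0 *\<^sub>R v + 0 *\<^sub>R w"
      by (intro tendsto_intros)
    moreover have "isCont F x" using F assms by (simp add: continuous_on_eq_continuous_at)
    ultimately show ?thesis using isCont_tendsto_compose[of x F] by simp
  qed
  obtain e where e: "e > 0" "ball x e \<subseteq> S" using assms(1,3) by (auto simp: open_contains_ball)
  \<comment> \<open>The parallelogram with sides \<open>d\<close> times \<open>v\<close> and
    \<open>w\<close> stays in the ball; the summand 1 keeps the denominator positive if
    \<open>v = w = 0\<close>.\<close>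
  define d where "d = e / (norm v + norm w + 1)"
  have pos: "norm v + norm w + 1 > 0" by (simp add: add_nonneg_pos)
  have d: "d > 0" using e pos by (simp add: d_def)
  have inS: "x + a *\<^sub>R v + b *\<^sub>R w \<in> S" if "0 \<le> a" "a \<le> d" "0 \<le> b" "b \<le> d" for a b
  proof -
    have "norm (a *\<^sub>R v + b *\<^sub>R w) \<le> d * norm v + d * norm w"
      using that by (intro order_trans[OF norm_triangle_ineq] add_mono) (auto intro: mult_right_mono)
    also have "\<dots> < d * (norm v + norm w + 1)" using d by (simp add: algebra_simps)
    also have "\<dots> = e" using pos by (simp add: d_def)
    finally show ?thesis using e(2) by (intro subsetD[OF e(2)]) (simp add: dist_norm algebra_simps norm_minus_commute)
  qed
  define s where "s n = d * inverse (real (Suc n))" for n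
  have s: "0 < s n" "s n \<le> d" for n
    using d by (auto simp: s_def field_simps)
  have "\<forall>n. \<exists>a b. 0 < a \<and> a < s n \<and> 0 < b \<and> b < s n \<and>
      f (x + s n *\<^sub>R v + s n *\<^sub>R w) - f (x + s n *\<^sub>R v) - f (x + s n *\<^sub>R w) + f x =
      (s n)\<^sup>2 * dir_deriv (dir_deriv f v) w (x + a *\<^sub>R v + b *\<^sub>R w)"
    using s by (intro allI second_difference_mean_value[OF assms(2)] inS) (auto intro: order_trans)
  then obtain a b where ab: "\<And>n. 0 < a n \<and> a n < s n \<and> 0 < b n \<and> b n < s n \<and>
      f (x + s n *\<^sub>R v + s n *\<^sub>R w) - f (x + s n *\<^sub>R v) - f (x + s n *\<^sub>R w) + f x =
      (s n)\<^sup>2 * dir_deriv (dir_deriv f v) w (x + a n *\<^sub>R v + b n *\<^sub>R w)" by metis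
  have inS': "x + a *\<^sub>R w + b *\<^sub>R v \<in> S" if "0 \<le> a" "a \<le> d" "0 \<le> b" "b \<le> d" for a b
    using inS[of b a] that by (simp add: algebra_simps)
  have "\<forall>n. \<exists>a b. 0 < a \<and> a < s n \<and> 0 < b \<and> b < s n \<and>
      f (x + s n *\<^sub>R w + s n *\<^sub>R v) - f (x + s n *\<^sub>R w) - f (x + s n *\<^sub>R v) + f x =
      (s n)\<^sup>2 * dir_deriv (dir_deriv f w) v (x + a *\<^sub>R w + b *\<^sub>R v)"
    using s by (intro allI second_difference_mean_value[OF assms(2)] inS') (auto intro: order_trans)
  then obtain a' b' where ab': "\<And>n. 0 < a' n \<and> a' n < s n \<and> 0 < b' n \<and> b' n < s n \<and>
      f (x + s n *\<^sub>R w + s n *\<^sub>R v) - f (x + s n *\<^sub>R w) - f (x + s n *\<^sub>R v) + f x =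
      (s n)\<^sup>2 * dir_deriv (dir_deriv f w) v (x + a' n *\<^sub>R w + b' n *\<^sub>R v)" by metis
  have "dir_deriv (dir_deriv f v) w (x + a n *\<^sub>R v + b n *\<^sub>R w) =
      dir_deriv (dir_deriv f w) v (x + b' n *\<^sub>R v + a' n *\<^sub>R w)" for n
  proof -
    have "(s n)\<^sup>2 * dir_deriv (dir_deriv f v) w (x + a n *\<^sub>R v + b n *\<^sub>R w) =
      (s n)\<^sup>2 * dir_deriv (dir_deriv f w) v (x + b' n *\<^sub>R v + a' n *\<^sub>R w)"
      using ab[of n] ab'[of n] by (simp add: algebra_simps)
    then show ?thesis using s(1)[of n] by simp
  qed
  moreover have "(\<lambda>n. dir_deriv (dir_deriv f v) w (x + a n *\<^sub>R v + b n *\<^sub>R w)) \<longlonglongrightarrow> dir_deriv (dir_deriv f v) w x"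
    by (rule tendsto[where d = d]) (use ab in \<open>auto simp: s_def intro!: smooth_on_continuous smooth_on_dir_deriv assms\<close>)
  moreover have "(\<lambda>n. dir_deriv (dir_deriv f w) v (x + b' n *\<^sub>R v + a' n *\<^sub>R w)) \<longlonglongrightarrow> dir_deriv (dir_deriv f w) v x"
    by (rule tendsto[where d = d]) (use ab' in \<open>auto simp: s_def intro!: smooth_on_continuous smooth_on_dir_deriv assms\<close>)
  ultimately show ?thesis by (simp add: LIMSEQ_unique)
qed

section \<open>Derivatives along vector fields\<close>

text \<open>A vector field may take the place of \<open>f\<close> and is then differentiated
  componentwise, so that \<open>lie e1 e2 q - lie e2 e1 q\<close> is the Lie bracket of
  \<open>e1\<close> and \<open>e2\<close> at \<open>q\<close>.\<close>

definition lie :: "('a::real_normed_vector \<Rightarrow> 'a) \<Rightarrow> ('a \<Rightarrow> 'b::real_normed_vector) \<Rightarrow> 'a \<Rightarrow> 'b" where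
  "lie e f q = dir_deriv f (e q) q"

lemma lie_eqI: "(f has_derivative f') (at q) \<Longrightarrow> lie e f q = f' (e q)"
  by (simp add: lie_def dir_deriv_eqI)

lemma lie_cong:
  "open S \<Longrightarrow> q \<in> S \<Longrightarrow> (\<And>y. y \<in> S \<Longrightarrow> f y = g y) \<Longrightarrow> lie e f q = lie e g q"
  unfolding lie_def by (rule dir_deriv_cong)

lemma lie_const [simp]: "lie e (\<lambda>x. c) q = 0"
  by (rule lie_eqI[OF has_derivative_const, THEN trans]) simp

lemma lie_add:
  "smooth_on S f \<Longrightarrow> smooth_on S g \<Longrightarrow> q \<in> S \<Longrightarrow> lie e (\<lambda>x. f x + g x) q = lie e f q + lie e g q"
  by (rule lie_eqI[OF has_derivative_add, THEN trans])
    (auto intro: smooth_on_has_derivative simp: lie_def)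

lemma lie_diff:
  "smooth_on S f \<Longrightarrow> smooth_on S g \<Longrightarrow> q \<in> S \<Longrightarrow> lie e (\<lambda>x. f x - g x) q = lie e f q - lie e g q"
  by (rule lie_eqI[OF has_derivative_diff, THEN trans])
    (auto intro: smooth_on_has_derivative simp: lie_def)

lemma lie_mult:
  fixes f g :: "'a::real_normed_vector \<Rightarrow> real"
  shows "smooth_on S f \<Longrightarrow> smooth_on S g \<Longrightarrow> q \<in> S \<Longrightarrow>
    lie e (\<lambda>x. f x * g x) q = f q * lie e g q + g q * lie e f q"
  by (rule lie_eqI[OF has_derivative_mult, THEN trans])
    (auto intro: smooth_on_has_derivative simp: lie_def)

lemma lie_scaleR:
  "smooth_on S f \<Longrightarrow> smooth_on S g \<Longrightarrow> q \<in> S \<Longrightarrow>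
    lie e (\<lambda>x. f x *\<^sub>R g x) q = f q *\<^sub>R lie e g q + lie e f q *\<^sub>R g q"
  by (rule lie_eqI[OF has_derivative_scaleR, THEN trans])
    (auto intro: smooth_on_has_derivative simp: lie_def)

lemma lie_inner:
  fixes f g :: "'a::real_normed_vector \<Rightarrow> 'b::real_inner"
  shows "smooth_on S f \<Longrightarrow> smooth_on S g \<Longrightarrow> q \<in> S \<Longrightarrow>
    lie e (\<lambda>x. f x \<bullet> g x) q = f q \<bullet> lie e g q + lie e f q \<bullet> g q"
  by (rule lie_eqI[OF has_derivative_inner, THEN trans])
    (auto intro: smooth_on_has_derivative simp: lie_def)

text \<open>Trades the variable direction \<open>e q\<close> for fixed ones; this is what makes
  \<open>lie e f\<close> smooth and lets iterated derivatives be compared.\<close>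

lemma lie_expand:
  fixes e :: "'a::euclidean_space \<Rightarrow> 'a"
  assumes "smooth_on S f" "q \<in> S"
  shows "lie e f q = (\<Sum>i\<in>Basis. (e q \<bullet> i) *\<^sub>R dir_deriv f i q)"
proof -
  interpret bounded_linear "\<lambda>v. dir_deriv f v q"
    using smooth_on_has_derivative[OF assms] by (rule has_derivative_bounded_linear)
  show ?thesis
    unfolding lie_def by (subst (1) euclidean_representation[symmetric]) (simp only: sum scaleR)
qed

lemma smooth_on_sum:
  "open S \<Longrightarrow> (\<And>i. i \<in> I \<Longrightarrow> smooth_on S (f i)) \<Longrightarrow> smooth_on S (\<lambda>x. \<Sum>i\<in>I. f i x)"
  by (simp add: smooth_on_def times_differentiable_on_sum)

lemma smooth_on_inner_const:
  "open S \<Longrightarrow> smooth_on S f \<Longrightarrow> smooth_on S (\<lambda>x. f x \<bullet> i)"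
  by (rule smooth_on_linear[OF bounded_linear_inner_left])

lemma smooth_on_lie [smooth_intros]:
  fixes e :: "'a::euclidean_space \<Rightarrow> 'a"
  assumes "open S" "smooth_on S e" "smooth_on S f"
  shows "smooth_on S (lie e f)"
proof (rule smooth_on_cong)
  show "smooth_on S (\<lambda>q. \<Sum>i\<in>Basis. (e q \<bullet> i) *\<^sub>R dir_deriv f i q)"
    by (intro smooth_on_sum smooth_on_scaleR smooth_on_inner_const smooth_on_dir_deriv assms)
qed (simp_all add: assms lie_expand[OF assms(3)])

text \<open>Only the value of the vector field at \<open>q\<close> matters, so the relation between
  the fields is demanded at this one point and \<open>a\<close>, \<open>b\<close> may be values of
  functions.\<close>

lemma lie_lincomb:
  assumes "smooth_on S f" "q \<in> S" "e q = a *\<^sub>R e1 q + b *\<^sub>R e2 q"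
  shows "lie e f q = a *\<^sub>R lie e1 f q + b *\<^sub>R lie e2 f q"
proof -
  interpret bounded_linear "\<lambda>v. dir_deriv f v q"
    using smooth_on_has_derivative[OF assms(1,2)] by (rule has_derivative_bounded_linear)
  show ?thesis by (simp add: lie_def assms(3) add scaleR)
qed

text \<open>Expanding both iterated derivatives in a basis leaves second-order terms that cancel by
  the symmetry of second derivatives; what remains is the derivative of \<open>f\<close> along the
  Lie bracket.\<close>

lemma lie_commutator:
  fixes e1 e2 :: "'a::euclidean_space \<Rightarrow> 'a" and f :: "'a \<Rightarrow> real"
  assumes "open S" "smooth_on S e1" "smooth_on S e2" "smooth_on S f" "q \<in> S"
  shows "lie e1 (lie e2 f) q - lie e2 (lie e1 f) q = dir_deriv f (lie e1 e2 q - lie e2 e1 q) q"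
proof -
  interpret bounded_linear "\<lambda>v. dir_deriv f v q"
    using smooth_on_has_derivative[OF assms(4,5)] by (rule has_derivative_bounded_linear)
  have expand: "lie e (lie e' f) q =
      dir_deriv f (lie e e' q) q +
      (\<Sum>i\<in>Basis. \<Sum>j\<in>Basis. (e' q \<bullet> i) * (e q \<bullet> j) * dir_deriv (dir_deriv f i) j q)"
    if e: "smooth_on S e" "smooth_on S e'" for e e'
  proof -
    have "lie e (lie e' f) q = lie e (\<lambda>q. \<Sum>i\<in>Basis. (e' q \<bullet> i) *\<^sub>R dir_deriv f i q) q"
      by (rule lie_cong[OF \<open>open S\<close> \<open>q \<in> S\<close>]) (rule lie_expand[OF assms(4)])
    also have "\<dots> = (\<Sum>i\<in>Basis. (e' q \<bullet> i) * lie e (dir_deriv f i) q + (lie e e' q \<bullet> i) * dir_deriv f i q)"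
    proof (rule lie_eqI[OF has_derivative_sum, THEN trans])
      show "((\<lambda>q. (e' q \<bullet> i) *\<^sub>R dir_deriv f i q) has_derivative
        (\<lambda>v. (e' q \<bullet> i) *\<^sub>R dir_deriv (dir_deriv f i) v q + (dir_deriv e' v q \<bullet> i) *\<^sub>R dir_deriv f i q)) (at q)" for i
        by (intro has_derivative_scaleR has_derivative_inner_left smooth_on_has_derivative[OF _ \<open>q \<in> S\<close>]
            smooth_on_dir_deriv assms e)
    qed (simp add: lie_def)
    also have "\<dots> = (\<Sum>i\<in>Basis. (e' q \<bullet> i) * lie e (dir_deriv f i) q) + dir_deriv f (lie e e' q) q"
      using lie_expand[OF assms(4,5), of "\<lambda>_. lie e e' q"] by (simp add: sum.distrib lie_def)
    also have "(\<Sum>i\<in>Basis. (e' q \<bullet> i) * lie e (dir_deriv f i) q) =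
        (\<Sum>i\<in>Basis. \<Sum>j\<in>Basis. (e' q \<bullet> i) * (e q \<bullet> j) * dir_deriv (dir_deriv f i) j q)"
      by (simp add: lie_expand[OF smooth_on_dir_deriv[OF assms(4)] assms(5)] sum_distrib_left mult.assoc)
    finally show ?thesis by simp
  qed
  have "(\<Sum>i\<in>Basis. \<Sum>j\<in>Basis. (e2 q \<bullet> i) * (e1 q \<bullet> j) * dir_deriv (dir_deriv f i) j q) =
      (\<Sum>i\<in>Basis. \<Sum>j\<in>Basis. (e1 q \<bullet> i) * (e2 q \<bullet> j) * dir_deriv (dir_deriv f i) j q)"
    by (subst sum.swap) (simp add: dir_deriv_commute[OF assms(1,4,5)] mult_ac)
  then show ?thesis
    using expand[OF assms(2,3)] expand[OF assms(3,2)] by (simp add: diff)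
qed

section \<open>Quadratic forms in a moving frame\<close>

text \<open>The mixed coefficient is not halved. In a frame the form is therefore nondegenerate iff
  \<open>4 * a q * c q - (b q)\<^sup>2\<close> is nonzero, and this expression recurs below.\<close>

definition frame_form ::
    "(real \<times> real \<Rightarrow> real \<times> real) \<Rightarrow> (real \<times> real \<Rightarrow> real \<times> real) \<Rightarrow>
     (real \<times> real \<Rightarrow> real) \<Rightarrow> (real \<times> real \<Rightarrow> real) \<Rightarrow> (real \<times> real \<Rightarrow> real) \<Rightarrow>
     (real \<times> real) \<times> (real \<times> real) \<Rightarrow> real" where
  "frame_form e1 e2 a b c = (\<lambda>(q, p).
     a q * (p \<bullet> e1 q)\<^sup>2 + b q * (p \<bullet> e1 q) * (p \<bullet> e2 q) + c q * (p \<bullet> e2 q)\<^sup>2)"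

lemma frame_form_has_derivative:
  assumes "smooth_on S e1" "smooth_on S e2" "smooth_on S a" "smooth_on S b" "smooth_on S c" "q \<in> S"
  shows "(frame_form e1 e2 a b c has_derivative (\<lambda>(v, w).
      (dir_deriv a v q * (p \<bullet> e1 q)\<^sup>2 + dir_deriv b v q * (p \<bullet> e1 q) * (p \<bullet> e2 q) + dir_deriv c v q * (p \<bullet> e2 q)\<^sup>2)
      + (2 * a q * (p \<bullet> e1 q) + b q * (p \<bullet> e2 q)) * (w \<bullet> e1 q + p \<bullet> dir_deriv e1 v q)
      + (b q * (p \<bullet> e1 q) + 2 * c q * (p \<bullet> e2 q)) * (w \<bullet> e2 q + p \<bullet> dir_deriv e2 v q))) (at (q, p))"
proof -
  have *: "((\<lambda>z. f (fst z)) has_derivative (\<lambda>v. dir_deriv f (fst v) q)) (at (q, p))"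
    if "smooth_on S f" for f :: "real \<times> real \<Rightarrow> 'x::real_normed_vector"
    using diff_chain_at[OF has_derivative_fst[OF has_derivative_ident],
        of f "\<lambda>v. dir_deriv f v q" "(q, p)"]
      smooth_on_has_derivative[OF that \<open>q \<in> S\<close>] by (simp add: o_def)
  show ?thesis
    unfolding frame_form_def split_beta
    by (rule derivative_eq_intros *[OF assms(1)] *[OF assms(2)] *[OF assms(3)] *[OF assms(4)] *[OF assms(5)] refl)+
      (auto simp: fun_eq_iff algebra_simps power2_eq_square)
qed

text \<open>The Leibniz rule in the variables \<open>q\<close>, \<open>P1\<close>,
  \<open>P2\<close>. The first four lines pair the derivatives of one form along \<open>e1\<close>
  and \<open>e2\<close>, with the momenta held fixed, with the derivatives of the other in
  \<open>P1\<close> and \<open>P2\<close>. The last summand is the bracket of \<open>P1\<close> and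
  \<open>P2\<close>, which is \<open>p \<bullet> (lie e2 e1 q - lie e1 e2 q)\<close>, times the
  functional determinant of the two forms in \<open>P1\<close> and \<open>P2\<close>.\<close>

lemma poisson_bracket_frame_form:
  fixes p q :: "real \<times> real"
  assumes "smooth_on S e1" "smooth_on S e2"
    "smooth_on S h11" "smooth_on S h12" "smooth_on S h22"
    "smooth_on S f11" "smooth_on S f12" "smooth_on S f22" "q \<in> S"
  defines "P1 \<equiv> p \<bullet> e1 q" and "P2 \<equiv> p \<bullet> e2 q"
  shows "poisson_bracket (frame_form e1 e2 h11 h12 h22) (frame_form e1 e2 f11 f12 f22) (q, p) =
    (lie e1 h11 q * P1\<^sup>2 + lie e1 h12 q * P1 * P2 + lie e1 h22 q * P2\<^sup>2) * (2 * f11 q * P1 + f12 q * P2)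
    - (lie e1 f11 q * P1\<^sup>2 + lie e1 f12 q * P1 * P2 + lie e1 f22 q * P2\<^sup>2) * (2 * h11 q * P1 + h12 q * P2)
    + (lie e2 h11 q * P1\<^sup>2 + lie e2 h12 q * P1 * P2 + lie e2 h22 q * P2\<^sup>2) * (f12 q * P1 + 2 * f22 q * P2)
    - (lie e2 f11 q * P1\<^sup>2 + lie e2 f12 q * P1 * P2 + lie e2 f22 q * P2\<^sup>2) * (h12 q * P1 + 2 * h22 q * P2)
    + (p \<bullet> (lie e2 e1 q - lie e1 e2 q)) *
      ((2 * h11 q * P1 + h12 q * P2) * (f12 q * P1 + 2 * f22 q * P2)
       - (h12 q * P1 + 2 * h22 q * P2) * (2 * f11 q * P1 + f12 q * P2))"
proof -
  obtain x1 y1 where e1: "e1 q = (x1, y1)" by force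
  obtain x2 y2 where e2: "e2 q = (x2, y2)" by force
  have lie: "lie e f q = fst (e q) *\<^sub>R dir_deriv f (1, 0) q + snd (e q) *\<^sub>R dir_deriv f (0, 1) q"
    if "smooth_on S f" for e and f :: "real \<times> real \<Rightarrow> 'x::real_normed_vector"
    using lie_expand[OF that \<open>q \<in> S\<close>, of e] by (simp add: Basis_prod_def inner_prod_def prod.case_eq_if)
  have lin: "dir_deriv f (0, 0) q = 0" if "smooth_on S f" for f :: "real \<times> real \<Rightarrow> 'x::real_normed_vector"
    using has_derivative_bounded_linear[OF smooth_on_has_derivative[OF that \<open>q \<in> S\<close>]]
    by (metis linear_0 linear_conv_bounded_linear zero_prod_def)
  note fd = frame_form_has_derivative[OF assms(1,2) _ _ _ \<open>q \<in> S\<close>, THEN frechet_derivative_at, symmetric]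
  show ?thesis
    unfolding poisson_bracket_def Let_def fd[OF assms(3-5)] fd[OF assms(6-8)]
      lie[OF assms(1)] lie[OF assms(2)] lie[OF assms(3)] lie[OF assms(4)] lie[OF assms(5)]
      lie[OF assms(6)] lie[OF assms(7)] lie[OF assms(8)] P1_def[symmetric] P2_def[symmetric]
    by (simp add: e1 e2 lin[OF assms(1)] lin[OF assms(2)] lin[OF assms(3)] lin[OF assms(4)] lin[OF assms(5)]
        lin[OF assms(6)] lin[OF assms(7)] lin[OF assms(8)] inner_diff_right inner_add_right inner_zero_left)
      (simp add: algebra_simps power2_eq_square)
qed

lemma binary_cubic_eq_0:
  fixes A B C D :: real
  assumes "\<And>x y. A * x ^ 3 + B * x\<^sup>2 * y + C * x * y\<^sup>2 + D * y ^ 3 = 0"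
  shows "A = 0" "B = 0" "C = 0" "D = 0"
  using assms[of 1 0] assms[of 0 1] assms[of 1 1] assms[of 1 "-1"] by auto

definition frame_at :: "real \<times> real \<Rightarrow> real \<times> real \<Rightarrow> bool" where
  "frame_at e1 e2 \<longleftrightarrow> fst e1 * snd e2 - fst e2 * snd e1 \<noteq> 0"

lemma frame_at_momentum:
  assumes "frame_at e1 e2"
  obtains p :: "real \<times> real" where "p \<bullet> e1 = x" "p \<bullet> e2 = y"
proof
  let ?d = "fst e1 * snd e2 - fst e2 * snd e1"
  let ?p = "((snd e2 * x - snd e1 * y) / ?d, (fst e1 * y - fst e2 * x) / ?d)"
  have d: "?d \<noteq> 0" using assms by (simp add: frame_at_def)
  show "?p \<bullet> e1 = x" using d
    by (simp add: inner_prod_def divide_simps) (simp add: algebra_simps)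
  show "?p \<bullet> e2 = y" using d
    by (simp add: inner_prod_def divide_simps) (simp add: algebra_simps)
qed

lemma frame_at_vector:
  assumes "frame_at e1 e2"
  obtains a b where "v = a *\<^sub>R e1 + b *\<^sub>R e2"
proof
  let ?d = "fst e1 * snd e2 - fst e2 * snd e1"
  have d: "?d \<noteq> 0" using assms by (simp add: frame_at_def)
  show "v = ((fst v * snd e2 - snd v * fst e2) / ?d) *\<^sub>R e1 + ((snd v * fst e1 - fst v * snd e1) / ?d) *\<^sub>R e2"
    using d by (intro prod_eqI) (simp_all add: divide_simps, simp_all add: algebra_simps)
qed

text \<open>The momenta of a frame take every pair of values, so the bracket vanishes as a cubic.
  The four equations are its coefficients at \<open>P1\<^sup>3\<close>,
  \<open>P1\<^sup>2 P2\<close>, \<open>P1 P2\<^sup>2\<close> and \<open>P2\<^sup>3\<close>, in this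
  order; \<open>c1\<close> and \<open>c2\<close> are the components of minus the Lie bracket of
  \<open>e1\<close> and \<open>e2\<close>.\<close>

lemma frame_form_integral_equations:
  assumes smooth: "smooth_on S e1" "smooth_on S e2"
    "smooth_on S h11" "smooth_on S h12" "smooth_on S h22"
    "smooth_on S f11" "smooth_on S f12" "smooth_on S f22" "q \<in> S"
    and frame: "frame_at (e1 q) (e2 q)"
    and integral: "\<And>p. poisson_bracket (frame_form e1 e2 h11 h12 h22) (frame_form e1 e2 f11 f12 f22) (q, p) = 0"
    and c: "lie e2 e1 q - lie e1 e2 q = c1 *\<^sub>R e1 q + c2 *\<^sub>R e2 q"
  shows "2 * f11 q * lie e1 h11 q - 2 * h11 q * lie e1 f11 q + f12 q * lie e2 h11 q - h12 q * lie e2 f11 q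
      + c1 * (2 * (h11 q * f12 q - h12 q * f11 q)) = 0" (is ?E1)
    and "2 * f11 q * lie e1 h12 q + f12 q * lie e1 h11 q - 2 * h11 q * lie e1 f12 q - h12 q * lie e1 f11 q
      + f12 q * lie e2 h12 q + 2 * f22 q * lie e2 h11 q - h12 q * lie e2 f12 q - 2 * h22 q * lie e2 f11 q
      + c1 * (4 * (h11 q * f22 q - h22 q * f11 q)) + c2 * (2 * (h11 q * f12 q - h12 q * f11 q)) = 0" (is ?E2)
    and "2 * f11 q * lie e1 h22 q + f12 q * lie e1 h12 q - 2 * h11 q * lie e1 f22 q - h12 q * lie e1 f12 q
      + f12 q * lie e2 h22 q + 2 * f22 q * lie e2 h12 q - h12 q * lie e2 f22 q - 2 * h22 q * lie e2 f12 q
      + c1 * (2 * (h12 q * f22 q - h22 q * f12 q)) + c2 * (4 * (h11 q * f22 q - h22 q * f11 q)) = 0" (is ?E3)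
    and "f12 q * lie e1 h22 q - h12 q * lie e1 f22 q + 2 * f22 q * lie e2 h22 q - 2 * h22 q * lie e2 f22 q
      + c2 * (2 * (h12 q * f22 q - h22 q * f12 q)) = 0" (is ?E4)
proof -
  let ?A = "2 * f11 q * lie e1 h11 q - 2 * h11 q * lie e1 f11 q + f12 q * lie e2 h11 q - h12 q * lie e2 f11 q
      + c1 * (2 * (h11 q * f12 q - h12 q * f11 q))"
  let ?B = "2 * f11 q * lie e1 h12 q + f12 q * lie e1 h11 q - 2 * h11 q * lie e1 f12 q - h12 q * lie e1 f11 q
      + f12 q * lie e2 h12 q + 2 * f22 q * lie e2 h11 q - h12 q * lie e2 f12 q - 2 * h22 q * lie e2 f11 q
      + c1 * (4 * (h11 q * f22 q - h22 q * f11 q)) + c2 * (2 * (h11 q * f12 q - h12 q * f11 q))"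
  let ?C = "2 * f11 q * lie e1 h22 q + f12 q * lie e1 h12 q - 2 * h11 q * lie e1 f22 q - h12 q * lie e1 f12 q
      + f12 q * lie e2 h22 q + 2 * f22 q * lie e2 h12 q - h12 q * lie e2 f22 q - 2 * h22 q * lie e2 f12 q
      + c1 * (2 * (h12 q * f22 q - h22 q * f12 q)) + c2 * (4 * (h11 q * f22 q - h22 q * f11 q))"
  let ?D = "f12 q * lie e1 h22 q - h12 q * lie e1 f22 q + 2 * f22 q * lie e2 h22 q - 2 * h22 q * lie e2 f22 q
      + c2 * (2 * (h12 q * f22 q - h22 q * f12 q))"
  have "?A * x ^ 3 + ?B * x\<^sup>2 * y + ?C * x * y\<^sup>2 + ?D * y ^ 3 = 0" for x y
  proof -
    obtain p where p: "p \<bullet> e1 q = x" "p \<bullet> e2 q = y" using frame_at_momentum[OF frame] .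
    show ?thesis
      using integral[of p] unfolding poisson_bracket_frame_form[OF smooth] c
      by (simp add: p inner_add_right) (simp add: algebra_simps power2_eq_square power3_eq_cube)
  qed
  from binary_cubic_eq_0[OF this] show ?E1 ?E2 ?E3 ?E4 by blast+
qed

section \<open>Closed forms and coordinates\<close>

lemma smooth_onI:
  assumes "open S" "\<And>x. x \<in> S \<Longrightarrow> (f has_derivative (\<lambda>v. f' v x)) (at x)" "\<And>v. smooth_on S (f' v)"
  shows "smooth_on S f"
proof -
  have "times_differentiable_on (Suc k) f S" for k
    using assms(3) by (intro times_differentiable_on_SucI[OF assms(1,2)]) (auto simp: smooth_on_def)
  then show ?thesis unfolding smooth_on_def using times_differentiable_on_lower by blast
qed

text \<open>The potential is the integral of \<open>\<theta>\<close> along the segment from \<open>q0\<close>; since \<open>\<theta>\<close> is closed, the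
  derivative of the integrand in \<open>q\<close> is the \<open>t\<close>-derivative of \<open>t \<theta>(q0 + t (q - q0))\<close>.\<close>

lemma closed_form_potential:
  fixes \<theta> :: "'a::euclidean_space \<Rightarrow> 'a"
  assumes "open S" "convex S" "q0 \<in> S" "smooth_on S \<theta>"
    and closed: "\<And>q v w. q \<in> S \<Longrightarrow> dir_deriv \<theta> v q \<bullet> w = dir_deriv \<theta> w q \<bullet> v"
  obtains \<phi> :: "'a \<Rightarrow> real" where "\<phi> q0 = 0" "smooth_on S \<phi>"
    "\<And>q. q \<in> S \<Longrightarrow> (\<phi> has_derivative (\<lambda>v. \<theta> q \<bullet> v)) (at q)"
proof -
  define \<gamma> where "\<gamma> x t = q0 + t *\<^sub>R (x - q0)" for x and t :: real
  \<comment> \<open>The derivative along \<open>x - q0\<close> is expanded in the basis because this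
    direction varies with \<open>x\<close>; continuity in \<open>(x, t)\<close> jointly then follows
    from that of the derivatives in fixed directions.\<close>
  define W where "W x t = \<theta> (\<gamma> x t) + t *\<^sub>R (\<Sum>i\<in>Basis. ((x - q0) \<bullet> i) *\<^sub>R dir_deriv \<theta> i (\<gamma> x t))" for x t
  define \<phi> where "\<phi> x = integral (cbox 0 1) (\<lambda>t. \<theta> (\<gamma> x t) \<bullet> (x - q0))" for x
  have inS: "\<gamma> x t \<in> S" if "x \<in> S" "t \<in> cbox 0 1" for x t
  proof -
    have "\<gamma> x t = (1 - t) *\<^sub>R q0 + t *\<^sub>R x" by (simp add: \<gamma>_def algebra_simps)
    then show ?thesis using that assms(2,3) by (auto simp: convex_alt)
  qed
  have W: "W x t = \<theta> (\<gamma> x t) + t *\<^sub>R dir_deriv \<theta> (x - q0) (\<gamma> x t)" if "x \<in> S" "t \<in> cbox 0 1" for x t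
    using lie_expand[OF assms(4) inS[OF that], of "\<lambda>_. x - q0"] by (simp add: W_def lie_def)
  have "continuous_on (S \<times> cbox 0 1) (\<lambda>z. \<gamma> (fst z) (snd z))"
    unfolding \<gamma>_def by (intro continuous_intros)
  then have cont: "continuous_on (S \<times> cbox 0 1) (\<lambda>z. f (\<gamma> (fst z) (snd z)))"
    if "continuous_on S f" for f :: "'a \<Rightarrow> 'a"
    using inS by (intro continuous_on_compose2[OF that]) auto
  have contW: "continuous_on (S \<times> cbox 0 1) (\<lambda>(x, t). W x t)"
    unfolding W_def split_beta
    by (intro continuous_intros cont smooth_on_continuous smooth_on_dir_deriv assms)
  have contg: "continuous_on (cbox 0 1) (\<lambda>t. \<theta> (\<gamma> x t))" if "x \<in> S" for x
  proof (rule continuous_on_compose2[OF smooth_on_continuous[OF assms(4)]])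
    show "continuous_on (cbox 0 1) (\<gamma> x)"
      unfolding \<gamma>_def by (intro continuous_intros)
  qed (use inS that in auto)
  have contWx: "continuous_on (cbox 0 1) (W x)" if "x \<in> S" for x
  proof -
    have "continuous_on (cbox 0 1) (\<lambda>t. (\<lambda>(x, t). W x t) (x, t))"
      by (rule continuous_on_compose2[OF contW])
        (intro continuous_on_Pair continuous_on_const continuous_on_id, use that in auto)
    then show ?thesis by simp
  qed
  have fx: "((\<lambda>x. \<theta> (\<gamma> x t) \<bullet> (x - q0)) has_derivative blinfun_inner_right (W x t)) (at x within S)"
    if "x \<in> S" "t \<in> cbox 0 1" for x t
  proof -
    note d = smooth_on_has_derivative[OF assms(4) inS[OF that]]
    interpret bounded_linear "\<lambda>v. dir_deriv \<theta> v (\<gamma> x t)"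
      using d by (rule has_derivative_bounded_linear)
    have "((\<lambda>x. \<gamma> x t) has_derivative (\<lambda>v. t *\<^sub>R v)) (at x)"
      unfolding \<gamma>_def by (auto intro!: derivative_eq_intros)
    from diff_chain_at[OF this d]
    have "((\<lambda>x. \<theta> (\<gamma> x t)) has_derivative (\<lambda>v. dir_deriv \<theta> (t *\<^sub>R v) (\<gamma> x t))) (at x)"
      by (simp add: o_def)
    then have der: "((\<lambda>x. \<theta> (\<gamma> x t) \<bullet> (x - q0)) has_derivative
        (\<lambda>v. \<theta> (\<gamma> x t) \<bullet> v + dir_deriv \<theta> (t *\<^sub>R v) (\<gamma> x t) \<bullet> (x - q0))) (at x)"
      by (auto intro!: derivative_eq_intros)
    have "\<theta> (\<gamma> x t) \<bullet> v + dir_deriv \<theta> (t *\<^sub>R v) (\<gamma> x t) \<bullet> (x - q0) = W x t \<bullet> v" for v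
    proof -
      have "dir_deriv \<theta> (t *\<^sub>R v) (\<gamma> x t) \<bullet> (x - q0) = t * (dir_deriv \<theta> (x - q0) (\<gamma> x t) \<bullet> v)"
        using closed[OF inS[OF that], of v "x - q0"] by (simp only: scaleR inner_scaleR_left)
      then show ?thesis by (simp only: W[OF that] inner_add_left inner_scaleR_left)
    qed
    then have "(\<lambda>v. \<theta> (\<gamma> x t) \<bullet> v + dir_deriv \<theta> (t *\<^sub>R v) (\<gamma> x t) \<bullet> (x - q0)) =
        blinfun_apply (blinfun_inner_right (W x t))"
      by (simp only: blinfun_inner_right.rep_eq fun_eq_iff) simp
    then show ?thesis
      using has_derivative_at_withinI[OF der] by (simp only:)
  qed
  have intW: "integral (cbox 0 1) (W x) = \<theta> x" if "x \<in> S" for x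
  proof -
    have "((\<lambda>t. t *\<^sub>R \<theta> (\<gamma> x t)) has_vector_derivative W x t) (at t)" if "t \<in> cbox 0 1" for t
    proof -
      note d = smooth_on_has_derivative[OF assms(4) inS[OF \<open>x \<in> S\<close> that]]
      interpret bounded_linear "\<lambda>v. dir_deriv \<theta> v (\<gamma> x t)"
        using d by (rule has_derivative_bounded_linear)
      have "(\<gamma> x has_derivative (\<lambda>s. s *\<^sub>R (x - q0))) (at t)"
        unfolding \<gamma>_def by (auto intro!: derivative_eq_intros)
      from diff_chain_at[OF this d]
      have "((\<lambda>t. \<theta> (\<gamma> x t)) has_derivative (\<lambda>s. s *\<^sub>R dir_deriv \<theta> (x - q0) (\<gamma> x t))) (at t)"
        by (simp add: o_def scaleR)
      from has_derivative_scaleR[OF has_derivative_ident this] show ?thesis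
        unfolding has_vector_derivative_def
        by (rule has_derivative_eq_rhs) (simp add: W[OF \<open>x \<in> S\<close> that] fun_eq_iff algebra_simps)
    qed
    \<comment> \<open>The factor \<open>t\<close> in the primitive removes the boundary term at
      \<open>q0\<close> and leaves \<open>\<theta> x\<close>.\<close>
    then have "(W x has_integral (1 *\<^sub>R \<theta> (\<gamma> x 1) - 0 *\<^sub>R \<theta> (\<gamma> x 0))) {0..1}"
      by (intro fundamental_theorem_of_calculus) (auto intro: has_vector_derivative_at_within)
    then show ?thesis by (auto simp: \<gamma>_def dest: integral_unique)
  qed
  have der: "(\<phi> has_derivative (\<lambda>v. \<theta> q \<bullet> v)) (at q)" if "q \<in> S" for q
  proof -
    have "(\<phi> has_derivative integral (cbox 0 1) (\<lambda>t. blinfun_inner_right (W q t))) (at q within S)"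
      unfolding \<phi>_def
    proof (rule leibniz_rule[OF fx])
      show "(\<lambda>t. \<theta> (\<gamma> x t) \<bullet> (x - q0)) integrable_on cbox 0 1" if "x \<in> S" for x
        by (intro integrable_continuous continuous_intros contg that)
      show "continuous_on (S \<times> cbox 0 1) (\<lambda>(x, t). blinfun_inner_right (W x t))"
        using contW unfolding split_beta
        by (intro bounded_linear.continuous_on[OF bounded_linear_blinfun_inner_right]) simp
    qed (use that assms in auto)
    moreover have "integral (cbox 0 1) (\<lambda>t. blinfun_inner_right (W q t)) = blinfun_inner_right (\<theta> q)"
      using integral_linear[OF integrable_continuous[OF contWx[OF that]] bounded_linear_blinfun_inner_right]
        intW[OF that] by (simp add: o_def)
    ultimately show ?thesis
      by (simp only: blinfun_inner_right.rep_eq at_within_open[OF that \<open>open S\<close>])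
  qed
  have "\<phi> q0 = 0" unfolding \<phi>_def by (simp only: diff_self inner_zero_right integral_0)
  moreover have "smooth_on S \<phi>"
    using smooth_onI[OF \<open>open S\<close> der smooth_on_inner_const[OF assms(1,4)]] .
  ultimately show ?thesis using der by (rule that)
qed

text \<open>For a 1-form with constant values on the frame, \<open>d\<theta>(e1, e2) = - \<theta>([e1, e2])\<close>.\<close>

lemma closed_form_frame:
  fixes \<theta> e1 e2 :: "real \<times> real \<Rightarrow> real \<times> real"
  assumes S: "open S" "smooth_on S e1" "smooth_on S e2" "smooth_on S \<theta>" "q \<in> S"
    and frame: "frame_at (e1 q) (e2 q)"
    and const: "\<And>q. q \<in> S \<Longrightarrow> \<theta> q \<bullet> e1 q = k1" "\<And>q. q \<in> S \<Longrightarrow> \<theta> q \<bullet> e2 q = k2"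
    and bracket: "\<theta> q \<bullet> (lie e2 e1 q - lie e1 e2 q) = 0"
  shows "dir_deriv \<theta> v q \<bullet> w = dir_deriv \<theta> w q \<bullet> v"
proof -
  interpret bounded_linear "\<lambda>v. dir_deriv \<theta> v q"
    using smooth_on_has_derivative[OF S(4,5)] by (rule has_derivative_bounded_linear)
  \<comment> \<open>Each constant value on the frame is differentiated along the other frame vector.
    This relates the derivative of \<open>\<theta>\<close> on the pair of frame vectors to the
    bracket, and bilinearity carries the symmetry over to all \<open>v\<close> and
    \<open>w\<close>.\<close>
  have "lie e1 (\<lambda>q. \<theta> q \<bullet> e2 q) q = lie e1 (\<lambda>_. k2) q" "lie e2 (\<lambda>q. \<theta> q \<bullet> e1 q) q = lie e2 (\<lambda>_. k1) q"
    by (intro lie_cong[OF S(1,5)] const; assumption)+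
  then have "\<theta> q \<bullet> lie e1 e2 q + lie e1 \<theta> q \<bullet> e2 q = 0" "\<theta> q \<bullet> lie e2 e1 q + lie e2 \<theta> q \<bullet> e1 q = 0"
    by (simp_all add: lie_inner[OF S(4) S(3) S(5)] lie_inner[OF S(4) S(2) S(5)])
  then have *: "dir_deriv \<theta> (e1 q) q \<bullet> e2 q = dir_deriv \<theta> (e2 q) q \<bullet> e1 q"
    using bracket by (simp add: lie_def inner_diff_right)
  obtain a b where "v = a *\<^sub>R e1 q + b *\<^sub>R e2 q" using frame_at_vector[OF frame] .
  moreover obtain a' b' where "w = a' *\<^sub>R e1 q + b' *\<^sub>R e2 q" using frame_at_vector[OF frame] .
  ultimately show ?thesis
    using * by (simp add: add scaleR inner_add_right inner_add_left algebra_simps)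
qed

lemma frame_form_dual:
  assumes S: "open S" "smooth_on S e1" "smooth_on S e2" and "\<And>q. q \<in> S \<Longrightarrow> frame_at (e1 q) (e2 q)"
  obtains \<theta> where "smooth_on S \<theta>" "\<And>q. q \<in> S \<Longrightarrow> \<theta> q \<bullet> e1 q = k1" "\<And>q. q \<in> S \<Longrightarrow> \<theta> q \<bullet> e2 q = k2"
proof
  let ?d = "\<lambda>q. fst (e1 q) * snd (e2 q) - fst (e2 q) * snd (e1 q)"
  let ?p = "\<lambda>q. ((snd (e2 q) * k1 - snd (e1 q) * k2) / ?d q, (fst (e1 q) * k2 - fst (e2 q) * k1) / ?d q)"
  have d: "?d q \<noteq> 0" if "q \<in> S" for q using assms(4)[OF that] by (simp add: frame_at_def)
  show "smooth_on S ?p" by (intro smooth_intros S d)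
  show "?p q \<bullet> e1 q = k1" if "q \<in> S" for q using d[OF that]
    by (simp add: inner_prod_def divide_simps) (simp add: algebra_simps)
  show "?p q \<bullet> e2 q = k2" if "q \<in> S" for q using d[OF that]
    by (simp add: inner_prod_def divide_simps) (simp add: algebra_simps)
qed

text \<open>The condition on \<open>k1\<close> and \<open>k2\<close> says that the form with these
  values on the frame annihilates the bracket, hence is closed. It concerns this one form, not the
  whole frame: in the Jordan-block case the values 1 and 0 are admissible before the frame has been
  made to commute.\<close>

lemma frame_potential:
  assumes S: "open S" "convex S" "q0 \<in> S" "smooth_on S e1" "smooth_on S e2"
    and frame: "\<And>q. q \<in> S \<Longrightarrow> frame_at (e1 q) (e2 q)"
    and bracket: "\<And>q. q \<in> S \<Longrightarrow> lie e2 e1 q - lie e1 e2 q = c1 q *\<^sub>R e1 q + c2 q *\<^sub>R e2 q"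
      "\<And>q. q \<in> S \<Longrightarrow> c1 q * k1 + c2 q * k2 = 0"
  obtains \<phi> where "\<phi> q0 = 0" "smooth_on S \<phi>"
    "\<And>q a b. q \<in> S \<Longrightarrow> dir_deriv \<phi> (a *\<^sub>R e1 q + b *\<^sub>R e2 q) q = a * k1 + b * k2"
proof -
  obtain \<theta> where \<theta>: "smooth_on S \<theta>" "\<And>q. q \<in> S \<Longrightarrow> \<theta> q \<bullet> e1 q = k1" "\<And>q. q \<in> S \<Longrightarrow> \<theta> q \<bullet> e2 q = k2"
    using frame_form_dual[OF S(1,4,5) frame] by blast
  have "dir_deriv \<theta> v q \<bullet> w = dir_deriv \<theta> w q \<bullet> v" if "q \<in> S" for q v w
    by (rule closed_form_frame[OF S(1,4,5) \<theta>(1) that frame[OF that] \<theta>(2,3)])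
      (use that bracket \<theta> in \<open>auto simp: inner_add_right\<close>)
  then obtain \<phi> where \<phi>: "\<phi> q0 = 0" "smooth_on S \<phi>"
    "\<And>q. q \<in> S \<Longrightarrow> (\<phi> has_derivative (\<lambda>v. \<theta> q \<bullet> v)) (at q)"
    using closed_form_potential[OF S(1-3) \<theta>(1)] by metis
  show ?thesis
  proof (rule that[OF \<phi>(1,2)])
    fix q a b assume "q \<in> S"
    then show "dir_deriv \<phi> (a *\<^sub>R e1 q + b *\<^sub>R e2 q) q = a * k1 + b * k2"
      using \<theta> by (simp add: dir_deriv_eqI[OF \<phi>(3)] inner_add_right)
  qed
qed

section \<open>Coordinates from a commuting frame\<close>

definition coordinate_change ::
    "(real \<times> real) set \<Rightarrow> (real \<times> real) set \<Rightarrow> (real \<times> real \<Rightarrow> real \<times> real) \<Rightarrow> (real \<times> real \<Rightarrow> real \<times> real) \<Rightarrow> bool" where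
  "coordinate_change V D \<psi> \<Phi> \<longleftrightarrow> open V \<and> open D \<and> \<psi> ` V = D \<and> \<Phi> ` D = V \<and>
     (\<forall>q\<in>V. \<Phi> (\<psi> q) = q) \<and> (\<forall>z\<in>D. \<psi> (\<Phi> z) = z) \<and> smooth_on V \<psi> \<and> smooth_on D \<Phi>"

text \<open>Says that \<open>e1\<close> and \<open>e2\<close> are the coordinate vector fields of
  the parametrization \<open>\<Phi>\<close>: here \<open>z\<close> is in the new coordinates and
  \<open>\<Phi> z\<close> in the old ones.\<close>

definition straightens ::
    "(real \<times> real) set \<Rightarrow> (real \<times> real \<Rightarrow> real \<times> real) \<Rightarrow>
     (real \<times> real \<Rightarrow> real \<times> real) \<Rightarrow> (real \<times> real \<Rightarrow> real \<times> real) \<Rightarrow> bool" where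
  "straightens D \<Phi> e1 e2 \<longleftrightarrow> (\<forall>z\<in>D.
     (\<Phi> has_derivative (\<lambda>v. fst v *\<^sub>R e1 (\<Phi> z) + snd v *\<^sub>R e2 (\<Phi> z))) (at z))"

text \<open>A bootstrap: the derivative of \<open>\<Phi>\<close> is the smooth frame composed with
  \<open>\<Phi>\<close>, so each order of differentiability of \<open>\<Phi>\<close> passes to its
  derivative and gives the next order.\<close>

lemma smooth_on_straightens:
  assumes "open D" "open S" "\<Phi> ` D \<subseteq> S" "smooth_on S e1" "smooth_on S e2" "straightens D \<Phi> e1 e2"
  shows "smooth_on D \<Phi>"
proof -
  have "times_differentiable_on k \<Phi> D" for k
  proof (induction k)
    case 0
    show ?case
      using assms(6) by (auto simp: straightens_def intro!: continuous_at_imp_continuous_on has_derivative_continuous)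
  next
    case (Suc k)
    show ?case
    proof (rule times_differentiable_on_SucI[OF assms(1)])
      show "(\<Phi> has_derivative (\<lambda>v. fst v *\<^sub>R e1 (\<Phi> z) + snd v *\<^sub>R e2 (\<Phi> z))) (at z)" if "z \<in> D" for z
        using assms(6) that by (simp add: straightens_def)
      show "times_differentiable_on k (\<lambda>z. fst v *\<^sub>R e1 (\<Phi> z) + snd v *\<^sub>R e2 (\<Phi> z)) D" for v
        using assms(4,5) unfolding smooth_on_def
        by (intro times_differentiable_on_add[OF assms(1)]
            times_differentiable_on_linear[OF assms(1) bounded_linear_scaleR_right]
            times_differentiable_on_compose[OF assms(1-3) Suc]) blast+
    qed
  qed
  then show ?thesis by (simp add: smooth_on_def)
qed

text \<open>The forms dual to the frame are closed; their potentials are the new coordinates, and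
  the inverse function theorem inverts them near \<open>q0\<close>. The new domain is a square, so
  that a function with vanishing derivative in one coordinate is independent of it throughout the
  domain.\<close>

lemma commuting_frame_coordinates:
  assumes S: "open S" "q0 \<in> S" "smooth_on S e1" "smooth_on S e2"
    and frame: "\<And>q. q \<in> S \<Longrightarrow> frame_at (e1 q) (e2 q)"
    and bracket: "\<And>q. q \<in> S \<Longrightarrow> lie e2 e1 q = lie e1 e2 q"
  obtains V r \<psi> \<Phi> where "q0 \<in> V" "V \<subseteq> S" "r > 0" "coordinate_change V ({-r<..<r} \<times> {-r<..<r}) \<psi> \<Phi>"
    "straightens ({-r<..<r} \<times> {-r<..<r}) \<Phi> e1 e2" "\<Phi> (0, 0) = q0"
proof -
  obtain s where s: "s > 0" "ball q0 s \<subseteq> S" using S by (auto simp: open_contains_ball)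
  have *: "smooth_on (ball q0 s) e1" "smooth_on (ball q0 s) e2"
    using S s smooth_on_subset by blast+
  obtain x where x: "x q0 = 0" "smooth_on (ball q0 s) x"
    "\<And>q a b. q \<in> ball q0 s \<Longrightarrow> dir_deriv x (a *\<^sub>R e1 q + b *\<^sub>R e2 q) q = a * 1 + b * 0"
    by (rule frame_potential[OF open_ball convex_ball _ *, of q0 "\<lambda>_. 0" "\<lambda>_. 0" 1 0])
      (use s frame bracket in auto)
  obtain y where y: "y q0 = 0" "smooth_on (ball q0 s) y"
    "\<And>q a b. q \<in> ball q0 s \<Longrightarrow> dir_deriv y (a *\<^sub>R e1 q + b *\<^sub>R e2 q) q = a * 0 + b * 1"
    by (rule frame_potential[OF open_ball convex_ball _ *, of q0 "\<lambda>_. 0" "\<lambda>_. 0" 0 1])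
      (use s frame bracket in auto)
  define \<psi> where "\<psi> q = (x q, y q)" for q
  define L where "L q = Blinfun (\<lambda>v. (dir_deriv x v q, dir_deriv y v q))" for q
  have smooth\<psi>: "smooth_on (ball q0 s) \<psi>"
    unfolding \<psi>_def by (intro smooth_intros x y) auto
  have d: "(\<psi> has_derivative (\<lambda>v. (dir_deriv x v q, dir_deriv y v q))) (at q)" if "q \<in> ball q0 s" for q
    unfolding \<psi>_def by (intro has_derivative_Pair smooth_on_has_derivative[OF _ that] x y)
  have L: "blinfun_apply (L q) = (\<lambda>v. (dir_deriv x v q, dir_deriv y v q))" if "q \<in> ball q0 s" for q
    unfolding L_def using has_derivative_bounded_linear[OF d[OF that]] by (rule bounded_linear_Blinfun_apply)
  have Le: "blinfun_apply (L q) (a *\<^sub>R e1 q + b *\<^sub>R e2 q) = (a, b)" if "q \<in> ball q0 s" for q a b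
    using that by (simp add: L x y)
  \<comment> \<open>The left inverse of the derivative at \<open>q0\<close> for the inverse function
    theorem: the derivative sends the frame to the standard basis, and \<open>M\<close> sends it
    back.\<close>
  define M where "M = Blinfun (\<lambda>v. fst v *\<^sub>R e1 q0 + snd v *\<^sub>R e2 q0)"
  have M: "blinfun_apply M = (\<lambda>v. fst v *\<^sub>R e1 q0 + snd v *\<^sub>R e2 q0)"
    unfolding M_def
    by (rule bounded_linear_Blinfun_apply)
      (intro bounded_linear_add bounded_linear_scaleR_const bounded_linear_fst bounded_linear_snd)
  have "M o\<^sub>L L q0 = id_blinfun"
  proof (rule blinfun_eqI)
    fix v
    obtain a b where "v = a *\<^sub>R e1 q0 + b *\<^sub>R e2 q0" using frame_at_vector[OF frame[OF S(2)]] .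
    then show "blinfun_apply (M o\<^sub>L L q0) v = blinfun_apply id_blinfun v"
      using s by (simp add: Le M)
  qed
  moreover have "continuous_on (ball q0 s) L"
  proof (rule continuous_on_blinfun_componentwise)
    fix i :: "real \<times> real"
    have "continuous_on (ball q0 s) (\<lambda>q. (dir_deriv x i q, dir_deriv y i q))"
      by (intro continuous_intros smooth_on_continuous smooth_on_dir_deriv x y)
    then show "continuous_on (ball q0 s) (\<lambda>q. blinfun_apply (L q) i)"
      by (rule continuous_on_eq) (simp add: L)
  qed
  moreover have "(\<psi> has_derivative blinfun_apply (L q)) (at q)" if "q \<in> ball q0 s" for q
    using d[OF that] by (simp add: L[OF that])
  ultimately obtain U V g g' where U: "open U" "U \<subseteq> ball q0 s" "q0 \<in> U" "open V" "\<psi> q0 \<in> V" "homeomorphism U V \<psi> g"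
    and g: "\<And>z. z \<in> V \<Longrightarrow> (g has_derivative (g' z)) (at z)"
      "\<And>z. z \<in> V \<Longrightarrow> g' z = inv (blinfun_apply (L (g z)))"
      "\<And>z. z \<in> V \<Longrightarrow> bij (blinfun_apply (L (g z)))"
    using inverse_function_theorem[of "ball q0 s" \<psi> L q0 M, OF open_ball _ _ centre_in_ball[THEN iffD2, OF s(1)]]
    by (metis (no_types, lifting))
  have \<psi>0: "\<psi> q0 = (0, 0)" by (simp add: \<psi>_def x y)
  obtain r where r: "r > 0" "{-r<..<r} \<times> {-r<..<r} \<subseteq> V"
  proof -
    obtain e where e: "e > 0" "ball (0::real, 0::real) e \<subseteq> V"
      using U \<psi>0 by (metis open_contains_ball)
    have "(a, b) \<in> ball (0, 0) e" if "\<bar>a\<bar> < e/2" "\<bar>b\<bar> < e/2" for a b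
    proof -
      have "norm (- a, - b) \<le> \<bar>a\<bar> + \<bar>b\<bar>" using norm_Pair_le[of "- a" "- b"] by simp
      then show ?thesis using that by (simp add: dist_norm)
    qed
    then have "{-(e/2)<..<e/2} \<times> {-(e/2)<..<e/2} \<subseteq> V"
      using e(2) by (force simp: abs_less_iff)
    then show ?thesis using e(1) that[of "e/2"] by simp
  qed
  let ?D = "{-r<..<r} \<times> {-r<..<r}"
  have gU: "g z \<in> U" if "z \<in> V" for z using U(6) that by (auto simp: homeomorphism_def)
  have \<psi>g: "\<psi> (g z) = z" if "z \<in> V" for z using homeomorphism_apply2[OF U(6) that] .
  have g\<psi>: "g (\<psi> q) = q" if "q \<in> U" for q using homeomorphism_apply1[OF U(6) that] .
  have st: "straightens ?D g e1 e2"
    unfolding straightens_def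
  proof
    fix z assume "z \<in> ?D"
    then have z: "z \<in> V" using r by auto
    then have gz: "g z \<in> ball q0 s" using gU U(2) by blast
    \<comment> \<open>Since the derivative of \<open>\<psi>\<close> has the values 1 and 0 on the
      frame, the derivative of the inverse map has the frame vectors as its columns.\<close>
    have "inv (blinfun_apply (L (g z))) (a, b) = a *\<^sub>R e1 (g z) + b *\<^sub>R e2 (g z)" for a b
      using g(3)[OF z] Le[OF gz, of a b] by (metis bij_inv_eq_iff)
    then have "g' z = (\<lambda>v. fst v *\<^sub>R e1 (g z) + snd v *\<^sub>R e2 (g z))"
      using g(2)[OF z] by (auto simp: fun_eq_iff)
    then show "(g has_derivative (\<lambda>v. fst v *\<^sub>R e1 (g z) + snd v *\<^sub>R e2 (g z))) (at z)"
      using g(1)[OF z] by simp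
  qed
  have openD: "open ?D" by (intro open_Times) auto
  have sub: "g ` ?D \<subseteq> ball q0 s" using gU U(2) r(2) by blast
  have "coordinate_change (g ` ?D) ?D \<psi> g"
    unfolding coordinate_change_def
  proof (intro conjI)
    have "g ` ?D = U \<inter> \<psi> -` ?D"
    proof
      show "g ` ?D \<subseteq> U \<inter> \<psi> -` ?D" using gU \<psi>g r(2) by auto
      show "U \<inter> \<psi> -` ?D \<subseteq> g ` ?D"
      proof
        fix q assume "q \<in> U \<inter> \<psi> -` ?D"
        then have "q = g (\<psi> q)" "\<psi> q \<in> ?D" using g\<psi> by auto
        then show "q \<in> g ` ?D" by (rule image_eqI)
      qed
    qed
    moreover have "continuous_on U \<psi>" using U(6) by (simp add: homeomorphism_def)
    ultimately show "open (g ` ?D)"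
      using continuous_open_preimage[OF _ U(1) openD] by (simp only:)
    show "smooth_on ?D g"
      by (rule smooth_on_straightens[OF openD open_ball sub * st])
    show "smooth_on (g ` ?D) \<psi>" using smooth\<psi> sub smooth_on_subset by blast
    have "(\<lambda>z. \<psi> (g z)) ` ?D = (\<lambda>z. z) ` ?D"
      by (rule image_cong) (use r(2) \<psi>g in auto)
    then show "\<psi> ` g ` ?D = ?D" by (simp add: image_image)
    show "\<forall>z\<in>?D. \<psi> (g z) = z" using r(2) \<psi>g by blast
    then show "\<forall>q\<in>g ` ?D. g (\<psi> q) = q" by simp
  qed (simp_all add: openD)
  moreover have g0: "g (0, 0) = q0" using g\<psi>[OF U(3)] \<psi>0 by simp
  moreover have "q0 \<in> g ` ?D" using g0 r(1) by (intro image_eqI[of _ _ "(0, 0)"]) auto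
  moreover have "g ` ?D \<subseteq> S" using sub s by blast
  ultimately show ?thesis using that[of "g ` ?D" r \<psi> g] r(1) st by blast
qed

section \<open>Unique continuation\<close>

text \<open>The module over the smooth functions on \<open>S\<close> generated by \<open>B\<close>,
  where the rule \<open>cong\<close> identifies functions that agree on \<open>S\<close>. Membership
  stands for a linear expression whose coefficients are never written down.\<close>

inductive smooth_span ::
    "'a::real_normed_vector set \<Rightarrow> ('a \<Rightarrow> real) set \<Rightarrow> ('a \<Rightarrow> real) \<Rightarrow> bool" for S B where
  base: "b \<in> B \<Longrightarrow> smooth_span S B b"
| zero: "smooth_span S B (\<lambda>x. 0)"
| add: "smooth_span S B f \<Longrightarrow> smooth_span S B g \<Longrightarrow> smooth_span S B (\<lambda>x. f x + g x)"
| mult: "smooth_on S c \<Longrightarrow> smooth_span S B f \<Longrightarrow> smooth_span S B (\<lambda>x. c x * f x)"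
| cong: "smooth_span S B f \<Longrightarrow> (\<And>x. x \<in> S \<Longrightarrow> f x = g x) \<Longrightarrow> smooth_span S B g"

lemma smooth_span_mono: "smooth_span S B f \<Longrightarrow> B \<subseteq> B' \<Longrightarrow> smooth_span S B' f"
  by (induction rule: smooth_span.induct) (auto intro: smooth_span.intros)

lemma smooth_span_diff:
  assumes "open S" "smooth_span S B f" "smooth_span S B g"
  shows "smooth_span S B (\<lambda>x. f x - g x)"
proof (rule smooth_span.cong)
  show "smooth_span S B (\<lambda>x. f x + (- 1) * g x)"
    by (intro smooth_span.add smooth_span.mult assms smooth_on_const)
qed simp

lemma smooth_span_smooth:
  assumes "open S" "\<And>b. b \<in> B \<Longrightarrow> smooth_on S b" "smooth_span S B f"
  shows "smooth_on S f"
  using assms(3)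
proof (induction rule: smooth_span.induct)
  case (cong f g)
  then show ?case using smooth_on_cong[OF _ assms(1)] by blast
qed (use assms(1,2) in \<open>auto intro: smooth_intros\<close>)

text \<open>A derivation is controlled by its values on generators. The target \<open>B'\<close> may
  be larger than \<open>B\<close>, since in a prolongation a derivative may introduce new
  unknowns.\<close>

lemma smooth_span_lie:
  fixes e :: "'a::euclidean_space \<Rightarrow> 'a"
  assumes "open S" "smooth_on S e" "\<And>b. b \<in> B \<Longrightarrow> smooth_on S b"
    "\<And>b. b \<in> B \<Longrightarrow> smooth_span S B' (lie e b)" "B \<subseteq> B'" "smooth_span S B f"
  shows "smooth_span S B' (lie e f)"
proof -
  have sm: "smooth_on S h" if "smooth_span S B h" for h
    using smooth_span_smooth[OF assms(1) _ that] assms(3) by blast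
  show ?thesis
    using assms(6)
  proof (induction rule: smooth_span.induct)
    case (base b)
    then show ?case using assms(4) by blast
  next
    case zero
    show ?case by (rule smooth_span.cong[OF smooth_span.zero]) simp
  next
    case (add f g)
    show ?case
      by (rule smooth_span.cong[OF smooth_span.add[OF add.IH]])
        (simp add: lie_add[OF sm[OF add.hyps(1)] sm[OF add.hyps(2)]])
  next
    case (mult c f)
    show ?case
    proof (rule smooth_span.cong)
      show "smooth_span S B' (\<lambda>x. c x * lie e f x + lie e c x * f x)"
        using mult assms smooth_span_mono by (intro smooth_span.add smooth_span.mult) (auto intro: smooth_on_lie)
      show "c x * lie e f x + lie e c x * f x = lie e (\<lambda>x. c x * f x) x" if "x \<in> S" for x
        using lie_mult[OF mult.hyps(1) sm[OF mult.hyps(2)] that] by simp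
    qed
  next
    case (cong f g)
    show ?case
      by (rule smooth_span.cong[OF cong.IH]) (rule lie_cong[OF assms(1) _ cong.hyps(2)])
  qed
qed

text \<open>Turns membership in the module into the linear estimate from which the Gronwall argument
  starts; smooth coefficients are bounded on compact sets.\<close>

lemma smooth_span_bound:
  assumes "compact K" "K \<subseteq> S" "finite B" "smooth_span S B f"
  shows "\<exists>C\<ge>0. \<forall>x\<in>K. \<bar>f x\<bar> \<le> C * (\<Sum>b\<in>B. \<bar>b x\<bar>)"
  using assms(4)
proof (induction rule: smooth_span.induct)
  case (base b)
  have "\<bar>b x\<bar> \<le> 1 * (\<Sum>b\<in>B. \<bar>b x\<bar>)" for x
    using member_le_sum[OF base, of "\<lambda>b. \<bar>b x\<bar>"] assms(3) by simp
  then show ?case using zero_le_one by blast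
next
  case zero
  show ?case by (rule exI[of _ 0]) simp
next
  case (add f g)
  then obtain C D where *: "C \<ge> 0" "D \<ge> 0" "\<And>x. x \<in> K \<Longrightarrow> \<bar>f x\<bar> \<le> C * (\<Sum>b\<in>B. \<bar>b x\<bar>)"
    "\<And>x. x \<in> K \<Longrightarrow> \<bar>g x\<bar> \<le> D * (\<Sum>b\<in>B. \<bar>b x\<bar>)" by blast
  have "\<bar>f x + g x\<bar> \<le> (C + D) * (\<Sum>b\<in>B. \<bar>b x\<bar>)" if "x \<in> K" for x
    using *(3,4)[OF that] by (simp add: distrib_right)
  then show ?case using *(1,2) by (intro exI[of _ "C + D"]) auto
next
  case (mult c f)
  then obtain C where C: "C \<ge> 0" "\<And>x. x \<in> K \<Longrightarrow> \<bar>f x\<bar> \<le> C * (\<Sum>b\<in>B. \<bar>b x\<bar>)" by blast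
  have "compact (c ` K)"
    by (intro compact_continuous_image continuous_on_subset[OF _ assms(2)] smooth_on_continuous mult assms)
  then obtain M where M: "\<And>x. x \<in> K \<Longrightarrow> \<bar>c x\<bar> \<le> M"
    using compact_imp_bounded by (force simp: bounded_iff)
  have "\<bar>c x * f x\<bar> \<le> \<bar>M\<bar> * C * (\<Sum>b\<in>B. \<bar>b x\<bar>)" if "x \<in> K" for x
  proof -
    have "\<bar>c x\<bar> * \<bar>f x\<bar> \<le> \<bar>M\<bar> * (C * (\<Sum>b\<in>B. \<bar>b x\<bar>))"
      using M[OF that] C(2)[OF that] by (intro mult_mono) auto
    then show ?thesis by (simp add: abs_mult mult.assoc)
  qed
  then show ?case using C(1) by (intro exI[of _ "\<bar>M\<bar> * C"]) auto
next
  case (cong f g)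
  then show ?case using assms(2) by (metis subsetD)
qed

text \<open>Along a segment the sum of squares \<open>N\<close> of the functions satisfies \<open>N' \<le> L N\<close>.\<close>

lemma smooth_span_system_vanish:
  fixes B :: "('a::real_normed_vector \<Rightarrow> real) set"
  assumes S: "open S" "convex S" "q0 \<in> S" "q1 \<in> S" and B: "finite B" "\<And>b. b \<in> B \<Longrightarrow> smooth_on S b"
    and closed: "\<And>b v. b \<in> B \<Longrightarrow> smooth_span S B (dir_deriv b v)"
    and zero: "\<And>b. b \<in> B \<Longrightarrow> b q0 = 0" and "b \<in> B"
  shows "b q1 = 0"
proof -
  define v where "v = q1 - q0"
  define \<gamma> where "\<gamma> t = q0 + t *\<^sub>R v" for t
  have inS: "\<gamma> t \<in> S" if "0 \<le> t" "t \<le> 1" for t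
  proof -
    have "\<gamma> t = (1 - t) *\<^sub>R q0 + t *\<^sub>R q1" by (simp add: \<gamma>_def v_def algebra_simps)
    then show ?thesis using that S by (auto simp: convex_alt)
  qed
  have "compact (\<gamma> ` {0..1})"
    unfolding \<gamma>_def by (intro compact_continuous_image continuous_intros compact_Icc)
  moreover have "\<gamma> ` {0..1} \<subseteq> S" using inS by auto
  ultimately have "\<forall>b\<in>B. \<exists>C\<ge>0. \<forall>x\<in>\<gamma> ` {0..1}. \<bar>dir_deriv b v x\<bar> \<le> C * (\<Sum>b\<in>B. \<bar>b x\<bar>)"
    using smooth_span_bound B(1) closed by blast
  from bchoice[OF this] obtain C where C': "\<And>b. b \<in> B \<Longrightarrow> C b \<ge> 0 \<and>
      (\<forall>x\<in>\<gamma> ` {0..1}. \<bar>dir_deriv b v x\<bar> \<le> C b * (\<Sum>b\<in>B. \<bar>b x\<bar>))"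
    by blast
  have C: "\<And>b. b \<in> B \<Longrightarrow> C b \<ge> 0"
    "\<And>b t. b \<in> B \<Longrightarrow> 0 \<le> t \<Longrightarrow> t \<le> 1 \<Longrightarrow> \<bar>dir_deriv b v (\<gamma> t)\<bar> \<le> C b * (\<Sum>b\<in>B. \<bar>b (\<gamma> t)\<bar>)"
    using C' by auto
  define M where "M = (\<Sum>b\<in>B. C b)"
  \<comment> \<open>With \<open>s\<close> the sum of the absolute values, \<open>N'\<close> is at
    most \<open>2 * M * s\<^sup>2\<close>, and \<open>s\<^sup>2\<close> is at most
    \<open>card B\<close> times \<open>N\<close> by Cauchy-Schwarz.\<close>
  define L where "L = 2 * M * card B"
  define N where "N t = (\<Sum>b\<in>B. (b (\<gamma> t))\<^sup>2)" for t
  define N' where "N' t = (\<Sum>b\<in>B. 2 * b (\<gamma> t) * dir_deriv b v (\<gamma> t))" for t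
  have M: "C b \<le> M" "0 \<le> M" if "b \<in> B" for b
    unfolding M_def using C(1) B(1) that by (auto intro: member_le_sum sum_nonneg)
  have der: "(N has_real_derivative N' t) (at t)" if t: "0 \<le> t" "t \<le> 1" for t
    unfolding N_def N'_def
  proof (rule DERIV_sum)
    fix b assume b: "b \<in> B"
    note d = smooth_on_has_derivative[OF B(2)[OF b] inS[OF t]]
    interpret bounded_linear "\<lambda>v. dir_deriv b v (\<gamma> t)"
      using d by (rule has_derivative_bounded_linear)
    have "(\<gamma> has_derivative (\<lambda>s. s *\<^sub>R v)) (at t)"
      unfolding \<gamma>_def by (auto intro!: derivative_eq_intros)
    from diff_chain_at[OF this d]
    have "((\<lambda>t. b (\<gamma> t)) has_real_derivative dir_deriv b v (\<gamma> t)) (at t)"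
      unfolding has_field_derivative_def o_def
      by (rule has_derivative_eq_rhs) (simp add: fun_eq_iff scaleR)
    then show "((\<lambda>t. (b (\<gamma> t))\<^sup>2) has_real_derivative 2 * b (\<gamma> t) * dir_deriv b v (\<gamma> t)) (at t)"
      by (auto intro!: derivative_eq_intros)
  qed
  have le: "N' t \<le> L * N t" if t: "0 \<le> t" "t \<le> 1" for t
  proof -
    let ?s = "\<Sum>b\<in>B. \<bar>b (\<gamma> t)\<bar>"
    have "N' t \<le> (\<Sum>b\<in>B. 2 * \<bar>b (\<gamma> t)\<bar> * (M * ?s))"
      unfolding N'_def
    proof (rule sum_mono)
      fix b assume b: "b \<in> B"
      have "\<bar>dir_deriv b v (\<gamma> t)\<bar> \<le> M * ?s"
        using C(2)[OF b t] M[OF b] by (meson mult_right_mono order_trans sum_nonneg abs_ge_zero)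
      then have "\<bar>b (\<gamma> t)\<bar> * \<bar>dir_deriv b v (\<gamma> t)\<bar> \<le> \<bar>b (\<gamma> t)\<bar> * (M * ?s)"
        by (intro mult_left_mono) auto
      then show "2 * b (\<gamma> t) * dir_deriv b v (\<gamma> t) \<le> 2 * \<bar>b (\<gamma> t)\<bar> * (M * ?s)"
        using abs_ge_self[of "b (\<gamma> t) * dir_deriv b v (\<gamma> t)"] by (simp add: abs_mult)
    qed
    also have "\<dots> = 2 * M * ?s\<^sup>2"
      unfolding sum_distrib_right[symmetric] sum_distrib_left[symmetric] by (simp add: power2_eq_square)
    also have "\<dots> \<le> 2 * M * ((\<Sum>b\<in>B. \<bar>b (\<gamma> t)\<bar>\<^sup>2) * card B)"
      using M(2)[OF \<open>b \<in> B\<close>] by (intro mult_left_mono sum_squared_le_sum_of_squares) auto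
    finally show ?thesis by (simp add: L_def N_def algebra_simps)
  qed
  \<comment> \<open>Gronwall's argument: \<open>N t * exp (- L * t)\<close> does not increase,
    starts at 0 and is nonnegative.\<close>
  have "N 1 * exp (- L * 1) \<le> N 0 * exp (- L * 0)"
  proof (rule DERIV_nonpos_imp_nonincreasing[OF zero_le_one])
    fix t :: real assume t: "0 \<le> t" "t \<le> 1"
    have "((\<lambda>t. N t * exp (- L * t)) has_real_derivative (N' t - L * N t) * exp (- L * t)) (at t)"
      by (rule derivative_eq_intros der[OF t] refl)+ (simp add: algebra_simps)
    moreover have "(N' t - L * N t) * exp (- L * t) \<le> 0"
      using le[OF t] by (simp add: mult_le_0_iff)
    ultimately show "\<exists>y. ((\<lambda>t. N t * exp (- L * t)) has_real_derivative y) (at t) \<and> y \<le> 0" by blast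
  qed
  moreover have "N 0 = 0" by (simp add: N_def \<gamma>_def zero)
  ultimately have "N 1 * exp (- L) \<le> 0" by simp
  then have "N 1 \<le> 0" using mult_le_0_iff[of "N 1" "exp (- L)"] by simp
  moreover have "(b (\<gamma> 1))\<^sup>2 \<le> N 1"
    unfolding N_def using B(1) \<open>b \<in> B\<close> by (intro member_le_sum) auto
  ultimately have "(b (\<gamma> 1))\<^sup>2 \<le> 0" by (rule order_trans[rotated])
  then show ?thesis by (simp add: \<gamma>_def v_def)
qed

lemma frame_components:
  assumes S: "open S" "smooth_on S e1" "smooth_on S e2" "\<And>q. q \<in> S \<Longrightarrow> frame_at (e1 q) (e2 q)"
    and "smooth_on S v"
  obtains a b where "smooth_on S a" "smooth_on S b" "\<And>q. q \<in> S \<Longrightarrow> v q = a q *\<^sub>R e1 q + b q *\<^sub>R e2 q"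
proof
  let ?d = "\<lambda>q. fst (e1 q) * snd (e2 q) - fst (e2 q) * snd (e1 q)"
  have d: "?d q \<noteq> 0" if "q \<in> S" for q using S(4)[OF that] by (simp add: frame_at_def)
  show "smooth_on S (\<lambda>q. (fst (v q) * snd (e2 q) - snd (v q) * fst (e2 q)) / ?d q)"
    by (intro smooth_intros S assms d)
  show "smooth_on S (\<lambda>q. (snd (v q) * fst (e1 q) - fst (v q) * snd (e1 q)) / ?d q)"
    by (intro smooth_intros S assms d)
  show "v q = ((fst (v q) * snd (e2 q) - snd (v q) * fst (e2 q)) / ?d q) *\<^sub>R e1 q
      + ((snd (v q) * fst (e1 q) - fst (v q) * snd (e1 q)) / ?d q) *\<^sub>R e2 q" if "q \<in> S" for q
    using d[OF that] by (intro prod_eqI) (simp_all add: divide_simps, simp_all add: algebra_simps)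
qed

section \<open>Prolongation of the equations for a quadratic integral\<close>

abbreviation (input) e_x :: "real \<times> real \<Rightarrow> real \<times> real" where "e_x \<equiv> \<lambda>_. (1, 0)"
abbreviation (input) e_y :: "real \<times> real \<Rightarrow> real \<times> real" where "e_y \<equiv> \<lambda>_. (0, 1)"

text \<open>The equations for the coefficients express \<open>V1 a\<close>, \<open>V1 b + V2 a\<close>, \<open>V1 c + V2 b\<close> and \<open>V2 c\<close>
  by \<open>a, b, c\<close>. Adjoining \<open>V2 a\<close>, \<open>V1 c\<close> and \<open>V2 V2 a\<close> to \<open>a, b, c\<close> makes the system closed.\<close>

lemma quadratic_integral_unique_continuation:
  assumes S: "open S" "convex S" and U: "open U" "U \<noteq> {}" "U \<subseteq> S"
    and smooth: "smooth_on S h11" "smooth_on S h12" "smooth_on S h22" "smooth_on S a" "smooth_on S b" "smooth_on S c"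
    and nondeg: "\<And>q. q \<in> S \<Longrightarrow> 4 * h11 q * h22 q - (h12 q)\<^sup>2 \<noteq> 0"
    and integral: "\<And>q p. q \<in> S \<Longrightarrow>
      poisson_bracket (frame_form e_x e_y h11 h12 h22) (frame_form e_x e_y a b c) (q, p) = 0"
    and zero: "\<And>q. q \<in> U \<Longrightarrow> a q = 0 \<and> b q = 0 \<and> c q = 0"
    and "q \<in> S"
  shows "a q = 0 \<and> b q = 0 \<and> c q = 0"
proof -
  \<comment> \<open>For a function \<open>f\<close> of the point the bracket of the energy with
    \<open>f\<close> is minus \<open>p\<^sub>x V1 f + p\<^sub>y V2 f\<close>. So only derivatives of
    the coefficients along \<open>V1\<close> and \<open>V2\<close> occur in the equations, and
    nondegeneracy makes these fields a frame.\<close>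
  define V1 where "V1 q = (2 * h11 q, h12 q)" for q
  define V2 where "V2 q = (h12 q, 2 * h22 q)" for q
  have sV: "smooth_on S V1" "smooth_on S V2"
    unfolding V1_def V2_def by (intro smooth_intros S smooth)+
  have fV: "frame_at (V1 q) (V2 q)" if "q \<in> S" for q
    using nondeg[OF that] by (simp add: frame_at_def V1_def V2_def power2_eq_square)
  have lV: "lie V1 f q = 2 * h11 q * lie e_x f q + h12 q * lie e_y f q"
     "lie V2 f q = h12 q * lie e_x f q + 2 * h22 q * lie e_y f q" if "smooth_on S f" "q \<in> S" for f :: "real \<times> real \<Rightarrow> real" and q
    using lie_lincomb[OF that, of V1 "2 * h11 q" e_x "h12 q" e_y]
      lie_lincomb[OF that, of V2 "h12 q" e_x "2 * h22 q" e_y] by (simp_all add: V1_def V2_def)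
  note sx = smooth_on_const[OF S(1), of "(1::real, 0::real)"] and sy = smooth_on_const[OF S(1), of "(0::real, 1::real)"]
  have fr: "frame_at (1, 0) (0, 1)" by (simp add: frame_at_def)
  have c0: "lie e_y e_x q - lie e_x e_y q = 0 *\<^sub>R (1, 0) + 0 *\<^sub>R (0, 1)" for q
    by (simp add: zero_prod_def)
  note E = frame_form_integral_equations[OF sx sy smooth _ fr integral c0]
  have E1: "lie V1 a q = 2 * lie e_x h11 q * a q + lie e_y h11 q * b q" if "q \<in> S" for q
    using E(1)[OF that that] by (simp add: lV smooth that algebra_simps)
  have E2: "lie V1 b q + lie V2 a q = (2 * lie e_x h12 q * a q + lie e_x h11 q * b q)
      + (lie e_y h12 q * b q + 2 * lie e_y h11 q * c q)" if "q \<in> S" for q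
    using E(2)[OF that that] by (simp add: lV smooth that algebra_simps)
  have E3: "lie V1 c q + lie V2 b q = (2 * lie e_x h22 q * a q + lie e_x h12 q * b q)
      + (lie e_y h22 q * b q + 2 * lie e_y h12 q * c q)" if "q \<in> S" for q
    using E(3)[OF that that] by (simp add: lV smooth that algebra_simps)
  have E4: "lie V2 c q = lie e_x h22 q * b q + 2 * lie e_y h22 q * c q" if "q \<in> S" for q
    using E(4)[OF that that] by (simp add: lV smooth that algebra_simps)
  obtain k1 k2 where k: "smooth_on S k1" "smooth_on S k2"
    "\<And>q. q \<in> S \<Longrightarrow> lie V1 V2 q - lie V2 V1 q = k1 q *\<^sub>R V1 q + k2 q *\<^sub>R V2 q"
    by (rule frame_components[OF S(1) sV fV, of "\<lambda>q. lie V1 V2 q - lie V2 V1 q"])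
      (use S sV in \<open>auto intro: smooth_intros\<close>)
  have comm: "lie V1 (lie V2 f) q = lie V2 (lie V1 f) q + k1 q * lie V1 f q + k2 q * lie V2 f q"
    if "smooth_on S f" "q \<in> S" for f :: "real \<times> real \<Rightarrow> real" and q
  proof -
    have "dir_deriv f (k1 q *\<^sub>R V1 q + k2 q *\<^sub>R V2 q) q = k1 q * lie V1 f q + k2 q * lie V2 f q"
      using lie_lincomb[OF that, of "\<lambda>_. k1 q *\<^sub>R V1 q + k2 q *\<^sub>R V2 q" "k1 q" V1 "k2 q" V2]
      by (simp add: lie_def)
    then show ?thesis
      using lie_commutator[OF S(1) sV that] k(3)[OF that(2)] by simp
  qed
  \<comment> \<open>Three levels of unknowns: derivatives of \<open>B0\<close> along
    \<open>V1\<close> and \<open>V2\<close> will lie in the span of \<open>B1\<close>, those of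
    \<open>B1\<close> in the span of \<open>B2\<close>, and those of \<open>B2\<close> again in the
    span of \<open>B2\<close>.\<close>
  define \<alpha> where "\<alpha> = lie V2 a"
  define \<gamma> where "\<gamma> = lie V1 c"
  define \<beta> where "\<beta> = lie V2 \<alpha>"
  define B0 where "B0 = {a, b, c}"
  define B1 where "B1 = B0 \<union> {\<alpha>, \<gamma>}"
  define B2 where "B2 = B1 \<union> {\<beta>}"
  have sg: "smooth_on S \<alpha>" "smooth_on S \<gamma>" "smooth_on S \<beta>"
    unfolding \<alpha>_def \<gamma>_def \<beta>_def by (intro smooth_on_lie S sV smooth)+
  have sB: "smooth_on S f" if "f \<in> B2" for f
    using that smooth sg by (auto simp: B2_def B1_def B0_def)
  have sB1: "smooth_on S f" if "f \<in> B1" for f using that sB by (simp add: B2_def)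
  have sB0: "smooth_on S f" if "f \<in> B0" for f using that sB1 by (simp add: B1_def)
  have in0: "smooth_span S B0 a" "smooth_span S B0 b" "smooth_span S B0 c"
    by (auto intro: smooth_span.base simp: B0_def)
  have up1: "smooth_span S B1 f" if "smooth_span S B0 f" for f
    using that by (rule smooth_span_mono) (auto simp: B1_def)
  have up2: "smooth_span S B2 f" if "smooth_span S B1 f" for f
    using that by (rule smooth_span_mono) (auto simp: B2_def)
  have in1: "smooth_span S B1 \<alpha>" "smooth_span S B1 \<gamma>"
    by (auto intro: smooth_span.base simp: B1_def)
  have in2: "smooth_span S B2 \<beta>"
    by (auto intro: smooth_span.base simp: B2_def)
  note intros = smooth_span.add smooth_span.mult smooth_span_diff[OF S(1)]
    smooth_on_lie smooth_intros S smooth sx sy k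
  have V1a: "smooth_span S B0 (lie V1 a)"
    by (rule smooth_span.cong[OF _ E1[symmetric]]) (intro intros in0)
  have V2c: "smooth_span S B0 (lie V2 c)"
    by (rule smooth_span.cong[OF _ E4[symmetric]]) (intro intros in0)
  \<comment> \<open>The equations determine only the sums \<open>r2\<close> and \<open>r3\<close> on
    level \<open>B0\<close>. Solving them for \<open>V1 b\<close> and \<open>V2 b\<close> costs the
    new unknowns \<open>\<alpha>\<close> and \<open>\<gamma>\<close>.\<close>
  define r2 where "r2 q = lie V1 b q + lie V2 a q" for q
  define r3 where "r3 q = lie V1 c q + lie V2 b q" for q
  have r2: "smooth_span S B0 r2"
    by (rule smooth_span.cong[OF _ E2[symmetric, folded r2_def]]) (intro intros in0)
  have r3: "smooth_span S B0 r3"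
    by (rule smooth_span.cong[OF _ E3[symmetric, folded r3_def]]) (intro intros in0)
  have sr: "smooth_on S r2" "smooth_on S r3"
    using smooth_span_smooth[OF S(1) sB0] r2 r3 by blast+
  have V1b: "smooth_span S B1 (lie V1 b)"
    by (rule smooth_span.cong[OF smooth_span_diff[OF S(1) up1[OF r2] in1(1)]]) (simp add: r2_def \<alpha>_def)
  have V2b: "smooth_span S B1 (lie V2 b)"
    by (rule smooth_span.cong[OF smooth_span_diff[OF S(1) up1[OF r3] in1(2)]]) (simp add: r3_def \<gamma>_def)
  have lie0: "smooth_span S B1 (lie V1 f)" "smooth_span S B1 (lie V2 f)" if "smooth_span S B0 f" for f
  proof -
    have "smooth_span S B1 (lie V1 f)" "smooth_span S B1 (lie V2 f)" if "f \<in> B0" for f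
      using that up1[OF V1a] up1[OF V2c] V1b V2b in1
      by (auto simp: B0_def \<alpha>_def[symmetric] \<gamma>_def[symmetric])
    moreover have "B0 \<subseteq> B1" by (auto simp: B1_def)
    ultimately show "smooth_span S B1 (lie V1 f)" "smooth_span S B1 (lie V2 f)"
      using smooth_span_lie[OF S(1) sV(1) sB0 _ _ that] smooth_span_lie[OF S(1) sV(2) sB0 _ _ that] by blast+
  qed
  \<comment> \<open>Commuting the derivations moves \<open>V1\<close> onto \<open>a\<close>, where
    the first equation expresses it on level \<open>B0\<close>, so the remaining \<open>V2\<close>
    reaches only \<open>B1\<close>. For \<open>V2 \<gamma>\<close> the last equation plays this
    part.\<close>
  have V1\<alpha>: "smooth_span S B1 (lie V1 \<alpha>)"
  proof (rule smooth_span.cong)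
    show "smooth_span S B1 (\<lambda>q. lie V2 (lie V1 a) q + k1 q * lie V1 a q + k2 q * \<alpha> q)"
      by (intro intros lie0 V1a up1[OF V1a] in1)
  qed (simp add: \<alpha>_def comm smooth)
  have V2\<gamma>: "smooth_span S B1 (lie V2 \<gamma>)"
  proof (rule smooth_span.cong)
    show "smooth_span S B1 (\<lambda>q. lie V1 (lie V2 c) q - k1 q * \<gamma> q - k2 q * lie V2 c q)"
      by (intro intros lie0 V2c up1[OF V2c] in1)
  qed (simp add: \<gamma>_def comm smooth)
  \<comment> \<open>Comparing \<open>V1 V2 b\<close> with \<open>V2 V1 b\<close> through the two sum
    relations yields \<open>V1 \<gamma> = \<beta> + \<rho>\<close> with \<open>\<rho>\<close> on
    level \<open>B1\<close>. Hence \<open>V1 V1 c\<close> and \<open>V2 V2 a\<close> count as a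
    single new unknown.\<close>
  define \<rho> where "\<rho> q = lie V1 r3 q - lie V2 r2 q - (k1 q * lie V1 b q + k2 q * lie V2 b q)" for q
  have \<rho>: "smooth_span S B1 \<rho>"
    unfolding \<rho>_def by (intro intros lie0 r2 r3 V1b V2b)
  have s\<rho>: "smooth_on S \<rho>" using smooth_span_smooth[OF S(1) _ \<rho>] sB1 by blast
  have \<gamma>\<beta>: "lie V1 \<gamma> q = \<beta> q + \<rho> q" if "q \<in> S" for q
  proof -
    have "lie V1 \<gamma> q = lie V1 (\<lambda>q. r3 q - lie V2 b q) q"
      by (rule lie_cong[OF S(1) that]) (simp add: r3_def \<gamma>_def)
    also have "\<dots> = lie V1 r3 q - lie V1 (lie V2 b) q"
      by (rule lie_diff[OF sr(2) smooth_on_lie[OF S(1) sV(2) smooth(5)] that])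
    also have "lie V1 (lie V2 b) q = lie V2 (lie V1 b) q + k1 q * lie V1 b q + k2 q * lie V2 b q"
      by (rule comm[OF smooth(5) that])
    also have "lie V2 (lie V1 b) q = lie V2 (\<lambda>q. r2 q - \<alpha> q) q"
      by (rule lie_cong[OF S(1) that]) (simp add: r2_def \<alpha>_def)
    also have "\<dots> = lie V2 r2 q - \<beta> q"
      unfolding \<beta>_def by (rule lie_diff[OF sr(1) sg(1) that])
    finally show ?thesis by (simp add: \<rho>_def)
  qed
  have V1\<gamma>: "smooth_span S B2 (lie V1 \<gamma>)"
    by (rule smooth_span.cong[OF smooth_span.add[OF in2 up2[OF \<rho>]]]) (simp add: \<gamma>\<beta>)
  have lie1: "smooth_span S B2 (lie V1 f)" "smooth_span S B2 (lie V2 f)" if "smooth_span S B1 f" for f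
  proof -
    have "smooth_span S B2 (lie V1 f)" "smooth_span S B2 (lie V2 f)" if "f \<in> B1" for f
      using that up2[OF lie0(1)[OF smooth_span.base]] up2[OF lie0(2)[OF smooth_span.base]]
        up2[OF V1\<alpha>] up2[OF V2\<gamma>] V1\<gamma> in2
      by (auto simp: B1_def \<beta>_def[symmetric])
    moreover have "B1 \<subseteq> B2" by (auto simp: B2_def)
    ultimately show "smooth_span S B2 (lie V1 f)" "smooth_span S B2 (lie V2 f)"
      using smooth_span_lie[OF S(1) sV(1) sB1 _ _ that] smooth_span_lie[OF S(1) sV(2) sB1 _ _ that] by blast+
  qed
  have V1\<beta>: "smooth_span S B2 (lie V1 \<beta>)"
  proof (rule smooth_span.cong)
    show "smooth_span S B2 (\<lambda>q. lie V2 (lie V1 \<alpha>) q + k1 q * lie V1 \<alpha> q + k2 q * \<beta> q)"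
      by (intro intros lie1 V1\<alpha> up2[OF V1\<alpha>] in2)
  qed (simp add: \<beta>_def comm sg)
  \<comment> \<open>Here the system closes. By the relation for \<open>V1 \<gamma>\<close>, the
    derivative \<open>V2 \<beta>\<close> is \<open>V2 V1 \<gamma>\<close> minus
    \<open>V2 \<rho>\<close>, and commuting leads to \<open>V1 V2 \<gamma>\<close>, where
    \<open>V2 \<gamma>\<close> is on level \<open>B1\<close>.\<close>
  have V2\<beta>: "smooth_span S B2 (lie V2 \<beta>)"
  proof (rule smooth_span.cong)
    show "smooth_span S B2 (\<lambda>q. lie V1 (lie V2 \<gamma>) q - k1 q * lie V1 \<gamma> q - k2 q * lie V2 \<gamma> q - lie V2 \<rho> q)"
      by (intro intros lie1 V2\<gamma> up2[OF V2\<gamma>] V1\<gamma> \<rho>)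
    fix q assume q: "q \<in> S"
    have "lie V2 (lie V1 \<gamma>) q = lie V2 (\<lambda>q. \<beta> q + \<rho> q) q"
      by (rule lie_cong[OF S(1) q]) (rule \<gamma>\<beta>)
    also have "\<dots> = lie V2 \<beta> q + lie V2 \<rho> q"
      by (rule lie_add[OF sg(3) s\<rho> q])
    finally show "lie V1 (lie V2 \<gamma>) q - k1 q * lie V1 \<gamma> q - k2 q * lie V2 \<gamma> q - lie V2 \<rho> q = lie V2 \<beta> q"
      using comm[OF sg(2) q] by simp
  qed
  have dd: "smooth_span S B2 (dir_deriv f v)" if f: "f \<in> B2" for f v
  proof -
    have V12: "smooth_span S B2 (lie V1 f)" "smooth_span S B2 (lie V2 f)"
      using f lie1[OF smooth_span.base] V1\<beta> V2\<beta> by (auto simp: B2_def)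
    obtain m1 m2 where m: "smooth_on S m1" "smooth_on S m2" "\<And>q. q \<in> S \<Longrightarrow> v = m1 q *\<^sub>R V1 q + m2 q *\<^sub>R V2 q"
      using frame_components[OF S(1) sV fV smooth_on_const[OF S(1)]] by metis
    show ?thesis
    proof (rule smooth_span.cong)
      show "smooth_span S B2 (\<lambda>q. m1 q * lie V1 f q + m2 q * lie V2 f q)"
        by (intro intros V12 m)
      show "m1 q * lie V1 f q + m2 q * lie V2 f q = dir_deriv f v q" if "q \<in> S" for q
        using lie_lincomb[OF sB[OF f] that, of "\<lambda>_. v" "m1 q" V1 "m2 q" V2] m(3)[OF that]
        by (simp add: lie_def)
    qed
  qed
  obtain q0 where q0: "q0 \<in> U" "q0 \<in> S" using U by blast
  \<comment> \<open>The initial values of the adjoined derivatives vanish because \<open>a\<close>,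
    \<open>b\<close>, \<open>c\<close> vanish on a whole open set around the starting point.\<close>
  have lz: "lie e f x = 0" if "\<And>x. x \<in> U \<Longrightarrow> f x = 0" "x \<in> U" for e and f :: "real \<times> real \<Rightarrow> real" and x
    using lie_cong[OF U(1) that(2), of f "\<lambda>_. 0" e] that(1) by simp
  have \<alpha>0: "\<alpha> x = 0" if "x \<in> U" for x unfolding \<alpha>_def by (rule lz[OF _ that]) (simp add: zero)
  have "\<beta> q0 = 0" unfolding \<beta>_def by (rule lz[OF \<alpha>0 q0(1)])
  moreover have "\<gamma> q0 = 0" unfolding \<gamma>_def by (rule lz[OF _ q0(1)]) (simp add: zero)
  ultimately have "f q0 = 0" if "f \<in> B2" for f
    using that zero[OF q0(1)] \<alpha>0[OF q0(1)] by (auto simp: B2_def B1_def B0_def)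
  then have "f q = 0" if "f \<in> B2" for f
    using smooth_span_system_vanish[OF S q0(2) \<open>q \<in> S\<close> _ sB dd _ that]
    by (simp add: B2_def B1_def B0_def)
  then show ?thesis by (simp add: B2_def B1_def B0_def)
qed

section \<open>Normal forms in a coordinate domain\<close>

text \<open>The covector, in the old coordinates, whose canonical momenta are \<open>p\<close> in
  coordinates for which \<open>e1\<close> and \<open>e2\<close> are the coordinate fields; obtained
  by Cramer's rule.\<close>

definition dual_covector :: "real \<times> real \<Rightarrow> real \<times> real \<Rightarrow> real \<times> real \<Rightarrow> real \<times> real" where
  "dual_covector e1 e2 p =
     ((snd e2 * fst p - snd e1 * snd p) / (fst e1 * snd e2 - fst e2 * snd e1),
      (fst e1 * snd p - fst e2 * fst p) / (fst e1 * snd e2 - fst e2 * snd e1))"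

lemma dual_covector_inner:
  assumes "frame_at e1 e2"
  shows "dual_covector e1 e2 p \<bullet> e1 = fst p" "dual_covector e1 e2 p \<bullet> e2 = snd p"
  using assms
  by (simp_all add: frame_at_def dual_covector_def inner_prod_def divide_simps, simp_all add: algebra_simps)

lemma dual_covector_components:
  assumes "frame_at e1 e2"
  shows "dual_covector e1 e2 (p \<bullet> e1, p \<bullet> e2) = p"
  using assms
  by (intro prod_eqI) (simp_all add: frame_at_def dual_covector_def inner_prod_def divide_simps,
      simp_all add: algebra_simps)

text \<open>If \<open>\<Phi>\<close> straightens the frame, this is the metric in the new
  coordinates: the frame stands in for the derivative of \<open>\<Phi>\<close>, and in
  \<open>pull_form\<close> its inverse transpose is written out by
  \<open>dual_covector\<close>.\<close>

definition pull_metric where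
  "pull_metric G \<Phi> e1 e2 = (\<lambda>(z, u). G (\<Phi> z, fst u *\<^sub>R e1 (\<Phi> z) + snd u *\<^sub>R e2 (\<Phi> z)))"

definition pull_form where
  "pull_form F \<Phi> e1 e2 = (\<lambda>(z, p). F (\<Phi> z, dual_covector (e1 (\<Phi> z)) (e2 (\<Phi> z)) p))"

definition normal_form ::
    "(real \<times> real) set \<Rightarrow> ((real \<times> real) \<times> (real \<times> real) \<Rightarrow> real) \<Rightarrow>
     ((real \<times> real) \<times> (real \<times> real) \<Rightarrow> real) \<Rightarrow> bool" where
  "normal_form D G f \<longleftrightarrow> liouville_form 1 D G f \<or> complex_liouville_form D G f \<or>
     (\<exists>\<sigma>\<in>{1, -1}. liouville_form (- 1) D G (\<lambda>z. \<sigma> * f z) \<or> jordan_block_form D G (\<lambda>z. \<sigma> * f z))"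

text \<open>Asks for some nonempty \<open>V\<close> inside \<open>U\<close>, not for a neighbourhood
  of a prescribed point. Applied to every open \<open>U\<close> it gives density, and it leaves room
  for shrinking.\<close>

definition admits_coordinates where
  "admits_coordinates P U G F \<longleftrightarrow> (\<exists>V D \<psi> \<Phi> e1 e2. V \<noteq> {} \<and> V \<subseteq> U \<and> coordinate_change V D \<psi> \<Phi> \<and>
     (\<forall>q\<in>V. frame_at (e1 q) (e2 q)) \<and> straightens D \<Phi> e1 e2 \<and>
     P D (pull_metric G \<Phi> e1 e2) (pull_form F \<Phi> e1 e2))"

lemma admits_coordinates_mono:
  "admits_coordinates P U G F \<Longrightarrow> U \<subseteq> U' \<Longrightarrow> (\<And>D G f. P D G f \<Longrightarrow> P' D G f) \<Longrightarrow> admits_coordinates P' U' G F"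
  unfolding admits_coordinates_def by (meson order_trans)

lemma admits_coordinates_scale:
  "admits_coordinates P U G (\<lambda>z. \<sigma> * F z) \<Longrightarrow> admits_coordinates (\<lambda>D G f. P D G (\<lambda>z. \<sigma> * f z)) U G F"
  unfolding admits_coordinates_def pull_form_def split_beta .

lemma has_derivative_straightens:
  assumes "straightens D \<Phi> e1 e2" "smooth_on V f" "\<Phi> z \<in> V" "z \<in> D"
  shows "((\<lambda>z. f (\<Phi> z)) has_derivative (\<lambda>v. fst v *\<^sub>R lie e1 f (\<Phi> z) + snd v *\<^sub>R lie e2 f (\<Phi> z))) (at z)"
proof -
  note d = smooth_on_has_derivative[OF assms(2,3)]
  interpret bounded_linear "\<lambda>v. dir_deriv f v (\<Phi> z)"
    using d by (rule has_derivative_bounded_linear)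
  have "(\<Phi> has_derivative (\<lambda>v. fst v *\<^sub>R e1 (\<Phi> z) + snd v *\<^sub>R e2 (\<Phi> z))) (at z)"
    using assms(1,4) by (simp add: straightens_def)
  from diff_chain_at[OF this d] show ?thesis by (simp add: o_def add scaleR lie_def)
qed

lemma lie_zero_straightens_fst:
  fixes f :: "real \<times> real \<Rightarrow> real"
  assumes "straightens ({-r<..<r} \<times> {-r<..<r}) \<Phi> e1 e2" "smooth_on V f"
    "\<And>z. z \<in> {-r<..<r} \<times> {-r<..<r} \<Longrightarrow> \<Phi> z \<in> V" "\<And>q. q \<in> V \<Longrightarrow> lie e1 f q = 0"
    "x \<in> {-r<..<r}" "x' \<in> {-r<..<r}" "y \<in> {-r<..<r}"
  shows "f (\<Phi> (x, y)) = f (\<Phi> (x', y))"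
proof -
  have "((\<lambda>x. f (\<Phi> (x, y))) has_derivative (\<lambda>h. 0)) (at x within {-r<..<r})" if "x \<in> {-r<..<r}" for x
  proof -
    have "((\<lambda>x. (x, y)) has_derivative (\<lambda>h. (h, 0))) (at x)"
      by (auto intro!: derivative_eq_intros)
    from diff_chain_at[OF this has_derivative_straightens[OF assms(1,2)]] that assms
    show ?thesis by (simp add: o_def has_derivative_at_withinI)
  qed
  then show ?thesis
    using has_derivative_zero_unique[of "{-r<..<r}" "\<lambda>x. f (\<Phi> (x, y))" x' x] assms by auto
qed

lemma lie_zero_straightens_snd:
  fixes f :: "real \<times> real \<Rightarrow> real"
  assumes "straightens ({-r<..<r} \<times> {-r<..<r}) \<Phi> e1 e2" "smooth_on V f"
    "\<And>z. z \<in> {-r<..<r} \<times> {-r<..<r} \<Longrightarrow> \<Phi> z \<in> V" "\<And>q. q \<in> V \<Longrightarrow> lie e2 f q = 0"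
    "x \<in> {-r<..<r}" "y \<in> {-r<..<r}" "y' \<in> {-r<..<r}"
  shows "f (\<Phi> (x, y)) = f (\<Phi> (x, y'))"
proof -
  have "((\<lambda>y. f (\<Phi> (x, y))) has_derivative (\<lambda>h. 0)) (at y within {-r<..<r})" if "y \<in> {-r<..<r}" for y
  proof -
    have "((\<lambda>y. (x, y)) has_derivative (\<lambda>h. (0, h))) (at y)"
      by (auto intro!: derivative_eq_intros)
    from diff_chain_at[OF this has_derivative_straightens[OF assms(1,2)]] that assms
    show ?thesis by (simp add: o_def has_derivative_at_withinI)
  qed
  then show ?thesis
    using has_derivative_zero_unique[of "{-r<..<r}" "\<lambda>y. f (\<Phi> (x, y))" y' y] assms by auto
qed

lemma poisson_bracket_cong:
  assumes "open S" "q \<in> S" "\<And>q p. q \<in> S \<Longrightarrow> H (q, p) = H' (q, p)" "\<And>q p. q \<in> S \<Longrightarrow> F (q, p) = F' (q, p)"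
  shows "poisson_bracket H F (q, p) = poisson_bracket H' F' (q, p)"
proof -
  have "open (S \<times> (UNIV :: (real \<times> real) set))" by (intro open_Times assms open_UNIV)
  then have "frechet_derivative f (at (q, p)) = frechet_derivative f' (at (q, p))"
    if "\<And>q p. q \<in> S \<Longrightarrow> f (q, p) = f' (q, p)" for f f' :: "(real \<times> real) \<times> (real \<times> real) \<Rightarrow> real"
    using dir_deriv_cong[of "S \<times> UNIV" "(q, p)" f f'] assms(2) that
    by (force simp: dir_deriv_def fun_eq_iff)
  from this[of H H'] this[of F F'] show ?thesis
    using assms(3,4) by (simp add: poisson_bracket_def)
qed

text \<open>The energy is half the inverse form, so in the frame the inverse Gram matrix has the
  entries \<open>2 * n11\<close>, \<open>n12\<close>, \<open>n12\<close>, \<open>2 * n22\<close>;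
  the claim is its inversion, with determinant \<open>4 * n11 * n22 - n12\<^sup>2\<close>.\<close>

lemma dual_form_in_frame:
  fixes g11 g12 g22 :: real
  assumes frame: "frame_at e1 e2" and nondeg: "g11 * g22 - g12\<^sup>2 \<noteq> 0"
    and Q: "\<And>dx dy. Q (dx, dy) = g11 * dx\<^sup>2 + 2 * g12 * dx * dy + g22 * dy\<^sup>2"
    and dual: "\<And>p. half_inverse_form Q p = n11 * (p \<bullet> e1)\<^sup>2 + n12 * (p \<bullet> e1) * (p \<bullet> e2) + n22 * (p \<bullet> e2)\<^sup>2"
  shows "Q (a *\<^sub>R e1 + b *\<^sub>R e2) =
    2 * (n22 * a\<^sup>2 - n12 * a * b + n11 * b\<^sup>2) / (4 * n11 * n22 - n12\<^sup>2)"
proof -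
  obtain x1 y1 x2 y2 where e: "e1 = (x1, y1)" "e2 = (x2, y2)" by (metis surj_pair)
  define \<Delta> where "\<Delta> = g11 * g22 - g12\<^sup>2"
  define N where "N = 4 * n11 * n22 - n12\<^sup>2"
  define d where "d = x1 * y2 - x2 * y1"
  have d: "d \<noteq> 0" using frame by (simp add: frame_at_def d_def e)
  have \<Delta>: "\<Delta> \<noteq> 0" using nondeg by (simp add: \<Delta>_def)
  have half: "half_inverse_form Q (px, py) = (g22 * px\<^sup>2 - 2 * g12 * px * py + g11 * py\<^sup>2) / \<Delta> / 2" for px py
    by (simp add: half_inverse_form_def Q Let_def \<Delta>_def)
  have g22: "g22 = \<Delta> * (2 * (n11 * x1\<^sup>2 + n12 * x1 * x2 + n22 * x2\<^sup>2))"
    using dual[of "(1, 0)"] \<Delta> by (simp add: half e field_simps)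
  have g11: "g11 = \<Delta> * (2 * (n11 * y1\<^sup>2 + n12 * y1 * y2 + n22 * y2\<^sup>2))"
    using dual[of "(0, 1)"] \<Delta> by (simp add: half e field_simps)
  have sum: "g22 - 2 * g12 + g11 = \<Delta> * (2 * (n11 * (x1 + y1)\<^sup>2 + n12 * (x1 + y1) * (x2 + y2) + n22 * (x2 + y2)\<^sup>2))"
    using dual[of "(1, 1)"] \<Delta> by (simp add: half e field_simps)
  have g12: "g12 = \<Delta> * (- (2 * n11 * x1 * y1 + n12 * (x1 * y2 + x2 * y1) + 2 * n22 * x2 * y2))"
    using sum unfolding g11 g22 by (simp add: algebra_simps power2_eq_square)
  \<comment> \<open>Multiplicativity of determinants: the Gram determinant, the squared determinant
    of the frame and \<open>N\<close> have product 1.\<close>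
  have "\<Delta> = \<Delta>\<^sup>2 * (N * d\<^sup>2)"
  proof -
    have "\<Delta> = g11 * g22 - g12\<^sup>2" by (rule \<Delta>_def)
    also have "\<dots> = \<Delta>\<^sup>2 * (N * d\<^sup>2)"
      unfolding g11 g22 g12 N_def d_def by (simp add: algebra_simps power2_eq_square)
    finally show ?thesis .
  qed
  then have N: "\<Delta> * d\<^sup>2 * N = 1" using \<Delta> by (simp add: power2_eq_square field_simps)
  then have "N \<noteq> 0" by auto
  have "Q (a *\<^sub>R e1 + b *\<^sub>R e2) = g11 * (a * x1 + b * x2)\<^sup>2
      + 2 * g12 * (a * x1 + b * x2) * (a * y1 + b * y2) + g22 * (a * y1 + b * y2)\<^sup>2"
    by (simp add: e Q)
  also have "\<dots> = \<Delta> * d\<^sup>2 * (2 * (n22 * a\<^sup>2 - n12 * a * b + n11 * b\<^sup>2))"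
    unfolding d_def by (subst g11, subst g12, subst g22) (simp add: algebra_simps power2_eq_square)
  also have "\<Delta> * d\<^sup>2 = 1 / N" using N \<open>N \<noteq> 0\<close> by (simp add: field_simps)
  finally show ?thesis by (simp add: N_def)
qed

section \<open>The equations of an integral in an adapted frame\<close>

locale local_integral =
  fixes S :: "(real \<times> real) set" and G K F :: "(real \<times> real) \<times> (real \<times> real) \<Rightarrow> real"
  assumes open_S: "open S"
    and metric: "\<And>q. q \<in> S \<Longrightarrow> \<exists>g11 g12 g22. g11 * g22 - g12\<^sup>2 \<noteq> 0 \<and>
      (\<forall>dx dy. G (q, (dx, dy)) = g11 * dx\<^sup>2 + 2 * g12 * dx * dy + g22 * dy\<^sup>2)"
    and energy: "\<And>q p. q \<in> S \<Longrightarrow> K (q, p) = half_inverse_form (\<lambda>u. G (q, u)) p"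
    and integral: "\<And>q p. q \<in> S \<Longrightarrow> poisson_bracket K F (q, p) = 0"
begin

lemma subset: "open S' \<Longrightarrow> S' \<subseteq> S \<Longrightarrow> local_integral S' G K F"
  by unfold_locales (use metric energy integral in blast)+

lemma metric_in_frame:
  assumes "q \<in> S" "frame_at (e1 q) (e2 q)" "\<And>p. K (q, p) = frame_form e1 e2 n11 n12 n22 (q, p)"
  shows "G (q, a *\<^sub>R e1 q + b *\<^sub>R e2 q) =
    2 * (n22 q * a\<^sup>2 - n12 q * a * b + n11 q * b\<^sup>2) / (4 * n11 q * n22 q - (n12 q)\<^sup>2)"
proof -
  obtain g11 g12 g22 where g: "g11 * g22 - g12\<^sup>2 \<noteq> 0"
    "\<And>dx dy. G (q, (dx, dy)) = g11 * dx\<^sup>2 + 2 * g12 * dx * dy + g22 * dy\<^sup>2"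
    using metric[OF assms(1)] by blast
  show ?thesis
    by (rule dual_form_in_frame[where Q = "\<lambda>u. G (q, u)", OF assms(2) g])
      (use assms(3) energy[OF assms(1)] in \<open>simp add: frame_form_def\<close>)
qed

text \<open>The outer coefficients of the cubic contain only \<open>lie e1 Y\<close> and
  \<open>lie e2 X\<close>. Once these vanish, the inner coefficients reduce to multiples of the
  bracket components \<open>c1\<close> and \<open>c2\<close>.\<close>

lemma liouville_frame:
  assumes smooth: "smooth_on S e1" "smooth_on S e2" "smooth_on S X" "smooth_on S Y"
    and frame: "\<And>q. q \<in> S \<Longrightarrow> frame_at (e1 q) (e2 q)"
    and \<epsilon>: "\<epsilon> = 1 \<or> \<epsilon> = -1" and nz: "\<And>q. q \<in> S \<Longrightarrow> X q \<noteq> Y q"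
    and K: "\<And>q p. q \<in> S \<Longrightarrow> K (q, p) = ((p \<bullet> e1 q)\<^sup>2 + \<epsilon> * (p \<bullet> e2 q)\<^sup>2) / (2 * (X q - Y q))"
    and F: "\<And>q p. q \<in> S \<Longrightarrow> F (q, p) = (X q * (p \<bullet> e2 q)\<^sup>2 + \<epsilon> * (Y q * (p \<bullet> e1 q)\<^sup>2)) / (X q - Y q)"
    and q: "q \<in> S"
  shows "lie e2 e1 q = lie e1 e2 q" "lie e2 X q = 0" "lie e1 Y q = 0"
proof -
  define n where "n q = 1 / (2 * (X q - Y q))" for q
  define h22 where "h22 q = \<epsilon> * n q" for q
  define f11 where "f11 q = 2 * \<epsilon> * (Y q * n q)" for q
  define f22 where "f22 q = 2 * (X q * n q)" for q
  note def = h22_def f11_def f22_def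
  define z where "z = (\<lambda>q::real \<times> real. 0::real)"
  have \<epsilon>2: "\<epsilon> * \<epsilon> = 1" using \<epsilon> by auto
  have n: "smooth_on S n" and n0: "n q \<noteq> 0"
    unfolding n_def using nz q by (auto intro!: smooth_intros open_S smooth)
  have z: "smooth_on S z" unfolding z_def by (rule smooth_on_const[OF open_S])
  have sm: "smooth_on S h22" "smooth_on S f11" "smooth_on S f22"
    unfolding def by (intro smooth_intros open_S smooth n)+
  have K': "K (q, p) = frame_form e1 e2 n z h22 (q, p)" if "q \<in> S" for q p
    by (simp add: K[OF that] frame_form_def n_def z_def def add_divide_distrib)
  have F': "F (q, p) = frame_form e1 e2 f11 z f22 (q, p)"
    if "q \<in> S" for q p
  proof -
    have "(x * P2 + \<epsilon> * (y * P1)) / D = 2 * \<epsilon> * (y * (1 / (2 * D))) * P1 + 2 * (x * (1 / (2 * D))) * P2"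
      for x y D P1 P2 :: real by (simp add: add_divide_distrib)
    then show ?thesis by (simp only: F[OF that] frame_form_def n_def z_def def prod.case mult_zero_left add_0_right)
  qed
  have int: "poisson_bracket (frame_form e1 e2 n z h22)
      (frame_form e1 e2 f11 z f22) (q, p) = 0" for p
    by (rule trans[OF poisson_bracket_cong[OF open_S q] integral[OF q]]) (erule K'[symmetric] F'[symmetric])+
  obtain c1 c2 where c: "lie e2 e1 q - lie e1 e2 q = c1 *\<^sub>R e1 q + c2 *\<^sub>R e2 q"
    using frame_at_vector[OF frame[OF q]] .
  note E = frame_form_integral_equations[OF smooth(1,2) n z sm(1,2) z sm(3) q frame[OF q] int c]
  have l1: "lie e h22 q = \<epsilon> * lie e n q" for e
    using lie_mult[OF smooth_on_const[OF open_S] n q, of e \<epsilon>] by (simp add: def[abs_def])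
  have l2: "lie e f11 q = 2 * \<epsilon> * (Y q * lie e n q + n q * lie e Y q)" for e
    using lie_mult[OF smooth_on_const[OF open_S] smooth_on_mult[OF open_S smooth(4) n] q, of e "2 * \<epsilon>"]
      lie_mult[OF smooth(4) n q, of e] by (simp only: def[abs_def]) simp
  have l3: "lie e f22 q = 2 * (X q * lie e n q + n q * lie e X q)" for e
    using lie_mult[OF smooth_on_const[OF open_S] smooth_on_mult[OF open_S smooth(3) n] q, of e 2]
      lie_mult[OF smooth(3) n q, of e] by (simp only: def[abs_def]) simp
  have l4: "lie e z q = 0" for e by (simp add: z_def)
  have z0: "z q = 0" by (simp add: z_def)
  have XY: "(X q - Y q) * n q = 1 / 2" using nz[OF q] by (simp add: n_def)
  \<comment> \<open>Obtained by differentiating \<open>(X - Y) * n = 1 / 2\<close>; it eliminates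
    the derivatives of \<open>n\<close> from the inner coefficients.\<close>
  have dXY: "(X q - Y q) * lie e n q + n q * (lie e X q - lie e Y q) = 0" for e
  proof -
    have "lie e (\<lambda>q. (X q - Y q) * n q) q = lie e (\<lambda>q. 1 / 2) q"
      by (rule lie_cong[OF open_S q]) (use nz in \<open>simp add: n_def\<close>)
    then show ?thesis
      by (simp add: lie_mult[OF smooth_on_diff[OF open_S smooth(3,4)] n q] lie_diff[OF smooth(3,4) q])
  qed
  have "4 * \<epsilon> * (n q)\<^sup>2 * lie e1 Y q = 0"
    using E(1) by (simp add: l1 l2 l3 l4 z0 def algebra_simps power2_eq_square)
  then show Y1: "lie e1 Y q = 0" using n0 \<epsilon> by auto
  have "4 * \<epsilon> * (n q)\<^sup>2 * lie e2 X q = 0"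
    using E(4) by (simp add: l1 l2 l3 l4 z0 def algebra_simps power2_eq_square)
  then show X2: "lie e2 X q = 0" using n0 \<epsilon> by auto
  have "4 * n q * ((X q - Y q) * lie e2 n q - n q * lie e2 Y q) + 8 * n q * (c1 * ((X q - Y q) * n q)) = 0"
    using E(2) \<epsilon>2 by (simp add: l1 l2 l3 l4 z0 def) algebra
  moreover have "(X q - Y q) * lie e2 n q - n q * lie e2 Y q = 0"
    using dXY[of e2] X2 by (simp add: algebra_simps)
  ultimately have c1: "c1 = 0" using XY n0 by simp
  have "- 4 * n q * ((X q - Y q) * lie e1 n q + n q * lie e1 X q) + 8 * n q * (c2 * ((X q - Y q) * n q)) = 0"
    using E(3) \<epsilon>2 by (simp add: l1 l2 l3 l4 z0 def) algebra
  moreover have "(X q - Y q) * lie e1 n q + n q * lie e1 X q = 0"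
    using dXY[of e1] Y1 by (simp add: algebra_simps)
  ultimately have "c2 = 0" using XY n0 by simp
  then show "lie e2 e1 q = lie e1 e2 q" using c c1 by simp
qed

text \<open>Here \<open>u\<close> is the coefficient of \<open>K\<close> in \<open>F\<close>. As the
  bracket of \<open>K\<close> with \<open>u K\<close> is \<open>K\<close> times that of
  \<open>K\<close> with \<open>u\<close>, derivatives of \<open>n\<close> survive only next to
  \<open>s1\<close> or \<open>s2\<close>. The values 1, -1 and 0 of \<open>s1\<close>,
  \<open>s2\<close> cover all cases of an indefinite metric, including that of \<open>F\<close>
  proportional to \<open>K\<close>.\<close>

lemma null_frame:
  assumes smooth: "smooth_on S e1" "smooth_on S e2" "smooth_on S n" "smooth_on S u"
    and frame: "\<And>q. q \<in> S \<Longrightarrow> frame_at (e1 q) (e2 q)"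
    and nz: "\<And>q. q \<in> S \<Longrightarrow> n q \<noteq> 0"
    and K: "\<And>q p. q \<in> S \<Longrightarrow> K (q, p) = n q * (p \<bullet> e1 q) * (p \<bullet> e2 q)"
    and F: "\<And>q p. q \<in> S \<Longrightarrow> F (q, p) =
      s1 * (p \<bullet> e1 q)\<^sup>2 + u q * n q * (p \<bullet> e1 q) * (p \<bullet> e2 q) + s2 * (p \<bullet> e2 q)\<^sup>2"
    and q: "q \<in> S" and c: "lie e2 e1 q - lie e1 e2 q = c1 *\<^sub>R e1 q + c2 *\<^sub>R e2 q"
  shows "s1 * c1 = 0" "s2 * c2 = 0"
    "(n q)\<^sup>2 * lie e2 u q = 2 * s1 * lie e1 n q - 2 * n q * s1 * c2"
    "(n q)\<^sup>2 * lie e1 u q = 2 * s2 * lie e2 n q + 2 * n q * s2 * c1"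
proof -
  note const = smooth_on_const[OF open_S, of "_ :: real"]
  have un: "smooth_on S (\<lambda>q. u q * n q)" by (intro smooth_intros open_S smooth)
  have K': "K (q, p) = frame_form e1 e2 (\<lambda>_. 0) n (\<lambda>_. 0) (q, p)" if "q \<in> S" for q p
    by (simp add: K[OF that] frame_form_def)
  have F': "F (q, p) = frame_form e1 e2 (\<lambda>_. s1) (\<lambda>q. u q * n q) (\<lambda>_. s2) (q, p)" if "q \<in> S" for q p
    by (simp add: F[OF that] frame_form_def)
  have int: "poisson_bracket (frame_form e1 e2 (\<lambda>_. 0) n (\<lambda>_. 0))
      (frame_form e1 e2 (\<lambda>_. s1) (\<lambda>q. u q * n q) (\<lambda>_. s2)) (q, p) = 0" for p
    by (rule trans[OF poisson_bracket_cong[OF open_S q] integral[OF q]]) (erule K'[symmetric] F'[symmetric])+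
  note E = frame_form_integral_equations[OF smooth(1,2) const smooth(3) const const un const q frame[OF q] int c]
  have l: "lie e (\<lambda>q. u q * n q) q = u q * lie e n q + n q * lie e u q" for e
    by (rule lie_mult[OF smooth(4,3) q])
  show "s1 * c1 = 0" "s2 * c2 = 0" using E(1,4) nz[OF q] by auto
  show "(n q)\<^sup>2 * lie e2 u q = 2 * s1 * lie e1 n q - 2 * n q * s1 * c2"
    using E(2) unfolding l by (simp add: algebra_simps power2_eq_square)
  show "(n q)\<^sup>2 * lie e1 u q = 2 * s2 * lie e2 n q + 2 * n q * s2 * c1"
    using E(3) unfolding l by (simp add: algebra_simps power2_eq_square)
qed

end

section \<open>Coordinates realizing each normal form\<close>

context local_integral
begin

text \<open>By \<open>liouville_frame\<close> the frame commutes and becomes a coordinate frame.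
  Then \<open>X\<close> is constant along the second coordinate and \<open>Y\<close> along the
  first, so their restrictions to the axes serve as the functions of one variable.\<close>

lemma liouville_coordinates:
  assumes smooth: "smooth_on S e1" "smooth_on S e2" "smooth_on S X" "smooth_on S Y"
    and frame: "\<And>q. q \<in> S \<Longrightarrow> frame_at (e1 q) (e2 q)"
    and \<epsilon>: "\<epsilon> = 1 \<or> \<epsilon> = -1" and nz: "\<And>q. q \<in> S \<Longrightarrow> X q \<noteq> Y q"
    and K: "\<And>q p. q \<in> S \<Longrightarrow> K (q, p) = ((p \<bullet> e1 q)\<^sup>2 + \<epsilon> * (p \<bullet> e2 q)\<^sup>2) / (2 * (X q - Y q))"
    and F: "\<And>q p. q \<in> S \<Longrightarrow> F (q, p) = (X q * (p \<bullet> e2 q)\<^sup>2 + \<epsilon> * (Y q * (p \<bullet> e1 q)\<^sup>2)) / (X q - Y q)"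
    and q0: "q0 \<in> S"
  shows "admits_coordinates (liouville_form \<epsilon>) S G F"
proof -
  note L = liouville_frame[OF smooth frame \<epsilon> nz K F]
  obtain V r \<psi> \<Phi> where V: "q0 \<in> V" "V \<subseteq> S" "r > 0"
    and ch: "coordinate_change V ({-r<..<r} \<times> {-r<..<r}) \<psi> \<Phi>"
    and st: "straightens ({-r<..<r} \<times> {-r<..<r}) \<Phi> e1 e2" and "\<Phi> (0, 0) = q0"
    by (rule commuting_frame_coordinates[OF open_S q0 smooth(1,2) frame L(1)]) blast+
  let ?I = "{-r<..<r}"
  have \<Phi>V: "\<Phi> z \<in> V" if "z \<in> ?I \<times> ?I" for z using ch that unfolding coordinate_change_def by blast
  have \<Phi>S: "\<Phi> z \<in> S" if "z \<in> ?I \<times> ?I" for z using \<Phi>V[OF that] V(2) by blast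
  have sm\<Phi>: "smooth_on (?I \<times> ?I) \<Phi>" using ch by (simp add: coordinate_change_def)
  have oD: "open (?I \<times> ?I)" by (intro open_Times) auto
  have sm: "smooth_on (?I \<times> ?I) (\<lambda>z. f (\<Phi> z))" if "smooth_on S f" for f :: "real \<times> real \<Rightarrow> real"
    by (rule smooth_on_compose[OF that sm\<Phi> oD open_S]) (use \<Phi>S in blast)
  have dom: "fst ` (?I \<times> ?I) = ?I" "snd ` (?I \<times> ?I) = ?I" using V(3) by auto
  have X: "X (\<Phi> (x, y)) = X (\<Phi> (x, 0))" if "x \<in> ?I" "y \<in> ?I" for x y
    by (rule lie_zero_straightens_snd[OF st smooth(3) \<Phi>S L(2)]) (use that V(3) in auto)
  have Y: "Y (\<Phi> (x, y)) = Y (\<Phi> (0, y))" if "x \<in> ?I" "y \<in> ?I" for x y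
    by (rule lie_zero_straightens_fst[OF st smooth(4) \<Phi>S L(3)]) (use that V(3) in auto)
  have smX: "smooth_on ?I (\<lambda>x. X (\<Phi> (x, 0)))"
    by (rule smooth_on_compose[OF sm[OF smooth(3)] _ _ oD]) (use V(3) in \<open>auto intro!: smooth_intros\<close>)
  have smY: "smooth_on ?I (\<lambda>y. Y (\<Phi> (0, y)))"
    by (rule smooth_on_compose[OF sm[OF smooth(4)] _ _ oD]) (use V(3) in \<open>auto intro!: smooth_intros\<close>)
  have Gz: "pull_metric G \<Phi> e1 e2 (z, (dx, dy)) = (X (\<Phi> z) - Y (\<Phi> z)) * (dx\<^sup>2 + \<epsilon> * dy\<^sup>2)"
    if "z \<in> ?I \<times> ?I" for z dx dy
  proof -
    define D where "D = X (\<Phi> z) - Y (\<Phi> z)"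
    have D: "D \<noteq> 0" using nz[OF \<Phi>S[OF that]] by (simp add: D_def)
    have "G (\<Phi> z, dx *\<^sub>R e1 (\<Phi> z) + dy *\<^sub>R e2 (\<Phi> z)) =
        2 * (\<epsilon> / (2 * D) * dx\<^sup>2 - 0 * dx * dy + 1 / (2 * D) * dy\<^sup>2) / (4 * (1 / (2 * D)) * (\<epsilon> / (2 * D)) - 0\<^sup>2)"
      by (rule metric_in_frame[where ?e1.0 = e1 and ?e2.0 = e2 and ?n11.0 = "\<lambda>_. 1 / (2 * D)"
            and ?n12.0 = "\<lambda>_. 0" and ?n22.0 = "\<lambda>_. \<epsilon> / (2 * D)", OF \<Phi>S[OF that] frame[OF \<Phi>S[OF that]]])
        (simp add: K[OF \<Phi>S[OF that]] frame_form_def D_def add_divide_distrib)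
    also have "\<dots> = D * (dx\<^sup>2 + \<epsilon> * dy\<^sup>2)"
      using D \<epsilon> by (auto simp: field_simps power2_eq_square)
    finally show ?thesis by (simp add: pull_metric_def D_def)
  qed
  have Fz: "pull_form F \<Phi> e1 e2 (z, (px, py)) =
      (X (\<Phi> z) * py\<^sup>2 + \<epsilon> * (Y (\<Phi> z) * px\<^sup>2)) / (X (\<Phi> z) - Y (\<Phi> z))" if "z \<in> ?I \<times> ?I" for z px py
    by (simp add: pull_form_def F[OF \<Phi>S[OF that]] dual_covector_inner[OF frame[OF \<Phi>S[OF that]]])
  have "liouville_form \<epsilon> (?I \<times> ?I) (pull_metric G \<Phi> e1 e2) (pull_form F \<Phi> e1 e2)"
    unfolding liouville_form_def dom
  proof (rule exI[of _ "\<lambda>x. X (\<Phi> (x, 0))"], rule exI[of _ "\<lambda>y. Y (\<Phi> (0, y))"], intro conjI ballI smX smY)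
    fix z assume z: "z \<in> ?I \<times> ?I"
    obtain x y where xy: "z = (x, y)" by force
    have XY: "X (\<Phi> z) = X (\<Phi> (x, 0))" "Y (\<Phi> z) = Y (\<Phi> (0, y))"
      using X[of x y] Y[of x y] z by (simp_all add: xy)
    show "case z of (x, y) \<Rightarrow> (\<forall>dx dy. pull_metric G \<Phi> e1 e2 ((x, y), (dx, dy)) = (X (\<Phi> (x, 0)) - Y (\<Phi> (0, y))) * (dx\<^sup>2 + \<epsilon> * dy\<^sup>2)) \<and>
        (\<forall>px py. pull_form F \<Phi> e1 e2 ((x, y), (px, py)) =
          (X (\<Phi> (x, 0)) * py\<^sup>2 + \<epsilon> * (Y (\<Phi> (0, y)) * px\<^sup>2)) / (X (\<Phi> (x, 0)) - Y (\<Phi> (0, y))))"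
      using Gz[OF z] Fz[OF z] by (simp add: xy XY[unfolded xy])
  qed
  then show ?thesis
    unfolding admits_coordinates_def using V ch st frame by blast
qed

lemma null_metric:
  assumes "q \<in> S" "frame_at (e1 q) (e2 q)" "n \<noteq> 0" "\<And>p. K (q, p) = n * (p \<bullet> e1 q) * (p \<bullet> e2 q)"
  shows "G (q, a *\<^sub>R e1 q + b *\<^sub>R e2 q) = 2 / n * a * b"
proof -
  have "G (q, a *\<^sub>R e1 q + b *\<^sub>R e2 q) = 2 * (0 * a\<^sup>2 - n * a * b + 0 * b\<^sup>2) / (4 * 0 * 0 - n\<^sup>2)"
    by (rule metric_in_frame[where ?e1.0 = e1 and ?e2.0 = e2 and ?n11.0 = "\<lambda>_. 0"
          and ?n12.0 = "\<lambda>_. n" and ?n22.0 = "\<lambda>_. 0", OF assms(1,2)])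
      (simp add: assms(4) frame_form_def)
  then show ?thesis using assms(3) by (simp add: power2_eq_square)
qed

text \<open>Since both squares have a nonzero coefficient, \<open>null_frame\<close> makes the frame
  commute. Its other two equations are the Cauchy-Riemann equations for the function with real part
  \<open>u\<close> and imaginary part \<open>2 / n\<close>.\<close>

lemma complex_liouville_coordinates:
  assumes smooth: "smooth_on S e1" "smooth_on S e2" "smooth_on S n" "smooth_on S u"
    and frame: "\<And>q. q \<in> S \<Longrightarrow> frame_at (e1 q) (e2 q)"
    and nz: "\<And>q. q \<in> S \<Longrightarrow> n q \<noteq> 0"
    and K: "\<And>q p. q \<in> S \<Longrightarrow> K (q, p) = n q * (p \<bullet> e1 q) * (p \<bullet> e2 q)"
    and F: "\<And>q p. q \<in> S \<Longrightarrow> F (q, p) =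
      1 * (p \<bullet> e1 q)\<^sup>2 + u q * n q * (p \<bullet> e1 q) * (p \<bullet> e2 q) + (-1) * (p \<bullet> e2 q)\<^sup>2"
    and q0: "q0 \<in> S"
  shows "admits_coordinates complex_liouville_form S G F"
proof -
  have bracket: "lie e2 e1 q = lie e1 e2 q" and
    cr: "(n q)\<^sup>2 * lie e2 u q = 2 * lie e1 n q" "(n q)\<^sup>2 * lie e1 u q = - 2 * lie e2 n q" if q: "q \<in> S" for q
  proof -
    obtain c1 c2 where c: "lie e2 e1 q - lie e1 e2 q = c1 *\<^sub>R e1 q + c2 *\<^sub>R e2 q"
      using frame_at_vector[OF frame[OF q]] .
    have "1 * c1 = 0 \<and> (-1) * c2 = 0 \<and>
        (n q)\<^sup>2 * lie e2 u q = 2 * 1 * lie e1 n q - 2 * n q * 1 * c2 \<and>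
        (n q)\<^sup>2 * lie e1 u q = 2 * (-1) * lie e2 n q + 2 * n q * (-1) * c1"
      by (intro conjI null_frame[where q = q and ?c1.0 = c1 and ?c2.0 = c2, OF smooth frame nz K F] q c)
    with c show "lie e2 e1 q = lie e1 e2 q"
      "(n q)\<^sup>2 * lie e2 u q = 2 * lie e1 n q" "(n q)\<^sup>2 * lie e1 u q = - 2 * lie e2 n q" by simp_all
  qed
  obtain V r \<psi> \<Phi> where V: "q0 \<in> V" "V \<subseteq> S" "r > 0"
    and ch: "coordinate_change V ({-r<..<r} \<times> {-r<..<r}) \<psi> \<Phi>"
    and st: "straightens ({-r<..<r} \<times> {-r<..<r}) \<Phi> e1 e2" and "\<Phi> (0, 0) = q0"
    by (rule commuting_frame_coordinates[OF open_S q0 smooth(1,2) frame bracket]) blast+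
  let ?D = "{-r<..<r} \<times> {-r<..<r}"
  have \<Phi>S: "\<Phi> z \<in> S" if "z \<in> ?D" for z using ch that V(2) unfolding coordinate_change_def by blast
  \<comment> \<open>By \<open>null_metric\<close> this is the coefficient of \<open>dx dy\<close>,
    hence the imaginary part of \<open>h\<close>; the mixed coefficient of \<open>F\<close> is then
    \<open>u n = 2 u / w\<close>.\<close>
  define w where "w q = 2 / n q" for q
  have smw: "smooth_on S w" unfolding w_def by (intro smooth_intros open_S smooth nz)
  have lw: "(n q)\<^sup>2 * lie e w q = - 2 * lie e n q" if q: "q \<in> S" for e q
  proof -
    have "lie e (\<lambda>q. w q * n q) q = lie e (\<lambda>_. 2) q"
      by (rule lie_cong[OF open_S q]) (simp add: w_def nz)
    then have "w q * lie e n q + n q * lie e w q = 0"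
      by (simp add: lie_mult[OF smw smooth(3) q])
    then have "n q * (w q * lie e n q + n q * lie e w q) = 0" by simp
    then show ?thesis using nz[OF q] by (simp add: w_def algebra_simps power2_eq_square)
  qed
  have CR: "lie e2 u q = - lie e1 w q" "lie e1 u q = lie e2 w q" if "q \<in> S" for q
  proof -
    have "(n q)\<^sup>2 * (lie e2 u q + lie e1 w q) = 0" "(n q)\<^sup>2 * (lie e1 u q - lie e2 w q) = 0"
      using cr[OF that] lw[OF that] by (simp_all add: distrib_left right_diff_distrib)
    then show "lie e2 u q = - lie e1 w q" "lie e1 u q = lie e2 w q"
      using nz[OF that] by (simp_all add: eq_neg_iff_add_eq_0)
  qed
  define h where "h c = Complex (u (\<Phi> (Re c, Im c))) (w (\<Phi> (Re c, Im c)))" for c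
  have hol: "h holomorphic_on {Complex x y | x y. (x, y) \<in> ?D}"
  proof (rule holomorphic_onI)
    fix c assume "c \<in> {Complex x y | x y. (x, y) \<in> ?D}"
    then have z: "(Re c, Im c) \<in> ?D" by auto
    let ?q = "\<Phi> (Re c, Im c)"
    have "((\<lambda>c. (Re c, Im c)) has_derivative (\<lambda>v. (Re v, Im v))) (at c)"
      by (auto intro!: derivative_eq_intros)
    from diff_chain_at[OF this has_derivative_straightens[OF st smooth(4) \<Phi>S[OF z] z]]
      diff_chain_at[OF this has_derivative_straightens[OF st smw \<Phi>S[OF z] z]]
    have d: "((\<lambda>c. u (\<Phi> (Re c, Im c))) has_derivative (\<lambda>v. Re v * lie e1 u ?q + Im v * lie e2 u ?q)) (at c)"
      "((\<lambda>c. w (\<Phi> (Re c, Im c))) has_derivative (\<lambda>v. Re v * lie e1 w ?q + Im v * lie e2 w ?q)) (at c)"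
      by (simp_all add: o_def)
    have "(h has_derivative (\<lambda>v. complex_of_real (Re v * lie e1 u ?q + Im v * lie e2 u ?q)
        + \<i> * complex_of_real (Re v * lie e1 w ?q + Im v * lie e2 w ?q))) (at c)"
      unfolding h_def Complex_eq
      by (intro has_derivative_add has_derivative_mult_right has_derivative_of_real d)
    moreover have "(\<lambda>v. complex_of_real (Re v * lie e1 u ?q + Im v * lie e2 u ?q)
        + \<i> * complex_of_real (Re v * lie e1 w ?q + Im v * lie e2 w ?q)) =
        (*) (Complex (lie e1 u ?q) (lie e1 w ?q))"
      by (auto simp: fun_eq_iff complex_eq_iff CR[OF \<Phi>S[OF z]] algebra_simps)
    ultimately have "(h has_field_derivative Complex (lie e1 u ?q) (lie e1 w ?q)) (at c)"
      by (simp add: has_field_derivative_def)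
    then show "h field_differentiable at c within {Complex x y | x y. (x, y) \<in> ?D}"
      using field_differentiable_at_within field_differentiable_def by blast
  qed
  have "complex_liouville_form ?D (pull_metric G \<Phi> e1 e2) (pull_form F \<Phi> e1 e2)"
    unfolding complex_liouville_form_def
  proof (rule exI[of _ h], intro conjI ballI)
    show "h holomorphic_on {Complex x y | x y. (x, y) \<in> ?D}" by (rule hol)
  next
    fix z assume z: "z \<in> ?D"
    obtain x y where xy: "z = (x, y)" by force
    note zS = \<Phi>S[OF z]
    have "pull_metric G \<Phi> e1 e2 (z, (dx, dy)) = Im (h (Complex x y)) * dx * dy" for dx dy
      using null_metric[where ?e1.0 = e1 and ?e2.0 = e2, OF zS frame[OF zS] nz[OF zS] K[OF zS]]
      by (simp add: pull_metric_def h_def w_def xy)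
    moreover have "pull_form F \<Phi> e1 e2 (z, (px, py)) =
      px\<^sup>2 - py\<^sup>2 + 2 * (Re (h (Complex x y)) / Im (h (Complex x y))) * px * py" for px py
      using nz[OF zS]
      by (simp add: pull_form_def F[OF zS, unfolded xy] dual_covector_inner[OF frame[OF zS, unfolded xy]]
          h_def w_def xy)
    ultimately show "case z of (x, y) \<Rightarrow>
        (\<forall>dx dy. pull_metric G \<Phi> e1 e2 ((x, y), (dx, dy)) = Im (h (Complex x y)) * dx * dy) \<and>
        (\<forall>px py. pull_form F \<Phi> e1 e2 ((x, y), (px, py)) =
           px\<^sup>2 - py\<^sup>2 + 2 * (Re (h (Complex x y)) / Im (h (Complex x y))) * px * py)"
      by (simp add: xy)
  qed
  then show ?thesis
    unfolding admits_coordinates_def using V ch st frame by blast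
qed

text \<open>Here \<open>[e1, e2]\<close> is a multiple of \<open>e2\<close>, so that there is a function \<open>x\<close> with \<open>e1 x = 1\<close> and
  \<open>e2 x = 0\<close>. The factor \<open>\<rho>\<close> that makes \<open>e2 / \<rho>\<close> commute with \<open>e1\<close> is found from
  the normal form: there \<open>1 + x Y' = 2 / (\<rho> n)\<close> and \<open>Y' = - (e2 u) / \<rho>\<close>.\<close>

lemma jordan_block_coordinates:
  assumes smooth: "smooth_on S e1" "smooth_on S e2" "smooth_on S n" "smooth_on S u"
    and frame: "\<And>q. q \<in> S \<Longrightarrow> frame_at (e1 q) (e2 q)"
    and nz: "\<And>q. q \<in> S \<Longrightarrow> n q \<noteq> 0"
    and K: "\<And>q p. q \<in> S \<Longrightarrow> K (q, p) = n q * (p \<bullet> e1 q) * (p \<bullet> e2 q)"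
    and F: "\<And>q p. q \<in> S \<Longrightarrow> F (q, p) =
      1 * (p \<bullet> e1 q)\<^sup>2 + u q * n q * (p \<bullet> e1 q) * (p \<bullet> e2 q) + 0 * (p \<bullet> e2 q)\<^sup>2"
    and q0: "q0 \<in> S"
  shows "admits_coordinates jordan_block_form S G F"
proof -
  have "\<forall>q\<in>S. \<exists>c2. lie e2 e1 q - lie e1 e2 q = c2 *\<^sub>R e2 q \<and>
      (n q)\<^sup>2 * lie e2 u q = 2 * lie e1 n q - 2 * n q * c2 \<and> lie e1 u q = 0"
  proof
    fix q assume q: "q \<in> S"
    obtain c1 c2 where c: "lie e2 e1 q - lie e1 e2 q = c1 *\<^sub>R e1 q + c2 *\<^sub>R e2 q"
      using frame_at_vector[OF frame[OF q]] .
    have "1 * c1 = 0 \<and> (n q)\<^sup>2 * lie e2 u q = 2 * 1 * lie e1 n q - 2 * n q * 1 * c2 \<and>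
        (n q)\<^sup>2 * lie e1 u q = 2 * 0 * lie e2 n q + 2 * n q * 0 * c1"
      by (intro conjI null_frame[where q = q and ?c1.0 = c1 and ?c2.0 = c2, OF smooth frame nz K F] q c)
    with c nz[OF q] show "\<exists>c2. lie e2 e1 q - lie e1 e2 q = c2 *\<^sub>R e2 q \<and>
        (n q)\<^sup>2 * lie e2 u q = 2 * lie e1 n q - 2 * n q * c2 \<and> lie e1 u q = 0"
      by (intro exI[of _ c2]) simp
  qed
  from bchoice[OF this] obtain c2 where c2: "\<And>q. q \<in> S \<Longrightarrow> lie e2 e1 q - lie e1 e2 q = c2 q *\<^sub>R e2 q"
    and u2: "\<And>q. q \<in> S \<Longrightarrow> (n q)\<^sup>2 * lie e2 u q = 2 * lie e1 n q - 2 * n q * c2 q"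
    and u1: "\<And>q. q \<in> S \<Longrightarrow> lie e1 u q = 0" by blast
  obtain s where s: "s > 0" "ball q0 s \<subseteq> S" using open_S q0 by (auto simp: open_contains_ball)
  let ?B = "ball q0 s"
  have smB: "smooth_on ?B e1" "smooth_on ?B e2" "smooth_on ?B n" "smooth_on ?B u"
    using smooth s(2) smooth_on_subset by blast+
  \<comment> \<open>The bracket is a multiple of \<open>e2\<close>, so the form with values 1 and 0
    on the frame is closed. The normalization at \<open>q0\<close> matters below, since the normal
    form contains \<open>x\<close> explicitly.\<close>
  obtain x where x: "x q0 = 0" "smooth_on ?B x"
    "\<And>q a b. q \<in> ?B \<Longrightarrow> dir_deriv x (a *\<^sub>R e1 q + b *\<^sub>R e2 q) q = a * 1 + b * 0"
    by (rule frame_potential[OF open_ball convex_ball _ smB(1,2), of q0 "\<lambda>_. 0" c2 1 0])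
      (use s frame c2 in \<open>auto simp: subset_iff\<close>)
  have x1: "lie e1 x q = 1" and x2: "lie e2 x q = 0" if "q \<in> ?B" for q
    using x(3)[OF that, of 1 0] x(3)[OF that, of 0 1] by (simp_all add: lie_def)
  define w where "w q = 1 / n q" for q
  have smw: "smooth_on S w" unfolding w_def by (intro smooth_intros open_S smooth nz)
  have lw: "(n q)\<^sup>2 * lie e w q = - lie e n q" if q: "q \<in> S" for e q
  proof -
    have "lie e (\<lambda>q. w q * n q) q = lie e (\<lambda>_. 1) q"
      by (rule lie_cong[OF open_S q]) (simp add: w_def nz)
    then have "w q * lie e n q + n q * lie e w q = 0"
      by (simp add: lie_mult[OF smw smooth(3) q])
    then have "n q * (w q * lie e n q + n q * lie e w q) = 0" by simp
    then show ?thesis using nz[OF q] by (simp add: w_def algebra_simps power2_eq_square)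
  qed
  have w1: "2 * lie e1 w q + lie e2 u q = - 2 * c2 q * w q" if q: "q \<in> S" for q
  proof -
    have "(n q)\<^sup>2 * (2 * lie e1 w q + lie e2 u q + 2 * c2 q * w q) = 0"
      using u2[OF q] lw[OF q, of e1] nz[OF q] by (simp add: distrib_left w_def power2_eq_square)
    then show ?thesis using nz[OF q] by simp
  qed
  \<comment> \<open>Found by eliminating \<open>Y'\<close> from the two relations
    \<open>1 + x Y' = 2 w / \<rho>\<close> and \<open>Y' = - (e2 u) / \<rho>\<close>.\<close>
  define \<rho> where "\<rho> q = 2 * w q + x q * lie e2 u q" for q
  have smu2: "smooth_on ?B (lie e2 u)" by (intro smooth_intros smB) auto
  have smwB: "smooth_on ?B w" using smw s(2) smooth_on_subset by blast
  have sm\<rho>: "smooth_on ?B \<rho>" unfolding \<rho>_def by (intro smooth_intros smu2 smwB x) auto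
  \<comment> \<open>This is the condition for \<open>e1\<close> to commute with \<open>e2\<close>
    divided by \<open>\<rho>\<close>. It uses that \<open>lie e1 u\<close> vanishes: the commutator
    formula then gives the derivative of \<open>lie e2 u\<close> along \<open>e1\<close>.\<close>
  have \<rho>1: "lie e1 \<rho> q = - c2 q * \<rho> q" if q: "q \<in> ?B" for q
  proof -
    have qS: "q \<in> S" using q s(2) by blast
    have "lie e2 (lie e1 u) q = 0"
      using lie_cong[OF open_S qS, of "lie e1 u" "\<lambda>_. 0" e2] u1 by simp
    moreover have "dir_deriv u (lie e1 e2 q - lie e2 e1 q) q = - c2 q * lie e2 u q"
    proof -
      have "lie e1 e2 q - lie e2 e1 q = (- c2 q) *\<^sub>R e2 q"
        using c2[OF qS] by (metis minus_diff_eq scaleR_minus_left)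
      moreover interpret bounded_linear "\<lambda>v. dir_deriv u v q"
        using smooth_on_has_derivative[OF smooth(4) qS] by (rule has_derivative_bounded_linear)
      have "dir_deriv u ((- c2 q) *\<^sub>R e2 q) q = - c2 q * dir_deriv u (e2 q) q"
        by (simp only: scaleR real_scaleR_def)
      ultimately show ?thesis by (simp only: lie_def)
    qed
    ultimately have "lie e1 (lie e2 u) q = - c2 q * lie e2 u q"
      using lie_commutator[OF open_S smooth(1,2,4) qS] by simp
    moreover have "lie e1 \<rho> q = 2 * lie e1 w q + (x q * lie e1 (lie e2 u) q + lie e2 u q * lie e1 x q)"
    proof -
      have "lie e1 \<rho> q = lie e1 (\<lambda>q. 2 * w q) q + lie e1 (\<lambda>q. x q * lie e2 u q) q"
        unfolding \<rho>_def by (rule lie_add[OF _ _ q]) (intro smooth_intros smu2 smwB x open_ball)+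
      then show ?thesis
        by (simp only: lie_mult[OF x(2) smu2 q] lie_mult[OF smooth_on_const[OF open_ball] smwB q]) simp
    qed
    ultimately show ?thesis
      using w1[OF qS] by (simp add: x1[OF q] \<rho>_def algebra_simps)
  qed
  define S' where "S' = {q \<in> ?B. \<rho> q \<noteq> 0}"
  have S'B: "S' \<subseteq> ?B" by (auto simp: S'_def)
  have oS': "open S'"
  proof -
    have "S' = ?B \<inter> \<rho> -` (- {0})" by (auto simp: S'_def)
    then show ?thesis
      using continuous_open_preimage[OF smooth_on_continuous[OF sm\<rho>] open_ball, of "- {0}"]
        open_Compl[OF closed_singleton[of "0::real"]] by simp
  qed
  \<comment> \<open>Because \<open>x\<close> vanishes at \<open>q0\<close>, the factor
    \<open>\<rho>\<close> equals \<open>2 / n\<close> there and is nonzero.\<close>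
  have q0S': "q0 \<in> S'" using s(1) nz[OF q0] by (simp add: S'_def \<rho>_def x(1) w_def)
  have S'S: "S' \<subseteq> S" using S'B s(2) by blast
  have smS': "smooth_on S' e1" "smooth_on S' e2" "smooth_on S' \<rho>" "smooth_on S' x" "smooth_on S' u"
    using smB sm\<rho> x(2) S'B smooth_on_subset by blast+
  define e2' where "e2' q = inverse (\<rho> q) *\<^sub>R e2 q" for q
  have \<rho>0: "\<rho> q \<noteq> 0" if "q \<in> S'" for q using that by (simp add: S'_def)
  have smi: "smooth_on S' (\<lambda>q. inverse (\<rho> q))" by (intro smooth_intros oS' smS' \<rho>0)
  have sme2': "smooth_on S' e2'" unfolding e2'_def by (intro smooth_on_scaleR oS' smi smS')
  have frame': "frame_at (e1 q) (e2' q)" if "q \<in> S'" for q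
  proof -
    have "frame_at (e1 q) (e2 q)" using frame that S'S by blast
    then show ?thesis using \<rho>0[OF that] by (simp add: frame_at_def e2'_def field_simps)
  qed
  have lie2': "lie e2' f q = inverse (\<rho> q) *\<^sub>R lie e2 f q" if "smooth_on S' f" "q \<in> S'"
    for f :: "real \<times> real \<Rightarrow> 'b::real_normed_vector" and q
    using lie_lincomb[OF that, of e2' "inverse (\<rho> q)" e2 0 e2] by (simp add: e2'_def)
  have bracket: "lie e2' e1 q = lie e1 e2' q" if q: "q \<in> S'" for q
  proof -
    have "lie e1 (\<lambda>q. inverse (\<rho> q) * \<rho> q) q = lie e1 (\<lambda>_. 1) q"
      by (rule lie_cong[OF oS' q]) (simp add: \<rho>0)
    moreover define L where "L = lie e1 (\<lambda>q. inverse (\<rho> q)) q"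
    ultimately have "inverse (\<rho> q) * lie e1 \<rho> q + \<rho> q * L = 0"
      by (simp only: lie_mult[OF smi smS'(3) q] lie_const)
    moreover have "lie e1 \<rho> q = - c2 q * \<rho> q" using \<rho>1 q S'B by blast
    ultimately have "L = c2 q * inverse (\<rho> q)"
      using \<rho>0[OF q] by (simp add: field_simps)
    then have i: "lie e1 (\<lambda>q. inverse (\<rho> q)) q = c2 q * inverse (\<rho> q)"
      by (simp only: L_def)
    have "lie e1 e2' q = inverse (\<rho> q) *\<^sub>R lie e1 e2 q + lie e1 (\<lambda>q. inverse (\<rho> q)) q *\<^sub>R e2 q"
      unfolding e2'_def by (rule lie_scaleR[OF smi smS'(2) q])
    also have "\<dots> = inverse (\<rho> q) *\<^sub>R (lie e1 e2 q + c2 q *\<^sub>R e2 q)"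
      unfolding i by (simp add: scaleR_add_right mult.commute)
    also have "lie e1 e2 q + c2 q *\<^sub>R e2 q = lie e2 e1 q"
      using c2 q S'S by (metis add_diff_cancel_left' diff_add_cancel add.commute subsetD)
    also have "inverse (\<rho> q) *\<^sub>R lie e2 e1 q = lie e2' e1 q"
      by (rule lie2'[OF smS'(1) q, symmetric])
    finally show ?thesis by simp
  qed
  obtain V r \<psi> \<Phi> where V: "q0 \<in> V" "V \<subseteq> S'" "r > 0"
    and ch: "coordinate_change V ({-r<..<r} \<times> {-r<..<r}) \<psi> \<Phi>"
    and st: "straightens ({-r<..<r} \<times> {-r<..<r}) \<Phi> e1 e2'" and \<Phi>0: "\<Phi> (0, 0) = q0"
    by (rule commuting_frame_coordinates[OF oS' q0S' smS'(1) sme2' frame' bracket]) blast+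
  let ?I = "{-r<..<r}"
  have \<Phi>S': "\<Phi> z \<in> S'" if "z \<in> ?I \<times> ?I" for z using ch that V(2) unfolding coordinate_change_def by blast
  have \<Phi>S: "\<Phi> z \<in> S" if "z \<in> ?I \<times> ?I" for z using \<Phi>S'[OF that] S'S by blast
  have oD: "open (?I \<times> ?I)" by (intro open_Times) auto
  have sm\<Phi>: "smooth_on (?I \<times> ?I) \<Phi>" using ch by (simp add: coordinate_change_def)
  \<comment> \<open>The first new coordinate has to be the very function \<open>x\<close> that
    enters \<open>\<rho>\<close>, not only up to a constant; both vanish at \<open>q0\<close>, and
    their derivatives agree.\<close>
  have x\<Phi>: "x (\<Phi> z) = fst z" if z: "z \<in> ?I \<times> ?I" for z
  proof -
    have "((\<lambda>z. x (\<Phi> z) - fst z) has_derivative (\<lambda>h. 0)) (at z within ?I \<times> ?I)" if z: "z \<in> ?I \<times> ?I" for z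
    proof -
      have "\<Phi> z \<in> ?B" using \<Phi>S'[OF z] S'B by blast
      then have "lie e1 x (\<Phi> z) = 1" "lie e2' x (\<Phi> z) = 0"
        using x1 x2 lie2'[OF smS'(4) \<Phi>S'[OF z]] by simp_all
      then have "((\<lambda>z. x (\<Phi> z)) has_derivative (\<lambda>v. fst v)) (at z)"
        using has_derivative_straightens[OF st smS'(4) \<Phi>S'[OF z] z] by simp
      then have "((\<lambda>z. x (\<Phi> z) - fst z) has_derivative (\<lambda>h. fst h - fst h)) (at z)"
        by (intro has_derivative_diff has_derivative_fst has_derivative_ident)
      then show ?thesis by (simp add: has_derivative_at_withinI)
    qed
    moreover have "convex (?I \<times> ?I)" by (intro convex_Times) auto
    ultimately have "x (\<Phi> z) - fst z = x (\<Phi> (0, 0)) - fst (0::real, 0::real)"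
      using has_derivative_zero_unique[of "?I \<times> ?I" "\<lambda>z. x (\<Phi> z) - fst z" "(0, 0)" z] z V(3) by simp
    then show ?thesis by (simp add: \<Phi>0 x(1))
  qed
  define Y where "Y y = - u (\<Phi> (0, y))" for y
  have dom: "snd ` (?I \<times> ?I) = ?I" using V(3) by auto
  have Yu: "u (\<Phi> (a, b)) = - Y b" if "a \<in> ?I" "b \<in> ?I" for a b
    unfolding Y_def
    using lie_zero_straightens_fst[OF st smS'(5) \<Phi>S' u1, of a 0 b] that V(3) S'S by auto
  have smY: "smooth_on ?I Y"
    unfolding Y_def
  proof (intro smooth_on_minus)
    show "smooth_on ?I (\<lambda>y. u (\<Phi> (0, y)))"
    proof (rule smooth_on_compose[OF smS'(5) _ _ oS'])
      show "smooth_on ?I (\<lambda>y. \<Phi> (0, y))"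
        by (rule smooth_on_compose[OF sm\<Phi> _ _ oD]) (use V(3) in \<open>auto intro!: smooth_intros\<close>)
    qed (use \<Phi>S' V(3) in auto)
  qed auto
  \<comment> \<open>As \<open>u\<close> does not depend on the first coordinate, the derivative may
    be taken on the line through the point \<open>(a, b)\<close> itself, where it can be compared
    with \<open>\<rho>\<close>.\<close>
  have dY: "deriv Y b = - lie e2' u (\<Phi> (a, b))" if ab: "a \<in> ?I" "b \<in> ?I" for a b
  proof -
    have "((\<lambda>y. (a, y)) has_derivative (\<lambda>h. (0, h))) (at b)"
      by (auto intro!: derivative_eq_intros)
    from diff_chain_at[OF this has_derivative_straightens[OF st smS'(5) \<Phi>S']] ab
    have "((\<lambda>y. u (\<Phi> (a, y))) has_derivative (\<lambda>h. h * lie e2' u (\<Phi> (a, b)))) (at b)"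
      by (simp add: o_def)
    then have "((\<lambda>y. - u (\<Phi> (a, y))) has_derivative (\<lambda>h. - (h * lie e2' u (\<Phi> (a, b))))) (at b)"
      by (rule has_derivative_minus)
    then have "(Y has_derivative (\<lambda>h. - (h * lie e2' u (\<Phi> (a, b))))) (at b)"
      by (rule has_derivative_transform_within_open[of _ _ _ UNIV ?I]) (use ab Yu in auto)
    then have "(Y has_field_derivative - lie e2' u (\<Phi> (a, b))) (at b)"
      unfolding has_field_derivative_def
      by (rule has_derivative_eq_rhs) (simp add: fun_eq_iff)
    then show ?thesis by (rule DERIV_imp_deriv)
  qed
  have "jordan_block_form (?I \<times> ?I) (pull_metric G \<Phi> e1 e2') (pull_form F \<Phi> e1 e2')"
    unfolding jordan_block_form_def dom
  proof (rule exI[of _ Y], intro conjI ballI smY)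
    fix z assume z: "z \<in> ?I \<times> ?I"
    obtain a b where ab: "z = (a, b)" by force
    note zS' = \<Phi>S'[OF z] and zS = \<Phi>S[OF z]
    define m where "m = n (\<Phi> z) * \<rho> (\<Phi> z)"
    have m: "m \<noteq> 0" using nz[OF zS] \<rho>0[OF zS'] by (simp add: m_def)
    have e2: "p \<bullet> e2 (\<Phi> z) = \<rho> (\<Phi> z) * (p \<bullet> e2' (\<Phi> z))" for p
      using \<rho>0[OF zS'] by (simp add: e2'_def)
    have K': "K (\<Phi> z, p) = m * (p \<bullet> e1 (\<Phi> z)) * (p \<bullet> e2' (\<Phi> z))" for p
      by (simp add: K[OF zS] e2 m_def)
    \<comment> \<open>The definition of \<open>\<rho>\<close> read backwards, with
      \<open>x = a\<close> and \<open>e2 u = - \<rho> Y'\<close>.\<close>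
    have "\<rho> (\<Phi> z) * (1 + a * deriv Y b) = 2 * w (\<Phi> z)"
    proof -
      define R U where "R = \<rho> (\<Phi> z)" and "U = lie e2 u (\<Phi> z)"
      have "R \<noteq> 0" using \<rho>0[OF zS'] by (simp add: R_def)
      moreover have "deriv Y b = - (inverse R * U)"
        using dY[of a b] z lie2'[OF smS'(5) zS'] by (simp add: ab R_def U_def)
      moreover have "R = 2 * w (\<Phi> z) + a * U"
        using x\<Phi>[OF z] by (simp add: R_def U_def \<rho>_def ab)
      moreover have "R * (1 + a * - (inverse R * U)) = R - a * U" if "R \<noteq> 0"
        using that by (simp add: field_simps)
      ultimately have "R * (1 + a * deriv Y b) = 2 * w (\<Phi> z)" by (metis add_diff_cancel_right')
      then show ?thesis by (simp only: R_def)
    qed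
    then have m2: "1 + a * deriv Y b = 2 / m"
      using \<rho>0[OF zS'] nz[OF zS] by (simp add: m_def w_def field_simps)
    have "pull_metric G \<Phi> e1 e2' (z, (dx, dy)) = (1 + a * deriv Y b) * dx * dy" for dx dy
      using null_metric[where ?e1.0 = e1 and ?e2.0 = e2', OF zS frame'[OF zS'] m K']
      by (simp add: pull_metric_def m2)
    moreover have "pull_form F \<Phi> e1 e2' (z, (px, py)) = px\<^sup>2 - 2 * (Y b / (1 + a * deriv Y b)) * px * py" for px py
      using m Yu[of a b] z
      by (simp add: pull_form_def F[OF zS, unfolded ab] e2[unfolded ab]
          dual_covector_inner[OF frame'[OF zS', unfolded ab]] m2 m_def ab)
    ultimately show "case z of (x, y) \<Rightarrow>
        (\<forall>dx dy. pull_metric G \<Phi> e1 e2' ((x, y), (dx, dy)) = (1 + x * deriv Y y) * dx * dy) \<and>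
        (\<forall>px py. pull_form F \<Phi> e1 e2' ((x, y), (px, py)) = px\<^sup>2 - 2 * (Y y / (1 + x * deriv Y y)) * px * py)"
      by (simp add: ab)
  qed
  moreover have "V \<subseteq> S" "\<forall>q\<in>V. frame_at (e1 q) (e2' q)" using V(2) S'S frame' by blast+
  ultimately show ?thesis
    unfolding admits_coordinates_def using V(1) ch st by blast
qed

end

section \<open>Adapted frames from pointwise algebra\<close>

lemma open_positive_set:
  assumes "open S" "continuous_on S f"
  shows "open {q \<in> S. f q > (0::real)}"
proof -
  have "{q \<in> S. f q > 0} = S \<inter> f -` {0<..}" by auto
  then show ?thesis using continuous_open_preimage[OF assms(2,1), of "{0<..}"] by simp
qed

lemma open_nonzero_set:
  assumes "open S" "continuous_on S f"
  shows "open {q \<in> S. f q \<noteq> (0::real)}"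
proof -
  have "{q \<in> S. f q \<noteq> 0} = S \<inter> f -` (- {0})" by auto
  then show ?thesis
    using continuous_open_preimage[OF assms(2,1), of "- {0}"] open_Compl[OF closed_singleton[of "0::real"]]
    by simp
qed

lemma frame_form_change_frame:
  assumes S: "open S" "smooth_on S e1" "smooth_on S e2" "\<And>q. q \<in> S \<Longrightarrow> frame_at (e1 q) (e2 q)"
    and smooth: "smooth_on S a" "smooth_on S b" "smooth_on S c"
  obtains a' b' c' where "smooth_on S a'" "smooth_on S b'" "smooth_on S c'"
    "\<And>q p. q \<in> S \<Longrightarrow> frame_form e_x e_y a b c (q, p) = frame_form e1 e2 a' b' c' (q, p)"
proof
  let ?d = "\<lambda>q. fst (e1 q) * snd (e2 q) - fst (e2 q) * snd (e1 q)"
  let ?s = "\<lambda>q. snd (e2 q) / ?d q" and ?t = "\<lambda>q. - snd (e1 q) / ?d q"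
  let ?v = "\<lambda>q. - fst (e2 q) / ?d q" and ?w = "\<lambda>q. fst (e1 q) / ?d q"
  let ?a = "\<lambda>q. a q * (?s q)\<^sup>2 + b q * ?s q * ?v q + c q * (?v q)\<^sup>2"
  let ?b = "\<lambda>q. 2 * a q * ?s q * ?t q + b q * (?s q * ?w q + ?t q * ?v q) + 2 * c q * ?v q * ?w q"
  let ?c = "\<lambda>q. a q * (?t q)\<^sup>2 + b q * ?t q * ?w q + c q * (?w q)\<^sup>2"
  have d: "?d q \<noteq> 0" if "q \<in> S" for q using S(4)[OF that] by (simp add: frame_at_def)
  show "smooth_on S ?a" "smooth_on S ?b" "smooth_on S ?c"
    by (intro smooth_intros S smooth d; assumption)+
  fix q p assume "q \<in> S"
  have "p = dual_covector (e1 q) (e2 q) (p \<bullet> e1 q, p \<bullet> e2 q)"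
    by (rule dual_covector_components[OF S(4)[OF \<open>q \<in> S\<close>], symmetric])
  then have p: "p \<bullet> (1, 0) = ?s q * (p \<bullet> e1 q) + ?t q * (p \<bullet> e2 q)"
    "p \<bullet> (0, 1) = ?v q * (p \<bullet> e1 q) + ?w q * (p \<bullet> e2 q)"
    by (simp_all add: dual_covector_def inner_prod_def prod_eq_iff diff_divide_distrib)
  have id: "A * (s * P + t * R)\<^sup>2 + B * (s * P + t * R) * (v * P + w * R) + C * (v * P + w * R)\<^sup>2 =
      (A * s\<^sup>2 + B * s * v + C * v\<^sup>2) * P\<^sup>2 + (2 * A * s * t + B * (s * w + t * v) + 2 * C * v * w) * P * R
      + (A * t\<^sup>2 + B * t * w + C * w\<^sup>2) * R\<^sup>2" for A B C s t v w P R :: real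
    by (simp add: algebra_simps power2_eq_square)
  show "frame_form e_x e_y a b c (q, p) = frame_form e1 e2 ?a ?b ?c (q, p)"
    unfolding frame_form_def prod.case p by (rule id)
qed

text \<open>Completing the square: \<open>\<kappa>\<close> is the sign of the form, the first square
  absorbs the mixed term, and the second has the discriminant over \<open>4 * h11\<close> as its
  coefficient. The frame vectors carry the square roots.\<close>

lemma definite_form_frame:
  fixes \<kappa> :: real
  assumes S: "open S" "smooth_on S h11" "smooth_on S h12" "smooth_on S h22" and "\<kappa> = 1 \<or> \<kappa> = -1"
    and pos: "\<And>q. q \<in> S \<Longrightarrow> 0 < \<kappa> * h11 q" "\<And>q. q \<in> S \<Longrightarrow> 0 < 4 * h11 q * h22 q - (h12 q)\<^sup>2"
  obtains e1 e2 where "smooth_on S e1" "smooth_on S e2" "\<And>q. q \<in> S \<Longrightarrow> frame_at (e1 q) (e2 q)"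
    "\<And>q p. q \<in> S \<Longrightarrow> frame_form e_x e_y h11 h12 h22 (q, p) = \<kappa> * ((p \<bullet> e1 q)\<^sup>2 + (p \<bullet> e2 q)\<^sup>2)"
proof
  let ?r = "\<lambda>q. \<kappa> * (4 * h11 q * h22 q - (h12 q)\<^sup>2) / (4 * h11 q)"
  let ?e1 = "\<lambda>q. (sqrt (\<kappa> * h11 q), sqrt (\<kappa> * h11 q) * h12 q / (2 * h11 q))"
  let ?e2 = "\<lambda>q. (0, sqrt (?r q))"
  have nz: "h11 q \<noteq> 0" if "q \<in> S" for q using pos(1)[OF that] by auto
  have r: "?r q > 0" if "q \<in> S" for q
    using pos[OF that] assms(5) by (auto simp: zero_less_divide_iff mult_less_0_iff)
  show "smooth_on S ?e1" "smooth_on S ?e2"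
    by (intro smooth_intros S pos(1) r; simp add: nz)+
  show "frame_at (?e1 q) (?e2 q)" if "q \<in> S" for q
    using pos(1)[OF that] r[OF that] by (simp add: frame_at_def) (use nz[OF that] in auto)
  show "frame_form e_x e_y h11 h12 h22 (q, p) = \<kappa> * ((p \<bullet> ?e1 q)\<^sup>2 + (p \<bullet> ?e2 q)\<^sup>2)" if "q \<in> S" for q p
  proof -
    define s where "s = sqrt (\<kappa> * h11 q)"
    define t where "t = sqrt (?r q)"
    have s: "s\<^sup>2 = \<kappa> * h11 q" and t: "t\<^sup>2 = ?r q"
      using pos(1)[OF that] r[OF that] unfolding s_def t_def by (simp_all only: real_sqrt_pow2 less_imp_le)
    have \<kappa>2: "\<kappa> * \<kappa> = 1" using assms(5) by auto
    obtain x y where p: "p = (x, y)" by force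
    have "p \<bullet> ?e1 q = s * (x + h12 q / (2 * h11 q) * y)"
      unfolding s_def[symmetric] by (simp add: p algebra_simps)
    moreover have "p \<bullet> ?e2 q = t * y"
      unfolding t_def[symmetric] by (simp add: p)
    ultimately have "\<kappa> * ((p \<bullet> ?e1 q)\<^sup>2 + (p \<bullet> ?e2 q)\<^sup>2) =
        \<kappa> * (s\<^sup>2 * (x + h12 q / (2 * h11 q) * y)\<^sup>2 + t\<^sup>2 * y\<^sup>2)"
      by (simp only: power_mult_distrib)
    also have "\<dots> = (\<kappa> * \<kappa>) * (h11 q * (x + h12 q / (2 * h11 q) * y)\<^sup>2
        + (4 * h11 q * h22 q - (h12 q)\<^sup>2) / (4 * h11 q) * y\<^sup>2)"
      unfolding s t by (simp add: algebra_simps)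
    also have "\<dots> = h11 q * x\<^sup>2 + h12 q * x * y + h22 q * y\<^sup>2"
      using nz[OF that] unfolding \<kappa>2 by (simp add: field_simps power2_eq_square)
    finally show ?thesis by (simp add: frame_form_def p)
  qed
qed

text \<open>The form splits into real linear factors with coefficients \<open>h11\<close>,
  \<open>\<tau>\<close> and \<open>1\<close>, \<open>h22 / \<tau>\<close> once
  \<open>\<tau>\<^sup>2 - h12 \<tau> + h11 h22 = 0\<close>. Dividing by \<open>\<tau>\<close>
  instead of \<open>h11\<close> also covers a vanishing \<open>h11\<close>.\<close>

lemma indefinite_form_frame:
  assumes S: "open S" "smooth_on S h11" "smooth_on S h12" "smooth_on S h22" "q0 \<in> S"
    and neg: "\<And>q. q \<in> S \<Longrightarrow> 4 * h11 q * h22 q - (h12 q)\<^sup>2 < 0"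
  obtains S' e1 e2 where "open S'" "q0 \<in> S'" "S' \<subseteq> S"
    "smooth_on S' e1" "smooth_on S' e2" "\<And>q. q \<in> S' \<Longrightarrow> frame_at (e1 q) (e2 q)"
    "\<And>q p. q \<in> S' \<Longrightarrow> frame_form e_x e_y h11 h12 h22 (q, p) = (p \<bullet> e1 q) * (p \<bullet> e2 q)"
proof -
  \<comment> \<open>The sign in the quadratic formula is chosen so that its two terms do not cancel
    at \<open>q0\<close>; hence \<open>\<tau>\<close> is nonzero there and nearby.\<close>
  define \<eta> :: real where "\<eta> = (if h12 q0 \<ge> 0 then 1 else -1)"
  define s where "s q = sqrt ((h12 q)\<^sup>2 - 4 * h11 q * h22 q)" for q
  define \<tau> where "\<tau> q = (h12 q + \<eta> * s q) / 2" for q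
  have spos: "0 < s q" and s2: "(s q)\<^sup>2 = (h12 q)\<^sup>2 - 4 * h11 q * h22 q" if "q \<in> S" for q
    using neg[OF that] by (simp_all add: s_def)
  have sms: "smooth_on S s" unfolding s_def by (intro smooth_intros S) (use neg in simp)
  have sm\<tau>: "smooth_on S \<tau>" unfolding \<tau>_def by (intro smooth_intros S sms) simp
  have \<eta>2: "\<eta> * \<eta> = 1" by (simp add: \<eta>_def)
  have root: "\<tau> q * \<tau> q = h12 q * \<tau> q - h11 q * h22 q" if "q \<in> S" for q
  proof -
    have "4 * (\<tau> q * \<tau> q) = h12 q * h12 q + 2 * \<eta> * h12 q * s q + (\<eta> * \<eta>) * (s q)\<^sup>2"
      by (simp add: \<tau>_def algebra_simps power2_eq_square)
    also have "\<dots> = 4 * (h12 q * \<tau> q - h11 q * h22 q)"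
      unfolding \<eta>2 s2[OF that] by (simp add: \<tau>_def algebra_simps power2_eq_square)
    finally show ?thesis by simp
  qed
  define S' where "S' = {q \<in> S. \<tau> q \<noteq> 0}"
  have S': "open S'" "S' \<subseteq> S"
    unfolding S'_def using open_nonzero_set[OF S(1) smooth_on_continuous[OF sm\<tau>]] by auto
  have nz: "\<tau> q \<noteq> 0" if "q \<in> S'" for q using that by (simp add: S'_def)
  have "q0 \<in> S'"
    using spos[OF S(5)] S(5) by (auto simp: S'_def \<tau>_def \<eta>_def)
  have sm': "smooth_on S' h11" "smooth_on S' h22" "smooth_on S' \<tau>"
    using S sm\<tau> S'(2) smooth_on_subset by blast+
  show thesis
  proof (rule that[OF S'(1) \<open>q0 \<in> S'\<close> S'(2)])
    show "smooth_on S' (\<lambda>q. (h11 q, \<tau> q))" "smooth_on S' (\<lambda>q. (1, h22 q / \<tau> q))"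
      by (intro smooth_intros S' sm' nz; assumption)+
    fix q assume q: "q \<in> S'"
    then have qS: "q \<in> S" using S'(2) by blast
    \<comment> \<open>The determinant of the two factors is, up to sign, the square root of the
      discriminant, so they are independent.\<close>
    have "h11 q * (h22 q / \<tau> q) - 1 * \<tau> q = - \<eta> * s q"
    proof -
      have "\<tau> q * (h11 q * (h22 q / \<tau> q) - 1 * \<tau> q) = h11 q * h22 q - \<tau> q * \<tau> q"
        using nz[OF q] by (simp add: right_diff_distrib)
      also have "\<dots> = \<tau> q * (h12 q - 2 * \<tau> q)"
        using root[OF qS] by (simp add: algebra_simps)
      finally have "h11 q * (h22 q / \<tau> q) - 1 * \<tau> q = h12 q - 2 * \<tau> q" using nz[OF q] by simp
      also have "\<dots> = - \<eta> * s q" by (simp add: \<tau>_def field_simps)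
      finally show ?thesis .
    qed
    then show "frame_at (h11 q, \<tau> q) (1, h22 q / \<tau> q)"
      using spos[OF qS] \<eta>2 by (auto simp: frame_at_def)
    fix p :: "real \<times> real"
    obtain x y where p: "p = (x, y)" by force
    have "(h11 q * x + \<tau> q * y) * (x + h22 q / \<tau> q * y) =
        h11 q * x\<^sup>2 + (h11 q * h22 q / \<tau> q + \<tau> q) * x * y + h22 q * y\<^sup>2"
      using nz[OF q] by (simp add: field_simps power2_eq_square)
    also have "h11 q * h22 q / \<tau> q + \<tau> q = h12 q"
      using root[OF qS] nz[OF q] by (simp add: field_simps)
    finally show "frame_form e_x e_y h11 h12 h22 (q, p) = (p \<bullet> (h11 q, \<tau> q)) * (p \<bullet> (1, h22 q / \<tau> q))"
      by (simp add: frame_form_def p mult.commute)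
  qed
qed

section \<open>The case distinction by the signs of the coefficients\<close>

context local_integral
begin

lemma scale:
  assumes "\<And>q p. q \<in> S \<Longrightarrow> F differentiable at (q, p)"
  shows "local_integral S G K (\<lambda>z. \<sigma> * F z)"
proof unfold_locales
  fix q p assume q: "q \<in> S"
  have "((\<lambda>z. \<sigma> * F z) has_derivative (\<lambda>v. \<sigma> * frechet_derivative F (at (q, p)) v)) (at (q, p))"
    using assms[OF q] by (intro has_derivative_mult_right) (simp add: frechet_derivative_works)
  note fd = frechet_derivative_at[OF this, symmetric]
  have "poisson_bracket K (\<lambda>z. \<sigma> * F z) (q, p) = \<sigma> * poisson_bracket K F (q, p)"
    unfolding poisson_bracket_def Let_def fd by (simp add: algebra_simps)
  then show "poisson_bracket K (\<lambda>z. \<sigma> * F z) (q, p) = 0" using integral[OF q] by simp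
qed (use open_S metric energy in blast)+

lemma differentiable_frame_form:
  assumes "smooth_on S e1" "smooth_on S e2" "smooth_on S a" "smooth_on S b" "smooth_on S c"
    "\<And>q p. q \<in> S \<Longrightarrow> F (q, p) = frame_form e1 e2 a b c (q, p)" "q \<in> S"
  shows "F differentiable at (q, p)"
proof -
  have "open (S \<times> (UNIV :: (real \<times> real) set))" by (intro open_Times open_S open_UNIV)
  moreover have "frame_form e1 e2 a b c differentiable at (q, p)"
    using frame_form_has_derivative[OF assms(1-5,7)] by (rule differentiableI)
  ultimately show ?thesis
    using differentiable_cong_open[of "S \<times> UNIV" "(q, p)" F "frame_form e1 e2 a b c"] assms(6,7) by auto
qed

text \<open>Sum and difference of the null vectors diagonalize \<open>K\<close> and \<open>F\<close>
  together. Comparing the coefficients of the two squares forces \<open>X - Y = 2 / n\<close> and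
  \<open>X + Y = - u\<close>.\<close>

lemma null_liouville_coordinates:
  assumes smooth: "smooth_on S e1" "smooth_on S e2" "smooth_on S n" "smooth_on S u"
    and frame: "\<And>q. q \<in> S \<Longrightarrow> frame_at (e1 q) (e2 q)"
    and nz: "\<And>q. q \<in> S \<Longrightarrow> n q \<noteq> 0"
    and K: "\<And>q p. q \<in> S \<Longrightarrow> K (q, p) = n q * (p \<bullet> e1 q) * (p \<bullet> e2 q)"
    and F: "\<And>q p. q \<in> S \<Longrightarrow> F (q, p) =
      1 * (p \<bullet> e1 q)\<^sup>2 + u q * n q * (p \<bullet> e1 q) * (p \<bullet> e2 q) + 1 * (p \<bullet> e2 q)\<^sup>2"
    and q0: "q0 \<in> S"
  shows "admits_coordinates (liouville_form (-1)) S G F"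
proof (rule liouville_coordinates)
  let ?X = "\<lambda>q. 1 / n q - u q / 2" and ?Y = "\<lambda>q. - (1 / n q) - u q / 2"
  show "smooth_on S (\<lambda>q. e1 q + e2 q)" "smooth_on S (\<lambda>q. e1 q - e2 q)" "smooth_on S ?X" "smooth_on S ?Y"
    by (intro smooth_intros open_S smooth nz; simp)+
  fix q assume q: "q \<in> S"
  show "frame_at (e1 q + e2 q) (e1 q - e2 q)"
    using frame[OF q] by (simp add: frame_at_def algebra_simps)
  show "?X q \<noteq> ?Y q" using nz[OF q] by (simp add: field_simps)
  fix p
  have D: "?X q - ?Y q = 2 / n q" by simp
  show "K (q, p) = ((p \<bullet> (e1 q + e2 q))\<^sup>2 + - 1 * (p \<bullet> (e1 q - e2 q))\<^sup>2) / (2 * (?X q - ?Y q))"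
    unfolding D K[OF q] using nz[OF q]
    by (simp add: inner_add_right inner_diff_right field_simps power2_eq_square)
  show "F (q, p) = (?X q * (p \<bullet> (e1 q - e2 q))\<^sup>2 + - 1 * (?Y q * (p \<bullet> (e1 q + e2 q))\<^sup>2)) / (?X q - ?Y q)"
    unfolding D F[OF q] using nz[OF q]
    by (simp add: inner_add_right inner_diff_right field_simps power2_eq_square)
qed (use q0 in auto)

text \<open>Rescaling the null directions reduces the coefficients of the squares to \<open>\<plusminus> 1\<close> or \<open>0\<close>.\<close>

lemma null_frame_normal_form:
  assumes smooth: "smooth_on S e1" "smooth_on S e2" "smooth_on S a" "smooth_on S b" "smooth_on S c"
    and frame: "\<And>q. q \<in> S \<Longrightarrow> frame_at (e1 q) (e2 q)"
    and K: "\<And>q p. q \<in> S \<Longrightarrow> K (q, p) = (p \<bullet> e1 q) * (p \<bullet> e2 q)"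
    and F: "\<And>q p. q \<in> S \<Longrightarrow> F (q, p) = frame_form e1 e2 a b c (q, p)"
    and q0: "q0 \<in> S" and a: "a q0 > 0"
    and c: "c q0 \<noteq> 0 \<or> (\<forall>q\<in>S. a q * c q = 0)"
  shows "admits_coordinates (if c q0 > 0 then liouville_form (-1)
      else if c q0 < 0 then complex_liouville_form else jordan_block_form) S G F"
proof -
  define \<tau> where "\<tau> = sgn (c q0)"
  define S' where "S' = {q \<in> {q \<in> S. 0 < a q}. c q0 = 0 \<or> 0 < \<tau> * c q}"
  have o1: "open {q \<in> S. 0 < a q}"
    by (rule open_positive_set[OF open_S smooth_on_continuous[OF smooth(3)]])
  have "open {q \<in> {q \<in> S. 0 < a q}. 0 < \<tau> * c q}"
    by (rule open_positive_set[OF o1])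
      (intro continuous_intros continuous_on_subset[OF smooth_on_continuous[OF smooth(5)]], auto)
  then have oS': "open S'" using o1 by (cases "c q0 = 0") (simp_all add: S'_def)
  have S'S: "S' \<subseteq> S" by (auto simp: S'_def)
  have "q0 \<in> S'" using q0 a by (auto simp: S'_def \<tau>_def sgn_if)
  interpret L: local_integral S' G K F by (rule subset[OF oS' S'S])
  define s where "s q = sqrt (a q)" for q
  \<comment> \<open>If \<open>c q0 = 0\<close>, the hypothesis forces \<open>c\<close> to vanish
    wherever \<open>a\<close> is positive, and \<open>e2\<close> stays unscaled; otherwise
    \<open>c\<close> keeps the sign \<open>\<tau>\<close> on \<open>S'\<close>.\<close>
  define t where "t q = (if c q0 = 0 then 1 else sqrt (\<tau> * c q))" for q
  have sm': "smooth_on S' e1" "smooth_on S' e2" "smooth_on S' a" "smooth_on S' b" "smooth_on S' c"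
    using smooth S'S smooth_on_subset by blast+
  have sms: "smooth_on S' s"
    unfolding s_def by (intro smooth_intros oS' sm') (simp add: S'_def)
  have smt: "smooth_on S' t"
  proof (cases "c q0 = 0")
    case False
    then show ?thesis unfolding t_def
      by (simp only: if_False) (intro smooth_intros oS' sm', simp add: S'_def)
  qed (simp add: t_def[abs_def] oS' smooth_on_const)
  have s: "s q > 0" "s q * s q = a q" if "q \<in> S'" for q using that by (auto simp: s_def S'_def)
  have t: "t q > 0" "\<tau> * (t q * t q) = c q" if "q \<in> S'" for q
  proof -
    show "t q > 0" using that by (auto simp: t_def S'_def)
    show "\<tau> * (t q * t q) = c q"
    proof (cases "c q0 = 0")
      case True
      then have "a q * c q = 0" using c that S'S by blast
      then show ?thesis using True that by (simp add: \<tau>_def S'_def)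
    next
      case False
      then have "t q * t q = \<tau> * c q" using that by (simp add: t_def S'_def)
      moreover have "\<tau> * \<tau> = 1" using False by (simp add: \<tau>_def sgn_if)
      ultimately show ?thesis by (simp add: mult.assoc[symmetric])
    qed
  qed
  define e1' where "e1' q = s q *\<^sub>R e1 q" for q
  define e2' where "e2' q = t q *\<^sub>R e2 q" for q
  define n where "n q = 1 / (s q * t q)" for q
  have st: "s q * t q \<noteq> 0" if "q \<in> S'" for q using s(1)[OF that] t(1)[OF that] by simp
  have sm: "smooth_on S' e1'" "smooth_on S' e2'" "smooth_on S' n" "smooth_on S' b"
    unfolding e1'_def e2'_def n_def by (intro smooth_intros oS' sm' sms smt st; assumption)+
  have frame': "frame_at (e1' q) (e2' q)" if "q \<in> S'" for q
  proof -
    have "frame_at (e1 q) (e2 q)" using frame that S'S by blast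
    moreover have "fst (e1' q) * snd (e2' q) - fst (e2' q) * snd (e1' q) =
        (s q * t q) * (fst (e1 q) * snd (e2 q) - fst (e2 q) * snd (e1 q))"
      by (simp add: e1'_def e2'_def algebra_simps)
    ultimately show ?thesis using st[OF that] by (simp add: frame_at_def)
  qed
  have n0: "n q \<noteq> 0" if "q \<in> S'" for q using st[OF that] by (simp add: n_def)
  have K': "K (q, p) = n q * (p \<bullet> e1' q) * (p \<bullet> e2' q)" if "q \<in> S'" for q p
    using that S'S st[OF that] by (simp add: K e1'_def e2'_def n_def subsetD)
  have F': "F (q, p) = 1 * (p \<bullet> e1' q)\<^sup>2 + b q * n q * (p \<bullet> e1' q) * (p \<bullet> e2' q) + \<tau> * (p \<bullet> e2' q)\<^sup>2"
    if "q \<in> S'" for q p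
  proof -
    have "1 * (p \<bullet> e1' q)\<^sup>2 + b q * n q * (p \<bullet> e1' q) * (p \<bullet> e2' q) + \<tau> * (p \<bullet> e2' q)\<^sup>2 =
        (s q * s q) * (p \<bullet> e1 q)\<^sup>2 + b q * (n q * (s q * t q)) * (p \<bullet> e1 q) * (p \<bullet> e2 q)
        + (\<tau> * (t q * t q)) * (p \<bullet> e2 q)\<^sup>2"
      by (simp add: e1'_def e2'_def power2_eq_square algebra_simps)
    also have "n q * (s q * t q) = 1" using st[OF that] by (simp add: n_def)
    finally show ?thesis
      using that S'S by (simp add: F s t frame_form_def subsetD)
  qed
  note L = L.null_liouville_coordinates[OF sm frame' n0 K'] L.complex_liouville_coordinates[OF sm frame' n0 K']
    L.jordan_block_coordinates[OF sm frame' n0 K']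
  consider "c q0 > 0" "\<tau> = 1" | "c q0 < 0" "\<tau> = -1" | "c q0 = 0" "\<tau> = 0"
    by (auto simp: \<tau>_def sgn_if split: if_splits) linarith
  then show ?thesis
  proof cases
    case 1
    then have "admits_coordinates (liouville_form (-1)) S' G F"
      using F' \<open>q0 \<in> S'\<close> by (intro L(1)) simp_all
    then show ?thesis using 1 S'S by (auto intro: admits_coordinates_mono)
  next
    case 2
    then have "admits_coordinates complex_liouville_form S' G F"
      using F' \<open>q0 \<in> S'\<close> by (intro L(2)) simp_all
    then show ?thesis using 2 S'S by (auto intro: admits_coordinates_mono)
  next
    case 3
    then have "admits_coordinates jordan_block_form S' G F"
      using F' \<open>q0 \<in> S'\<close> by (intro L(3)) simp_all
    then show ?thesis using 3 S'S by (auto intro: admits_coordinates_mono)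
  qed
qed

text \<open>The frame \<open>R1, R2\<close> diagonalizes \<open>F\<close> with respect to \<open>K\<close>; it arises from \<open>e1, e2\<close> by a rotation
  and a dilation.\<close>

lemma definite_frame_liouville:
  assumes smooth: "smooth_on S e1" "smooth_on S e2" "smooth_on S a" "smooth_on S b" "smooth_on S c"
    and frame: "\<And>q. q \<in> S \<Longrightarrow> frame_at (e1 q) (e2 q)" and \<kappa>: "\<kappa> = 1 \<or> \<kappa> = -1"
    and K: "\<And>q p. q \<in> S \<Longrightarrow> K (q, p) = \<kappa> * ((p \<bullet> e1 q)\<^sup>2 + (p \<bullet> e2 q)\<^sup>2)"
    and F: "\<And>q p. q \<in> S \<Longrightarrow> F (q, p) = frame_form e1 e2 a b c (q, p)"
    and q0: "q0 \<in> S" and ac: "a q0 \<le> c q0" and ne: "a q0 \<noteq> c q0 \<or> b q0 \<noteq> 0"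
  shows "admits_coordinates (liouville_form 1) S G F"
proof -
  define d2 where "d2 q = (a q - c q)\<^sup>2 + (b q)\<^sup>2" for q
  \<comment> \<open>The difference of the two eigenvalues of \<open>F\<close> relative to the sum of
    squares; it is positive near \<open>q0\<close> because \<open>F\<close> is not a multiple of
    that sum there.\<close>
  define \<delta> where "\<delta> q = sqrt (d2 q)" for q
  \<comment> \<open>The square of the coefficient \<open>m\<close> below. The requirements
    \<open>l\<^sup>2 - m\<^sup>2 = a - c\<close> and \<open>2 l m = b\<close> say that
    \<open>l + i m\<close> is a square root of \<open>(a - c) + i b\<close>. With
    \<open>a q0 \<le> c q0\<close> the part \<open>m\<close> is nonzero near \<open>q0\<close>, so
    \<open>l\<close> can be found by division.\<close>
  define \<mu> where "\<mu> q = (\<delta> q + c q - a q) / 2" for q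
  define S' where "S' = {q \<in> {q \<in> S. 0 < d2 q}. 0 < \<mu> q}"
  have o1: "open {q \<in> S. 0 < d2 q}"
    unfolding d2_def
    by (intro open_positive_set[OF open_S] smooth_on_continuous smooth_intros open_S smooth)
  have "continuous_on S \<mu>"
    unfolding \<mu>_def \<delta>_def d2_def
    by (intro continuous_intros smooth_on_continuous smooth) simp
  then have oS': "open S'"
    unfolding S'_def by (intro open_positive_set[OF o1]) (auto elim: continuous_on_subset)
  have S'S: "S' \<subseteq> S" by (auto simp: S'_def)
  have d2q0: "0 < d2 q0" using ne by (auto simp: d2_def sum_power2_gt_zero_iff)
  then have "0 < \<delta> q0" by (simp add: \<delta>_def)
  then have "0 < \<mu> q0" using ac by (simp add: \<mu>_def)
  then have q0': "q0 \<in> S'" using d2q0 q0 by (simp add: S'_def)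
  interpret L: local_integral S' G K F by (rule subset[OF oS' S'S])
  have sm': "smooth_on S' e1" "smooth_on S' e2" "smooth_on S' a" "smooth_on S' b" "smooth_on S' c"
    using smooth S'S smooth_on_subset by blast+
  have pos: "0 < d2 q" "0 < \<mu> q" "0 < \<delta> q" if "q \<in> S'" for q using that by (auto simp: S'_def \<delta>_def)
  have sm\<delta>: "smooth_on S' \<delta>"
    unfolding \<delta>_def using pos(1) unfolding d2_def by (intro smooth_intros oS' sm')
  have sm\<mu>: "smooth_on S' \<mu>" unfolding \<mu>_def by (intro smooth_intros oS' sm' sm\<delta>) simp
  define m where "m q = sqrt (\<mu> q)" for q
  define l where "l q = b q / (2 * m q)" for q
  have m: "0 < m q" "m q * m q = \<mu> q" if "q \<in> S'" for q using pos(2)[OF that] by (auto simp: m_def)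
  have smm: "smooth_on S' m" unfolding m_def by (intro smooth_intros oS' sm\<mu> pos(2))
  have sml: "smooth_on S' l"
    unfolding l_def using m(1) by (intro smooth_intros oS' sm' smm) force
  have \<delta>2: "\<delta> q * \<delta> q = (a q - c q)\<^sup>2 + (b q)\<^sup>2" if "q \<in> S'" for q
    using pos(1)[OF that] by (simp add: \<delta>_def d2_def)
  have lm: "2 * (l q * m q) = b q" if "q \<in> S'" for q using m(1)[OF that] by (simp add: l_def)
  have ll: "l q * l q = (\<delta> q - c q + a q) / 2" if "q \<in> S'" for q
  proof -
    have \<mu>: "2 * \<mu> q = \<delta> q + c q - a q" by (simp add: \<mu>_def)
    have "(2 * (l q * l q)) * (2 * \<mu> q) = (2 * (l q * m q)) * (2 * (l q * m q))"
      by (simp add: m(2)[OF that, symmetric])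
    also have "\<dots> = \<delta> q * \<delta> q - (a q - c q)\<^sup>2"
      unfolding lm[OF that] using \<delta>2[OF that] by (simp add: power2_eq_square)
    also have "\<dots> = (\<delta> q - c q + a q) * (2 * \<mu> q)"
      unfolding \<mu> by (simp add: algebra_simps power2_eq_square)
    finally have "2 * (l q * l q) = \<delta> q - c q + a q"
      using pos(2)[OF that] by simp
    then show ?thesis by simp
  qed
  define R1 where "R1 q = m q *\<^sub>R e1 q - l q *\<^sub>R e2 q" for q
  define R2 where "R2 q = l q *\<^sub>R e1 q + m q *\<^sub>R e2 q" for q
  \<comment> \<open>Up to the factor \<open>\<kappa> / 2\<close>, \<open>X\<close> is the larger and
    \<open>Y\<close> the smaller eigenvalue of \<open>F\<close> relative to the sum of
    squares.\<close>
  define X where "X q = \<kappa> / 4 * (\<delta> q + (a q + c q))" for q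
  define Y where "Y q = \<kappa> / 4 * (- \<delta> q + (a q + c q))" for q
  have \<kappa>2: "\<kappa> * \<kappa> = 1" using \<kappa> by auto
  have XY: "X q - Y q = \<kappa> * \<delta> q / 2" for q by (simp add: X_def Y_def algebra_simps)
  have sumR: "(p \<bullet> R1 q)\<^sup>2 + (p \<bullet> R2 q)\<^sup>2 = \<delta> q * ((p \<bullet> e1 q)\<^sup>2 + (p \<bullet> e2 q)\<^sup>2)" if "q \<in> S'" for q p
  proof -
    have "(p \<bullet> R1 q)\<^sup>2 + (p \<bullet> R2 q)\<^sup>2 = (m q * m q + l q * l q) * ((p \<bullet> e1 q)\<^sup>2 + (p \<bullet> e2 q)\<^sup>2)"
      by (simp add: R1_def R2_def inner_add_right inner_diff_right algebra_simps power2_eq_square)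
    also have "m q * m q + l q * l q = \<delta> q" unfolding m(2)[OF that] ll[OF that] by (simp add: \<mu>_def field_simps)
    finally show ?thesis .
  qed
  have diffR: "(p \<bullet> R2 q)\<^sup>2 - (p \<bullet> R1 q)\<^sup>2 =
      2 * F (q, p) - (a q + c q) * ((p \<bullet> e1 q)\<^sup>2 + (p \<bullet> e2 q)\<^sup>2)" if "q \<in> S'" for q p
  proof -
    have "(p \<bullet> R2 q)\<^sup>2 - (p \<bullet> R1 q)\<^sup>2 = (l q * l q - m q * m q) * ((p \<bullet> e1 q)\<^sup>2 - (p \<bullet> e2 q)\<^sup>2)
        + 2 * (2 * (l q * m q)) * (p \<bullet> e1 q) * (p \<bullet> e2 q)"
      by (simp add: R1_def R2_def inner_add_right inner_diff_right algebra_simps power2_eq_square)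
    also have "l q * l q - m q * m q = a q - c q" unfolding m(2)[OF that] ll[OF that] by (simp add: \<mu>_def field_simps)
    finally show ?thesis
      using that S'S unfolding lm[OF that] by (simp add: F frame_form_def subsetD algebra_simps)
  qed
  have "admits_coordinates (liouville_form 1) S' G F"
  proof (rule L.liouville_coordinates[where ?e1.0 = R1 and ?e2.0 = R2 and X = X and Y = Y])
    show "smooth_on S' R1" "smooth_on S' R2" "smooth_on S' X" "smooth_on S' Y"
      unfolding R1_def R2_def X_def Y_def by (intro smooth_intros oS' sm' smm sml sm\<delta>; simp)+
    fix q assume q: "q \<in> S'"
    have "fst (R1 q) * snd (R2 q) - fst (R2 q) * snd (R1 q) =
        (m q * m q + l q * l q) * (fst (e1 q) * snd (e2 q) - fst (e2 q) * snd (e1 q))"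
      by (simp add: R1_def R2_def algebra_simps)
    moreover have "m q * m q + l q * l q \<noteq> 0"
      using m(1)[OF q] by (metis add_pos_nonneg less_irrefl mult_pos_pos zero_le_square)
    moreover have qS: "q \<in> S" using q S'S by blast
    ultimately show "frame_at (R1 q) (R2 q)"
      using frame[OF qS] by (simp add: frame_at_def)
    show "X q \<noteq> Y q"
      using XY[of q] pos(3)[OF q] \<kappa> by auto
    fix p
    have \<delta>: "\<delta> q \<noteq> 0" using pos(3)[OF q] by simp
    show "K (q, p) = ((p \<bullet> R1 q)\<^sup>2 + 1 * (p \<bullet> R2 q)\<^sup>2) / (2 * (X q - Y q))"
      using \<delta> \<kappa> sumR[OF q, of p] by (auto simp: K[OF qS] XY)
    have "(X q * (p \<bullet> R2 q)\<^sup>2 + 1 * (Y q * (p \<bullet> R1 q)\<^sup>2)) =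
        \<kappa> / 4 * (\<delta> q * ((p \<bullet> R2 q)\<^sup>2 - (p \<bullet> R1 q)\<^sup>2) + (a q + c q) * ((p \<bullet> R1 q)\<^sup>2 + (p \<bullet> R2 q)\<^sup>2))"
      by (simp add: X_def Y_def algebra_simps add_divide_distrib)
    also have "\<dots> = F (q, p) * (X q - Y q)"
      unfolding sumR[OF q] diffR[OF q] XY by (simp add: algebra_simps)
    finally show "F (q, p) = (X q * (p \<bullet> R2 q)\<^sup>2 + 1 * (Y q * (p \<bullet> R1 q)\<^sup>2)) / (X q - Y q)"
      using \<open>X q \<noteq> Y q\<close> by (simp only: nonzero_mult_div_cancel_right right_minus_eq not_False_eq_True)
  qed (use q0' in auto)
  then show ?thesis using S'S by (auto intro: admits_coordinates_mono)
qed

text \<open>Handles the degenerate cases, where \<open>F\<close> is pointwise a multiple of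
  \<open>K\<close>: the equations make the factor constant along the frame.\<close>

lemma proportional_const:
  assumes smooth: "smooth_on S e1" "smooth_on S e2" "smooth_on S f"
    and frame: "\<And>q. q \<in> S \<Longrightarrow> frame_at (e1 q) (e2 q)"
    and f: "\<And>q. q \<in> S \<Longrightarrow> lie e1 f q = 0" "\<And>q. q \<in> S \<Longrightarrow> lie e2 f q = 0" and q0: "q0 \<in> S"
  obtains k B where "open B" "q0 \<in> B" "B \<subseteq> S" "\<And>q. q \<in> B \<Longrightarrow> f q = k"
proof -
  obtain s where s: "s > 0" "ball q0 s \<subseteq> S" using open_S q0 by (auto simp: open_contains_ball)
  have d: "(f has_derivative (\<lambda>h. 0)) (at q within ball q0 s)" if "q \<in> ball q0 s" for q
  proof -
    have q: "q \<in> S" using that s by blast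
    have "dir_deriv f v q = 0" for v
    proof -
      obtain a b where "v = a *\<^sub>R e1 q + b *\<^sub>R e2 q" using frame_at_vector[OF frame[OF q]] .
      then show ?thesis
        using lie_lincomb[OF smooth(3) q, of "\<lambda>_. v" a e1 b e2] f[OF q] by (simp add: lie_def)
    qed
    then show ?thesis
      using smooth_on_has_derivative[OF smooth(3) q] by (simp add: has_derivative_at_withinI)
  qed
  have "f q = f q0" if "q \<in> ball q0 s" for q
    using has_derivative_zero_unique[OF convex_ball d _ that, of q0] s(1) by simp
  then show ?thesis
    by (rule that[OF open_ball _ s(2), rotated]) (use s(1) in simp_all)
qed

definition proportional_somewhere where
  "proportional_somewhere \<longleftrightarrow> (\<exists>k B. open B \<and> B \<noteq> {} \<and> B \<subseteq> S \<and> (\<forall>q\<in>B. \<forall>p. F (q, p) = k * K (q, p)))"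

text \<open>If \<open>a\<close> and \<open>c\<close> are both nonzero somewhere, equal signs give
  the Liouville form after multiplication by that sign. For opposite signs, ordering the null
  vectors so that \<open>a > 0 > c\<close> gives the complex form without changing the sign of
  \<open>F\<close>. Otherwise \<open>a * c\<close> vanishes identically, and a point with one
  nonzero coefficient leads to the Jordan block. If none exists, \<open>F = b K\<close>, and
  \<open>b\<close> is locally constant.\<close>

lemma null_frame_cases:
  assumes smooth: "smooth_on S e1" "smooth_on S e2" "smooth_on S a" "smooth_on S b" "smooth_on S c"
    and frame: "\<And>q. q \<in> S \<Longrightarrow> frame_at (e1 q) (e2 q)"
    and K: "\<And>q p. q \<in> S \<Longrightarrow> K (q, p) = (p \<bullet> e1 q) * (p \<bullet> e2 q)"
    and F: "\<And>q p. q \<in> S \<Longrightarrow> F (q, p) = frame_form e1 e2 a b c (q, p)"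
    and "S \<noteq> {}"
  shows "admits_coordinates normal_form S G F \<or> proportional_somewhere"
proof -
  have sub: "admits_coordinates normal_form S G F" if ad: "admits_coordinates P S G (\<lambda>z. \<sigma> * F z)"
      and P: "P = complex_liouville_form \<and> \<sigma> = 1 \<or> (P = liouville_form (-1) \<or> P = jordan_block_form) \<and> \<sigma> \<in> {1, -1}"
    for \<sigma> P
    by (rule admits_coordinates_mono[OF admits_coordinates_scale[OF ad] order_refl])
      (use P in \<open>auto simp: normal_form_def\<close>)
  have main: "admits_coordinates normal_form S G F"
    if fr: "smooth_on S e1" "smooth_on S e2" "smooth_on S a" "smooth_on S c" "\<And>q. q \<in> S \<Longrightarrow> frame_at (e1 q) (e2 q)"
      and K: "\<And>q p. q \<in> S \<Longrightarrow> K (q, p) = (p \<bullet> e1 q) * (p \<bullet> e2 q)"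
      and F: "\<And>q p. q \<in> S \<Longrightarrow> F (q, p) = frame_form e1 e2 a b c (q, p)"
      and q0: "q0 \<in> S" and a: "\<sigma> * a q0 > 0" and \<sigma>: "\<sigma> \<in> {1, -1}"
      and c: "c q0 \<noteq> 0 \<or> (\<forall>q\<in>S. a q * c q = 0)" and pos: "\<sigma> * c q0 < 0 \<Longrightarrow> \<sigma> = 1"
    for e1 e2 a c q0 \<sigma>
  proof -
    interpret L: local_integral S G K "\<lambda>z. \<sigma> * F z"
      by (rule scale[OF differentiable_frame_form[OF fr(1-3) smooth(4) fr(4) F]])
    have F': "\<sigma> * F (q, p) = frame_form e1 e2 (\<lambda>q. \<sigma> * a q) (\<lambda>q. \<sigma> * b q) (\<lambda>q. \<sigma> * c q) (q, p)" if "q \<in> S" for q p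
      by (simp add: F[OF that] frame_form_def algebra_simps)
    have sm: "smooth_on S (\<lambda>q. \<sigma> * a q)" "smooth_on S (\<lambda>q. \<sigma> * b q)" "smooth_on S (\<lambda>q. \<sigma> * c q)"
      by (intro smooth_intros open_S smooth fr)+
    have "\<sigma> \<noteq> 0" using \<sigma> by auto
    then have c': "\<sigma> * c q0 \<noteq> 0 \<or> (\<forall>q\<in>S. \<sigma> * a q * (\<sigma> * c q) = 0)" using c by auto
    note L.null_frame_normal_form[OF fr(1,2) sm fr(5) K F' q0 a c']
    then show ?thesis
      by (rule sub) (use \<sigma> pos in auto)
  qed
  have swap: "frame_form e1 e2 a b c (q, p) = frame_form e2 e1 c b a (q, p)" for q p
    by (simp add: frame_form_def mult_ac)
  have F2: "F (q, p) = frame_form e2 e1 c b a (q, p)" if "q \<in> S" for q p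
    using F[OF that] by (simp only: swap)
  have frame2: "frame_at (e2 q) (e1 q)" if "q \<in> S" for q
    using frame[OF that] by (simp add: frame_at_def mult.commute)
  have K2: "K (q, p) = (p \<bullet> e2 q) * (p \<bullet> e1 q)" if "q \<in> S" for q p using K[OF that] by (simp add: mult.commute)
  note main1 = main[OF smooth(1,2,3,5) frame K F] and main2 = main[OF smooth(2,1,5,3) frame2 K2 F2]
  consider q0 where "q0 \<in> S" "a q0 \<noteq> 0" "c q0 \<noteq> 0"
    | q0 where "q0 \<in> S" "a q0 \<noteq> 0" "\<forall>q\<in>S. a q * c q = 0"
    | q0 where "q0 \<in> S" "c q0 \<noteq> 0" "\<forall>q\<in>S. a q * c q = 0"
    | "\<forall>q\<in>S. a q = 0 \<and> c q = 0" by (metis mult_eq_0_iff)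
  then show ?thesis
  proof cases
    case (1 q0)
    consider "sgn (a q0) = sgn (c q0)" | "a q0 > 0" "c q0 < 0" | "a q0 < 0" "c q0 > 0"
      using 1(2,3) by (cases "a q0 > 0"; cases "c q0 > 0") (auto simp: sgn_if not_less le_less)
    then show ?thesis
    proof cases
      case 1
      then have "sgn (a q0) * a q0 > 0" "sgn (a q0) \<in> {1, -1}" "sgn (a q0) * c q0 > 0"
        using \<open>a q0 \<noteq> 0\<close> \<open>c q0 \<noteq> 0\<close> by (auto simp: sgn_if split: if_splits)
      then show ?thesis using main1[OF _ _ _ \<open>q0 \<in> S\<close>, of "sgn (a q0)"] \<open>c q0 \<noteq> 0\<close> by auto
    next
      case 2
      then show ?thesis using main1[OF _ _ _ \<open>q0 \<in> S\<close>, of 1] by auto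
    next
      case 3
      then show ?thesis using main2[OF _ _ _ \<open>q0 \<in> S\<close>, of 1] by auto
    qed
  next
    case (2 q0)
    then have "c q0 = 0" by auto
    moreover have "sgn (a q0) * a q0 > 0" "sgn (a q0) \<in> {1, -1}"
      using 2 by (auto simp: sgn_if)
    ultimately show ?thesis using main1[OF _ _ _ \<open>q0 \<in> S\<close>, of "sgn (a q0)"] 2 by auto
  next
    case (3 q0)
    then have "a q0 = 0" by auto
    moreover have "sgn (c q0) * c q0 > 0" "sgn (c q0) \<in> {1, -1}"
      using 3 by (auto simp: sgn_if)
    ultimately show ?thesis
      using main2[OF _ _ _ \<open>q0 \<in> S\<close>, of "sgn (c q0)"] 3 by (auto simp: mult.commute)
  next
    case 4
    obtain q0 where q0: "q0 \<in> S" using \<open>S \<noteq> {}\<close> by blast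
    have F0: "F (q, p) = 0 * (p \<bullet> e1 q)\<^sup>2 + b q * 1 * (p \<bullet> e1 q) * (p \<bullet> e2 q) + 0 * (p \<bullet> e2 q)\<^sup>2"
      if "q \<in> S" for q p using 4 that by (simp add: F frame_form_def)
    have K1: "K (q, p) = 1 * (p \<bullet> e1 q) * (p \<bullet> e2 q)" if "q \<in> S" for q p by (simp add: K[OF that])
    have db: "lie e1 b q = 0 \<and> lie e2 b q = 0" if q: "q \<in> S" for q
    proof -
      obtain c1 c2 where c: "lie e2 e1 q - lie e1 e2 q = c1 *\<^sub>R e1 q + c2 *\<^sub>R e2 q"
        using frame_at_vector[OF frame[OF q]] .
      have "(1::real)\<^sup>2 * lie e2 b q = 2 * 0 * lie e1 (\<lambda>_. 1) q - 2 * 1 * 0 * c2 \<and>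
          (1::real)\<^sup>2 * lie e1 b q = 2 * 0 * lie e2 (\<lambda>_. 1) q + 2 * 1 * 0 * c1"
        by (intro conjI null_frame[where q = q and n = "\<lambda>_. 1" and ?c1.0 = c1 and ?c2.0 = c2,
              OF smooth(1,2) smooth_on_const[OF open_S] smooth(4) frame _ K1 F0] q c) simp_all
      then show ?thesis by simp
    qed
    obtain k B where B: "open B" "q0 \<in> B" "B \<subseteq> S" "\<And>q. q \<in> B \<Longrightarrow> b q = k"
      by (rule proportional_const[OF smooth(1,2,4) frame _ _ q0]) (use db in auto)
    have "F (q, p) = k * K (q, p)" if "q \<in> B" for q p
    proof -
      have "q \<in> S" using that B(3) by blast
      then show ?thesis by (simp add: F0 K1 B(4)[OF that])
    qed
    then show ?thesis unfolding proportional_somewhere_def using B by blast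
  qed
qed

text \<open>A definite metric allows only the Liouville form, reached wherever \<open>F\<close> is
  not a pointwise multiple of \<open>K\<close>; swapping the frame vectors arranges the order of
  \<open>a\<close> and \<open>c\<close>.\<close>

lemma definite_frame_cases:
  assumes smooth: "smooth_on S e1" "smooth_on S e2" "smooth_on S a" "smooth_on S b" "smooth_on S c"
    and frame: "\<And>q. q \<in> S \<Longrightarrow> frame_at (e1 q) (e2 q)" and \<kappa>: "\<kappa> = 1 \<or> \<kappa> = -1"
    and K: "\<And>q p. q \<in> S \<Longrightarrow> K (q, p) = \<kappa> * ((p \<bullet> e1 q)\<^sup>2 + (p \<bullet> e2 q)\<^sup>2)"
    and F: "\<And>q p. q \<in> S \<Longrightarrow> F (q, p) = frame_form e1 e2 a b c (q, p)"
    and "S \<noteq> {}"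
  shows "admits_coordinates normal_form S G F \<or> proportional_somewhere"
proof (cases "\<exists>q0\<in>S. a q0 \<noteq> c q0 \<or> b q0 \<noteq> 0")
  case True
  then obtain q0 where q0: "q0 \<in> S" "a q0 \<noteq> c q0 \<or> b q0 \<noteq> 0" by blast
  have "admits_coordinates (liouville_form 1) S G F"
  proof (cases "a q0 \<le> c q0")
    case True
    show ?thesis by (rule definite_frame_liouville[OF smooth frame \<kappa> K F q0(1) True q0(2)])
  next
    case False
    have F2: "F (q, p) = frame_form e2 e1 c b a (q, p)" if "q \<in> S" for q p
      by (simp add: F[OF that] frame_form_def mult_ac)
    have frame2: "frame_at (e2 q) (e1 q)" if "q \<in> S" for q
      using frame[OF that] by (simp add: frame_at_def mult.commute)
    have K2: "K (q, p) = \<kappa> * ((p \<bullet> e2 q)\<^sup>2 + (p \<bullet> e1 q)\<^sup>2)" if "q \<in> S" for q p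
      by (simp add: K[OF that] add.commute)
    show ?thesis
      by (rule definite_frame_liouville[OF smooth(2,1,5,4,3) frame2 \<kappa> K2 F2 q0(1)])
        (use False q0(2) in auto)
  qed
  then show ?thesis by (auto simp: normal_form_def intro: admits_coordinates_mono)
next
  case False
  obtain q0 where q0: "q0 \<in> S" using \<open>S \<noteq> {}\<close> by blast
  have F0: "F (q, p) = frame_form e1 e2 a (\<lambda>_. 0) a (q, p)" if "q \<in> S" for q p
    using False that by (simp add: F frame_form_def)
  have K0: "K (q, p) = frame_form e1 e2 (\<lambda>_. \<kappa>) (\<lambda>_. 0) (\<lambda>_. \<kappa>) (q, p)" if "q \<in> S" for q p
    by (simp add: K[OF that] frame_form_def algebra_simps)
  have da: "lie e1 a q = 0 \<and> lie e2 a q = 0" if q: "q \<in> S" for q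
  proof -
    obtain c1 c2 where c: "lie e2 e1 q - lie e1 e2 q = c1 *\<^sub>R e1 q + c2 *\<^sub>R e2 q"
      using frame_at_vector[OF frame[OF q]] .
    have int: "poisson_bracket (frame_form e1 e2 (\<lambda>_. \<kappa>) (\<lambda>_. 0) (\<lambda>_. \<kappa>)) (frame_form e1 e2 a (\<lambda>_. 0) a) (q, p) = 0" for p
      by (rule trans[OF poisson_bracket_cong[OF open_S q] integral[OF q]]) (erule K0[symmetric] F0[symmetric])+
    note const = smooth_on_const[OF open_S, of "_ :: real"]
    note E = frame_form_integral_equations[OF smooth(1,2) const const const smooth(3) const smooth(3) q frame[OF q] int c]
    \<comment> \<open>With constant \<open>h11 = h22\<close> and no mixed terms, the two outer
      coefficients of the cubic are multiples of the derivatives of \<open>a\<close> along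
      \<open>e1\<close> and \<open>e2\<close>.\<close>
    show ?thesis using E(1,4) \<kappa> by auto
  qed
  obtain k B where B: "open B" "q0 \<in> B" "B \<subseteq> S" "\<And>q. q \<in> B \<Longrightarrow> a q = k"
    by (rule proportional_const[OF smooth(1,2,3) frame _ _ q0]) (use da in auto)
  have "F (q, p) = k * \<kappa> * K (q, p)" if "q \<in> B" for q p
  proof -
    have "q \<in> S" using that B(3) by blast
    then show ?thesis using \<kappa> B(4)[OF that] by (auto simp: F0 K frame_form_def algebra_simps)
  qed
  then show ?thesis unfolding proportional_somewhere_def using B by blast
qed

text \<open>The discriminant at an arbitrary point decides whether the metric is definite or
  indefinite. Either alternative of the conclusion on a smaller open set passes to
  \<open>S\<close>.\<close>

theorem local_normal_form:
  assumes smooth: "smooth_on S h11" "smooth_on S h12" "smooth_on S h22" "smooth_on S a" "smooth_on S b" "smooth_on S c"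
    and nondeg: "\<And>q. q \<in> S \<Longrightarrow> 4 * h11 q * h22 q - (h12 q)\<^sup>2 \<noteq> 0"
    and K: "\<And>q p. q \<in> S \<Longrightarrow> K (q, p) = frame_form e_x e_y h11 h12 h22 (q, p)"
    and F: "\<And>q p. q \<in> S \<Longrightarrow> F (q, p) = frame_form e_x e_y a b c (q, p)"
    and "S \<noteq> {}"
  shows "admits_coordinates normal_form S G F \<or> proportional_somewhere"
proof -
  obtain q0 where q0: "q0 \<in> S" using \<open>S \<noteq> {}\<close> by blast
  define disc where "disc q = 4 * h11 q * h22 q - (h12 q)\<^sup>2" for q
  have smd: "smooth_on S disc" unfolding disc_def by (intro smooth_intros open_S smooth)
  have up: "admits_coordinates normal_form S G F \<or> proportional_somewhere"
    if S': "open S'" "S' \<subseteq> S" and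
      ad: "admits_coordinates normal_form S' G F \<or> local_integral.proportional_somewhere S' K F" for S'
  proof -
    interpret L: local_integral S' G K F by (rule subset[OF S'])
    show ?thesis
      using ad S'(2) unfolding proportional_somewhere_def L.proportional_somewhere_def
      by (meson admits_coordinates_mono order_trans)
  qed
  show ?thesis
  proof (cases "disc q0 > 0")
    case True
    define \<kappa> where "\<kappa> = sgn (h11 q0)"
    have "h11 q0 \<noteq> 0"
    proof
      assume "h11 q0 = 0"
      then show False using True by (simp add: disc_def not_less)
    qed
    then have \<kappa>: "\<kappa> = 1 \<or> \<kappa> = -1" "\<kappa> * h11 q0 > 0" by (auto simp: \<kappa>_def sgn_if)
    define S' where "S' = {q \<in> {q \<in> S. 0 < disc q}. 0 < \<kappa> * h11 q}"
    have o1: "open {q \<in> S. 0 < disc q}" by (rule open_positive_set[OF open_S smooth_on_continuous[OF smd]])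
    have S': "open S'" "S' \<subseteq> S" "q0 \<in> S'"
    proof -
      show "open S'" unfolding S'_def
        by (rule open_positive_set[OF o1])
          (intro continuous_intros continuous_on_subset[OF smooth_on_continuous[OF smooth(1)]], auto)
    qed (use q0 True \<kappa> in \<open>auto simp: S'_def\<close>)
    interpret L: local_integral S' G K F by (rule subset[OF S'(1,2)])
    have sm: "smooth_on S' h11" "smooth_on S' h12" "smooth_on S' h22" "smooth_on S' a" "smooth_on S' b" "smooth_on S' c"
      using smooth S'(2) smooth_on_subset by blast+
    obtain e1 e2 where e: "smooth_on S' e1" "smooth_on S' e2" "\<And>q. q \<in> S' \<Longrightarrow> frame_at (e1 q) (e2 q)"
      "\<And>q p. q \<in> S' \<Longrightarrow> frame_form e_x e_y h11 h12 h22 (q, p) = \<kappa> * ((p \<bullet> e1 q)\<^sup>2 + (p \<bullet> e2 q)\<^sup>2)"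
      by (rule definite_form_frame[OF S'(1) sm(1-3) \<kappa>(1)]) (auto simp: S'_def disc_def)
    obtain a' b' c' where f: "smooth_on S' a'" "smooth_on S' b'" "smooth_on S' c'"
      "\<And>q p. q \<in> S' \<Longrightarrow> frame_form e_x e_y a b c (q, p) = frame_form e1 e2 a' b' c' (q, p)"
      using frame_form_change_frame[OF S'(1) e(1,2,3) sm(4-6)] by blast
    have K': "K (q, p) = \<kappa> * ((p \<bullet> e1 q)\<^sup>2 + (p \<bullet> e2 q)\<^sup>2)" if "q \<in> S'" for q p
      using K[OF subsetD[OF S'(2) that]] e(4)[OF that] by simp
    have F': "F (q, p) = frame_form e1 e2 a' b' c' (q, p)" if "q \<in> S'" for q p
      using F[OF subsetD[OF S'(2) that]] f(4)[OF that] by simp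
    have "S' \<noteq> {}" using S'(3) by blast
    then have "admits_coordinates normal_form S' G F \<or> L.proportional_somewhere"
      by (intro L.definite_frame_cases[OF e(1,2) f(1-3) e(3) \<kappa>(1) K' F'])
    then show ?thesis by (rule up[OF S'(1,2)])
  next
    case False
    then have neg: "disc q0 < 0" using nondeg[OF q0] by (simp add: disc_def)
    define S1 where "S1 = {q \<in> S. 0 < - disc q}"
    have S1: "open S1" "S1 \<subseteq> S" "q0 \<in> S1"
    proof -
      show "open S1" unfolding S1_def
        by (intro open_positive_set[OF open_S] continuous_intros smooth_on_continuous[OF smd])
    qed (use q0 neg in \<open>auto simp: S1_def\<close>)
    have sm1: "smooth_on S1 h11" "smooth_on S1 h12" "smooth_on S1 h22"
      using smooth S1(2) smooth_on_subset by blast+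
    obtain S' e1 e2 where S': "open S'" "q0 \<in> S'" "S' \<subseteq> S1"
      and e: "smooth_on S' e1" "smooth_on S' e2" "\<And>q. q \<in> S' \<Longrightarrow> frame_at (e1 q) (e2 q)"
        "\<And>q p. q \<in> S' \<Longrightarrow> frame_form e_x e_y h11 h12 h22 (q, p) = (p \<bullet> e1 q) * (p \<bullet> e2 q)"
      by (rule indefinite_form_frame[OF S1(1) sm1 S1(3)]) (auto simp: S1_def disc_def)
    have S'S: "S' \<subseteq> S" using S' S1 by blast
    interpret L: local_integral S' G K F by (rule subset[OF S'(1) S'S])
    have sm: "smooth_on S' a" "smooth_on S' b" "smooth_on S' c"
      using smooth S'S smooth_on_subset by blast+
    obtain a' b' c' where f: "smooth_on S' a'" "smooth_on S' b'" "smooth_on S' c'"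
      "\<And>q p. q \<in> S' \<Longrightarrow> frame_form e_x e_y a b c (q, p) = frame_form e1 e2 a' b' c' (q, p)"
      using frame_form_change_frame[OF S'(1) e(1,2,3) sm] by blast
    have K': "K (q, p) = (p \<bullet> e1 q) * (p \<bullet> e2 q)" if "q \<in> S'" for q p
      using K[OF subsetD[OF S'S that]] e(4)[OF that] by simp
    have F': "F (q, p) = frame_form e1 e2 a' b' c' (q, p)" if "q \<in> S'" for q p
      using F[OF subsetD[OF S'S that]] f(4)[OF that] by simp
    have "S' \<noteq> {}" using S'(2) by blast
    then have "admits_coordinates normal_form S' G F \<or> L.proportional_somewhere"
      by (intro L.null_frame_cases[OF e(1,2) f(1-3) e(3) K' F'])
    then show ?thesis by (rule up[OF S'(1) S'S])
  qed
qed

end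

section \<open>Coordinate systems\<close>

abbreviation (input) chart_inv :: "'a chart \<Rightarrow> real \<times> real \<Rightarrow> 'a" where
  "chart_inv c \<equiv> inv_into (fst c) (snd c)"

lemma is_chart_inj: "is_chart T c \<Longrightarrow> inj_on (snd c) (fst c)"
  unfolding is_chart_def using homeomorphic_imp_injective_map topspace_subtopology_subset openin_subset
  by metis

lemma is_chart_subset: "is_chart T c \<Longrightarrow> fst c \<subseteq> topspace T"
  by (simp add: is_chart_def openin_subset)

lemma chart_inv_left [simp]: "is_chart T c \<Longrightarrow> p \<in> fst c \<Longrightarrow> chart_inv c (snd c p) = p"
  by (simp add: is_chart_inj)

lemma chart_inv_right: "z \<in> range_of c \<Longrightarrow> snd c (chart_inv c z) = z"
  by (simp add: range_of_def f_inv_into_f)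

lemma chart_inv_in: "z \<in> range_of c \<Longrightarrow> chart_inv c z \<in> fst c"
  by (simp add: range_of_def inv_into_into)

lemma in_range_of: "p \<in> fst c \<Longrightarrow> snd c p \<in> range_of c"
  by (simp add: range_of_def)

lemma is_chart_open_image:
  assumes "is_chart T c" "openin T U" "U \<subseteq> fst c"
  shows "open (snd c ` U)"
proof -
  have "openin (subtopology T (fst c)) U"
    using assms by (simp add: is_chart_def openin_open_subtopology)
  then have "openin (top_of_set (range_of c)) (snd c ` U)"
    using assms(1) homeomorphic_imp_open_map unfolding is_chart_def open_map_def by blast
  then show ?thesis using assms(1) by (simp add: is_chart_def openin_open_eq)
qed

lemma is_chart_open_preimage:
  assumes "is_chart T c" "open V"
  shows "openin T {p \<in> fst c. snd c p \<in> V}"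
proof -
  have "continuous_map (subtopology T (fst c)) (top_of_set (range_of c)) (snd c)"
    using assms(1) by (simp add: is_chart_def homeomorphic_imp_continuous_map)
  moreover have "openin (top_of_set (range_of c)) (range_of c \<inter> V)"
    using assms(2) by (simp add: openin_open_Int)
  ultimately have "openin (subtopology T (fst c))
      {p \<in> topspace (subtopology T (fst c)). snd c p \<in> range_of c \<inter> V}"
    by (rule openin_continuous_map_preimage)
  moreover have "{p \<in> topspace (subtopology T (fst c)). snd c p \<in> range_of c \<inter> V} = {p \<in> fst c. snd c p \<in> V}"
    using is_chart_subset[OF assms(1)] by (auto simp: range_of_def)
  ultimately show ?thesis using assms(1) by (simp add: is_chart_def openin_open_subtopology)
qed

lemma transition_apply: "is_chart T c \<Longrightarrow> p \<in> fst c \<Longrightarrow> transition c d (snd c p) = snd d p"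
  by (simp add: transition_def)

locale surface =
  fixes T :: "'a topology" and A :: "'a chart set"
  assumes surface: "smooth_surface T A"
begin

lemma coordinate_system_chart: "coordinate_system T A c \<Longrightarrow> is_chart T c"
  by (simp add: coordinate_system_def)

lemma atlas_coordinate_system: "c \<in> A \<Longrightarrow> coordinate_system T A c"
  using surface by (auto simp: coordinate_system_def smooth_surface_def)

lemma atlas_at:
  assumes "p \<in> topspace T"
  obtains c where "c \<in> A" "coordinate_system T A c" "p \<in> fst c"
  using assms surface atlas_coordinate_system unfolding smooth_surface_def by blast

lemma open_overlap:
  assumes "coordinate_system T A c" "is_chart T d"
  shows "open (snd c ` (fst c \<inter> fst d))"
proof (rule is_chart_open_image[OF coordinate_system_chart[OF assms(1)]])
  show "openin T (fst c \<inter> fst d)"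
    using assms coordinate_system_chart[OF assms(1)] by (auto simp: is_chart_def)
qed simp

text \<open>Coordinate systems are compatible with the atlas by definition, but not with each other.
  Near each point the transition factors through an atlas chart, and smoothness is local.\<close>

lemma smooth_transition:
  assumes c: "coordinate_system T A c" and d: "coordinate_system T A d"
  shows "smooth_on (snd c ` (fst c \<inter> fst d)) (transition c d)"
proof (rule smooth_on_local)
  fix z assume "z \<in> snd c ` (fst c \<inter> fst d)"
  then obtain p where p: "p \<in> fst c" "p \<in> fst d" "z = snd c p" by blast
  note cc = coordinate_system_chart[OF c] and cd = coordinate_system_chart[OF d]
  obtain a where a: "a \<in> A" "p \<in> fst a"
    using atlas_at is_chart_subset[OF cc] p(1) by blast
  have ca: "is_chart T a" using coordinate_system_chart atlas_coordinate_system a(1) by blast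
  let ?W = "fst c \<inter> fst d \<inter> fst a"
  have oW: "openin T ?W" using cc cd ca by (auto simp: is_chart_def)
  have oN: "open (snd c ` ?W)" by (rule is_chart_open_image[OF cc oW]) blast
  have oa: "open (snd a ` (fst a \<inter> fst d))"
    by (rule open_overlap[OF atlas_coordinate_system[OF a(1)] cd])
  have "smooth_on (snd c ` (fst c \<inter> fst a)) (transition c a)"
    using c a(1) by (simp add: coordinate_system_def compatible_def)
  then have s1: "smooth_on (snd c ` ?W) (transition c a)"
    by (rule smooth_on_subset) blast
  have s2: "smooth_on (snd a ` (fst a \<inter> fst d)) (transition a d)"
    using d a(1) by (simp add: coordinate_system_def compatible_def Int_commute)
  have tr: "transition c b (snd c p) = snd b p" "transition a d (snd a p) = snd d p" if "p \<in> ?W" for b p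
    using that by (simp_all add: transition_apply[OF cc] transition_apply[OF ca])
  have "transition c a ` (snd c ` ?W) = (\<lambda>p. snd a p) ` ?W"
    unfolding image_image by (rule image_cong[OF refl]) (rule tr)
  then have "transition c a ` (snd c ` ?W) \<subseteq> snd a ` (fst a \<inter> fst d)" by blast
  from smooth_on_compose[OF s2 s1 oN oa this]
  have "smooth_on (snd c ` ?W) (transition c d)"
    by (rule smooth_on_cong[OF _ oN]) (elim imageE, simp only: tr)
  then show "\<exists>U. open U \<and> z \<in> U \<and> smooth_on U (transition c d)"
    using oN p a(2) by blast
qed

lemma transition_has_derivative:
  assumes "coordinate_system T A c" "coordinate_system T A d" "p \<in> fst c" "p \<in> fst d"
  shows "(transition c d has_derivative jacobian c d p) (at (snd c p))"
  using smooth_on_has_derivative[OF smooth_transition[OF assms(1,2)], of "snd c p"] assms(3,4)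
  by (simp add: dir_deriv_def jacobian_def)

lemma jacobian_linear:
  assumes "coordinate_system T A c" "coordinate_system T A d" "p \<in> fst c" "p \<in> fst d"
  shows "bounded_linear (jacobian c d p)"
  using has_derivative_bounded_linear[OF transition_has_derivative[OF assms]] .

lemma jacobian_cocycle:
  assumes c: "coordinate_system T A c" "p \<in> fst c" and d: "coordinate_system T A d" "p \<in> fst d"
    and e: "coordinate_system T A e" "p \<in> fst e"
  shows "jacobian d e p (jacobian c d p u) = jacobian c e p u"
proof -
  note cc = coordinate_system_chart[OF c(1)] and cd = coordinate_system_chart[OF d(1)]
    and ce = coordinate_system_chart[OF e(1)]
  let ?W = "fst c \<inter> fst d \<inter> fst e"
  have oW: "openin T ?W" using cc cd ce by (auto simp: is_chart_def)
  have oN: "open (snd c ` ?W)" by (rule is_chart_open_image[OF cc oW]) blast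
  have "(transition d e has_derivative jacobian d e p) (at (transition c d (snd c p)))"
    using transition_has_derivative[OF d(1) e(1) d(2) e(2)] by (simp add: transition_apply[OF cc c(2)])
  from diff_chain_at[OF transition_has_derivative[OF c(1) d(1) c(2) d(2)] this]
  have "(transition c e has_derivative jacobian d e p \<circ> jacobian c d p) (at (snd c p))"
  proof (rule has_derivative_transform_within_open[OF _ oN])
    show "snd c p \<in> snd c ` ?W" using c d e by blast
    show "(transition d e \<circ> transition c d) z = transition c e z" if "z \<in> snd c ` ?W" for z
      using that by (elim imageE) (simp add: transition_apply[OF cc] transition_apply[OF cd])
  qed
  then have "jacobian d e p \<circ> jacobian c d p = jacobian c e p"
    using transition_has_derivative[OF c(1) e(1) c(2) e(2)] has_derivative_unique by blast
  then show ?thesis by (metis comp_apply)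
qed

lemma jacobian_self:
  assumes c: "coordinate_system T A c" "p \<in> fst c"
  shows "jacobian c c p u = u"
proof -
  note cc = coordinate_system_chart[OF c(1)]
  have "(transition c c has_derivative (\<lambda>u. u)) (at (snd c p))"
    by (rule has_derivative_transform_within_open[OF has_derivative_ident, of "range_of c"])
      (use c cc in \<open>auto simp: is_chart_def in_range_of transition_def chart_inv_right\<close>)
  then have "jacobian c c p = (\<lambda>u. u)"
    using transition_has_derivative[OF c(1) c(1) c(2) c(2)] has_derivative_unique by blast
  then show ?thesis by simp
qed

lemma jacobian_inverse:
  assumes c: "coordinate_system T A c" "p \<in> fst c" and d: "coordinate_system T A d" "p \<in> fst d"
  shows "jacobian d c p (jacobian c d p u) = u"
  by (simp add: jacobian_cocycle[OF c d c] jacobian_self[OF c])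

section \<open>Tangent and cotangent vectors in coordinates\<close>

definition tangent_vector :: "'a \<Rightarrow> 'a chart \<Rightarrow> real \<times> real \<Rightarrow> 'a chart \<Rightarrow> real \<times> real" where
  "tangent_vector p c u = (\<lambda>d\<in>coordinate_systems_at T A p. jacobian c d p u)"

text \<open>Covectors are pulled back: the components in \<open>d\<close> are the values on the
  coordinate vectors of \<open>d\<close>, which the Jacobian from \<open>d\<close> to
  \<open>c\<close> carries to \<open>c\<close>.\<close>

definition cotangent_vector :: "'a \<Rightarrow> 'a chart \<Rightarrow> real \<times> real \<Rightarrow> 'a chart \<Rightarrow> real \<times> real" where
  "cotangent_vector p c w = (\<lambda>d\<in>coordinate_systems_at T A p.
     (w \<bullet> jacobian d c p (1, 0), w \<bullet> jacobian d c p (0, 1)))"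

lemma tangent_vector_in:
  assumes c: "coordinate_system T A c" "p \<in> fst c"
  shows "tangent_vector p c u \<in> tangent_space T A p"
  unfolding tangent_space_def
proof (intro CollectI conjI ballI)
  show "tangent_vector p c u \<in> extensional (coordinate_systems_at T A p)"
    by (simp add: tangent_vector_def)
  fix d e assume "d \<in> coordinate_systems_at T A p" "e \<in> coordinate_systems_at T A p"
  then show "tangent_vector p c u e = jacobian d e p (tangent_vector p c u d)"
    using jacobian_cocycle[OF c, of d e u] by (simp add: tangent_vector_def coordinate_systems_at_def)
qed

lemma tangent_vector_self:
  assumes c: "coordinate_system T A c" "p \<in> fst c"
  shows "tangent_vector p c u c = u"
  unfolding tangent_vector_def using c
  by (subst restrict_apply') (simp_all add: coordinate_systems_at_def jacobian_self[OF c])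

lemma tangent_space_eqI:
  assumes "v \<in> tangent_space T A p" "w \<in> tangent_space T A p" "c \<in> coordinate_systems_at T A p" "v c = w c"
  shows "v = w"
proof (rule extensionalityI)
  show "v \<in> extensional (coordinate_systems_at T A p)" "w \<in> extensional (coordinate_systems_at T A p)"
    using assms(1,2) unfolding tangent_space_def by blast+
  show "v d = w d" if "d \<in> coordinate_systems_at T A p" for d
  proof -
    have "v d = jacobian c d p (v c)" "w d = jacobian c d p (w c)"
      using assms(1-3) that unfolding tangent_space_def by blast+
    then show ?thesis by (simp only: assms(4))
  qed
qed

lemma cotangent_vector_apply:
  assumes c: "coordinate_system T A c" "p \<in> fst c" and d: "coordinate_system T A d" "p \<in> fst d"
  shows "cotangent_vector p c w d \<bullet> u = w \<bullet> jacobian d c p u"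
proof -
  interpret bounded_linear "jacobian d c p" by (rule jacobian_linear[OF d(1) c(1) d(2) c(2)])
  have "u = fst u *\<^sub>R (1, 0) + snd u *\<^sub>R (0, 1)" by (simp add: prod_eq_iff)
  then have "jacobian d c p u = fst u *\<^sub>R jacobian d c p (1, 0) + snd u *\<^sub>R jacobian d c p (0, 1)"
    by (metis add scaleR)
  then show ?thesis
    using d by (simp add: cotangent_vector_def coordinate_systems_at_def inner_add_right inner_prod_def[of _ u]
        mult.commute)
qed

lemma cotangent_vector_in:
  assumes c: "coordinate_system T A c" "p \<in> fst c"
  shows "cotangent_vector p c w \<in> cotangent_space T A p"
proof -
  show ?thesis
    unfolding cotangent_space_def
  proof (intro CollectI conjI ballI allI)
    show "cotangent_vector p c w \<in> extensional (coordinate_systems_at T A p)"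
      by (simp add: cotangent_vector_def)
    fix d e u assume "d \<in> coordinate_systems_at T A p" "e \<in> coordinate_systems_at T A p"
    then have that: "coordinate_system T A d" "p \<in> fst d" "coordinate_system T A e" "p \<in> fst e"
      by (simp_all add: coordinate_systems_at_def)
    show "cotangent_vector p c w d \<bullet> u = cotangent_vector p c w e \<bullet> jacobian d e p u"
      by (simp add: cotangent_vector_apply[OF c that(1,2)] cotangent_vector_apply[OF c that(3,4)]
          jacobian_cocycle[OF that c])
  qed
qed

lemma cotangent_vector_self:
  assumes c: "coordinate_system T A c" "p \<in> fst c"
  shows "cotangent_vector p c w c = w"
  using cotangent_vector_apply[OF c c] jacobian_self[OF c] by (metis vector_eq_rdot)

lemma cotangent_space_eqI:
  assumes "v \<in> cotangent_space T A p" "w \<in> cotangent_space T A p" "c \<in> coordinate_systems_at T A p" "v c = w c"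
  shows "v = w"
proof (rule extensionalityI)
  show "v \<in> extensional (coordinate_systems_at T A p)" "w \<in> extensional (coordinate_systems_at T A p)"
    using assms(1,2) unfolding cotangent_space_def by blast+
  show "v d = w d" if d: "d \<in> coordinate_systems_at T A p" for d
  proof -
    have "v d \<bullet> u = v c \<bullet> jacobian d c p u" "w d \<bullet> u = w c \<bullet> jacobian d c p u" for u
      using assms(1-3) d unfolding cotangent_space_def by blast+
    then have "v d \<bullet> u = w d \<bullet> u" for u by (simp only: assms(4))
    then show ?thesis by (metis vector_eq_rdot)
  qed
qed

text \<open>The expression in coordinates is defined through \<open>inv_into\<close>; it is
  determined because a bundle point over the chart is recovered from its position and its components
  in that single chart.\<close>

lemma in_tangent_coords_apply:
  assumes c: "coordinate_system T A c" "p \<in> fst c"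
  shows "in_tangent_coords T A c g (snd c p, u) = g (p, tangent_vector p c u)"
proof -
  have "inj_on (bundle_coords c) (tangent_bundle_on T A (fst c))"
  proof (rule inj_onI)
    fix x y assume x: "x \<in> tangent_bundle_on T A (fst c)" and y: "y \<in> tangent_bundle_on T A (fst c)"
      and eq: "bundle_coords c x = bundle_coords c y"
    obtain q v r w where xy: "x = (q, v)" "y = (r, w)" by (metis surj_pair)
    have qr: "q \<in> fst c" "v \<in> tangent_space T A q" "r \<in> fst c" "w \<in> tangent_space T A r"
      "snd c q = snd c r" "v c = w c"
      using x y eq by (auto simp: tangent_bundle_on_def bundle_coords_def xy)
    have "q = r" using is_chart_inj[OF coordinate_system_chart[OF c(1)]] qr by (auto dest: inj_onD)
    moreover have "v = w"
      by (rule tangent_space_eqI[of _ q _ c]) (use qr \<open>q = r\<close> c in \<open>auto simp: coordinate_systems_at_def\<close>)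
    ultimately show "x = y" by (simp add: xy)
  qed
  moreover have "(p, tangent_vector p c u) \<in> tangent_bundle_on T A (fst c)"
    using c tangent_vector_in[OF c] by (simp add: tangent_bundle_on_def)
  moreover have "bundle_coords c (p, tangent_vector p c u) = (snd c p, u)"
    by (simp add: bundle_coords_def tangent_vector_self[OF c])
  ultimately show ?thesis unfolding in_tangent_coords_def by (metis comp_apply inv_into_f_f)
qed

lemma in_canonical_coords_apply:
  assumes c: "coordinate_system T A c" "p \<in> fst c"
  shows "in_canonical_coords T A c F (snd c p, w) = F (p, cotangent_vector p c w)"
proof -
  have "inj_on (bundle_coords c) (cotangent_bundle_on T A (fst c))"
  proof (rule inj_onI)
    fix x y assume x: "x \<in> cotangent_bundle_on T A (fst c)" and y: "y \<in> cotangent_bundle_on T A (fst c)"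
      and eq: "bundle_coords c x = bundle_coords c y"
    obtain q v r w where xy: "x = (q, v)" "y = (r, w)" by (metis surj_pair)
    have qr: "q \<in> fst c" "v \<in> cotangent_space T A q" "r \<in> fst c" "w \<in> cotangent_space T A r"
      "snd c q = snd c r" "v c = w c"
      using x y eq by (auto simp: cotangent_bundle_on_def bundle_coords_def xy)
    have "q = r" using is_chart_inj[OF coordinate_system_chart[OF c(1)]] qr by (auto dest: inj_onD)
    moreover have "v = w"
      by (rule cotangent_space_eqI[of _ q _ c]) (use qr \<open>q = r\<close> c in \<open>auto simp: coordinate_systems_at_def\<close>)
    ultimately show "x = y" by (simp add: xy)
  qed
  moreover have "(p, cotangent_vector p c w) \<in> cotangent_bundle_on T A (fst c)"
    using c cotangent_vector_in[OF c] by (simp add: cotangent_bundle_on_def)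
  moreover have "bundle_coords c (p, cotangent_vector p c w) = (snd c p, w)"
    by (simp add: bundle_coords_def cotangent_vector_self[OF c])
  ultimately show ?thesis unfolding in_canonical_coords_def by (metis comp_apply inv_into_f_f)
qed

lemma in_tangent_coords_change:
  assumes c: "coordinate_system T A c" "p \<in> fst c" and d: "coordinate_system T A d" "p \<in> fst d"
  shows "in_tangent_coords T A d g (snd d p, jacobian c d p u) = in_tangent_coords T A c g (snd c p, u)"
proof -
  have "tangent_vector p d (jacobian c d p u) = tangent_vector p c u"
    by (rule tangent_space_eqI[OF tangent_vector_in[OF d] tangent_vector_in[OF c], of d])
      (use d in \<open>simp_all add: jacobian_self[OF d] coordinate_systems_at_def tangent_vector_def\<close>)
  then show ?thesis by (simp add: in_tangent_coords_apply[OF c] in_tangent_coords_apply[OF d])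
qed

lemma in_canonical_coords_change:
  assumes c: "coordinate_system T A c" "p \<in> fst c" and d: "coordinate_system T A d" "p \<in> fst d"
    and w: "\<And>u. w \<bullet> u = w' \<bullet> jacobian c d p u"
  shows "in_canonical_coords T A d F (snd d p, w') = in_canonical_coords T A c F (snd c p, w)"
proof -
  have "cotangent_vector p d w' c = w"
    using cotangent_vector_apply[OF d c] w by (metis vector_eq_rdot)
  then have "cotangent_vector p d w' = cotangent_vector p c w"
    by (intro cotangent_space_eqI[OF cotangent_vector_in[OF d] cotangent_vector_in[OF c], of c])
      (use c in \<open>simp_all add: cotangent_vector_self[OF c] coordinate_systems_at_def\<close>)
  then show ?thesis by (simp add: in_canonical_coords_apply[OF c] in_canonical_coords_apply[OF d])
qed

end

text \<open>Numerator and denominator both acquire the square of the determinant of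
  \<open>L\<close>, which is nonzero because \<open>L\<close> has a left inverse.\<close>

lemma half_inverse_form_invariant:
  fixes L :: "real \<times> real \<Rightarrow> real \<times> real"
  assumes L: "bounded_linear L" "\<And>u. L' (L u) = u"
    and Q: "\<And>x y. Q (x, y) = g11 * x\<^sup>2 + 2 * g12 * x * y + g22 * y\<^sup>2"
    and w: "\<And>u. w0 \<bullet> u = w \<bullet> L u"
  shows "half_inverse_form (\<lambda>u. Q (L u)) w0 = half_inverse_form Q w"
proof -
  interpret bounded_linear L by (rule L(1))
  obtain a c where e1: "L (1, 0) = (a, c)" by force
  obtain b d where e2: "L (0, 1) = (b, d)" by force
  obtain w1 w2 where w12: "w = (w1, w2)" by force
  have Lxy: "L (x, y) = (a * x + b * y, c * x + d * y)" for x y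
  proof -
    have "L (x, y) = L (x *\<^sub>R (1, 0) + y *\<^sub>R (0, 1))" by simp
    also have "\<dots> = x *\<^sub>R (a, c) + y *\<^sub>R (b, d)" by (simp only: add scaleR e1 e2)
    finally show ?thesis by (simp add: mult.commute)
  qed
  define D where "D = a * d - b * c"
  \<comment> \<open>For \<open>D = 0\<close> the columns of the adjugate matrix are mapped to 0.
    Injectivity makes all entries vanish, and then \<open>L\<close> is not injective.\<close>
  have "D \<noteq> 0"
  proof
    assume "D = 0"
    then have "L (d, - c) = L (0, 0)" "L (- b, a) = L (0, 0)"
      by (simp_all add: Lxy D_def mult.commute)
    then have "(d, - c) = (0, 0)" "(- b, a) = (0, 0)" using L(2) by metis+
    then have "L (1, 0) = L (0, 0)" by (simp add: Lxy)
    then show False using L(2) by (metis prod.inject zero_neq_one)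
  qed
  have w0: "w0 = (w1 * a + w2 * c, w1 * b + w2 * d)"
    using w[of "(1, 0)"] w[of "(0, 1)"] by (simp add: prod_eq_iff inner_prod_def[of w0] w12 e1 e2)
  define G11 where "G11 = g11 * a\<^sup>2 + 2 * g12 * a * c + g22 * c\<^sup>2"
  define G12 where "G12 = g11 * a * b + g12 * (a * d + b * c) + g22 * c * d"
  define G22 where "G22 = g11 * b\<^sup>2 + 2 * g12 * b * d + g22 * d\<^sup>2"
  have half: "half_inverse_form R (x, y) = (r22 * x\<^sup>2 - 2 * r12 * x * y + r11 * y\<^sup>2) / (r11 * r22 - r12\<^sup>2) / 2"
    if "\<And>x y. R (x, y) = r11 * x\<^sup>2 + 2 * r12 * x * y + r22 * y\<^sup>2" for R r11 r12 r22 x y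
    by (simp add: half_inverse_form_def that Let_def)
  have QL: "Q (L (x, y)) = G11 * x\<^sup>2 + 2 * G12 * x * y + G22 * y\<^sup>2" for x y
    by (simp add: Lxy Q G11_def G12_def G22_def algebra_simps power2_eq_square)
  have num: "G22 * (w1 * a + w2 * c)\<^sup>2 - 2 * G12 * (w1 * a + w2 * c) * (w1 * b + w2 * d) + G11 * (w1 * b + w2 * d)\<^sup>2 =
      D\<^sup>2 * (g22 * w1\<^sup>2 - 2 * g12 * w1 * w2 + g11 * w2\<^sup>2)"
    by (simp add: D_def G11_def G12_def G22_def algebra_simps power2_eq_square)
  have den: "G11 * G22 - G12\<^sup>2 = D\<^sup>2 * (g11 * g22 - g12\<^sup>2)"
    by (simp add: D_def G11_def G12_def G22_def algebra_simps power2_eq_square)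
  show ?thesis
    unfolding w12 w0 half[where R = Q, OF Q] half[where R = "\<lambda>u. Q (L u)", OF QL] num den
    using \<open>D \<noteq> 0\<close> by simp
qed

context surface
begin

text \<open>The energy is computed in an arbitrary chosen coordinate system; invariance under the
  linear change from that system allows computing it in \<open>c\<close>.\<close>

lemma kinetic_energy_coords:
  assumes g: "pseudo_riemannian_metric T A g" and c: "coordinate_system T A c" "p \<in> fst c"
  shows "in_canonical_coords T A c (kinetic_energy T A g) (snd c p, w) =
    half_inverse_form (\<lambda>u. in_tangent_coords T A c g (snd c p, u)) w"
proof -
  define b where "b = (SOME b. b \<in> coordinate_systems_at T A p)"
  have "c \<in> coordinate_systems_at T A p" using c by (simp add: coordinate_systems_at_def)
  then have "b \<in> coordinate_systems_at T A p" unfolding b_def by (rule someI)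
  then have b: "coordinate_system T A b" "p \<in> fst b" by (simp_all add: coordinate_systems_at_def)
  obtain g11 g12 g22 where Q: "\<And>dx dy. in_tangent_coords T A c g (snd c p, (dx, dy)) =
      g11 * dx\<^sup>2 + 2 * g12 * dx * dy + g22 * dy\<^sup>2"
    using g c in_range_of[OF c(2)] unfolding pseudo_riemannian_metric_def by metis
  have "in_canonical_coords T A c (kinetic_energy T A g) (snd c p, w) =
      half_inverse_form (\<lambda>u. in_tangent_coords T A b g (snd b p, u)) (cotangent_vector p c w b)"
    by (simp add: in_canonical_coords_apply[OF c] kinetic_energy_def b_def Let_def)
  also have "(\<lambda>u. in_tangent_coords T A b g (snd b p, u)) =
      (\<lambda>u. in_tangent_coords T A c g (snd c p, jacobian b c p u))"
    by (simp add: in_tangent_coords_change[OF b c])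
  also have "half_inverse_form \<dots> (cotangent_vector p c w b) =
      half_inverse_form (\<lambda>u. in_tangent_coords T A c g (snd c p, u)) w"
    by (rule half_inverse_form_invariant[where Q = "\<lambda>u. in_tangent_coords T A c g (snd c p, u)"
          and L' = "jacobian c b p", OF jacobian_linear[OF b(1) c(1) b(2) c(2)] jacobian_inverse[OF b c] Q])
      (rule cotangent_vector_apply[OF c b])
  finally show ?thesis .
qed

text \<open>The restriction of \<open>c\<close> to the preimage of \<open>V\<close>, followed by
  \<open>\<psi>\<close>. Since \<open>\<Phi>\<close> is the transition from \<open>d\<close> back to
  \<open>c\<close>, its derivative is the Jacobian; compatibility with the atlas is inherited
  through \<open>c\<close>.\<close>

lemma changed_coordinate_system:
  assumes c: "coordinate_system T A c" and ch: "coordinate_change V D \<psi> \<Phi>" and V: "V \<subseteq> range_of c"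
  defines "d \<equiv> ({p \<in> fst c. snd c p \<in> V}, \<psi> \<circ> snd c)"
  shows "coordinate_system T A d" "range_of d = D"
    "\<And>p. p \<in> fst d \<Longrightarrow> \<Phi> (snd d p) = snd c p"
    "\<And>p. p \<in> fst d \<Longrightarrow> (\<Phi> has_derivative jacobian d c p) (at (snd d p))"
proof -
  note cc = coordinate_system_chart[OF c]
  have oV: "open V" and oD: "open D" and \<psi>V: "\<psi> ` V = D" and \<Phi>D: "\<Phi> ` D = V"
    and \<Phi>\<psi>: "\<And>q. q \<in> V \<Longrightarrow> \<Phi> (\<psi> q) = q" and \<psi>\<Phi>: "\<And>z. z \<in> D \<Longrightarrow> \<psi> (\<Phi> z) = z"
    and sm: "smooth_on V \<psi>" "smooth_on D \<Phi>"
    using ch unfolding coordinate_change_def by blast+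
  have fd: "fst d = {p \<in> fst c. snd c p \<in> V}" and sd: "snd d = (\<lambda>p. \<psi> (snd c p))"
    by (simp_all add: d_def o_def)
  have sub: "fst d \<subseteq> fst c" by (auto simp: fd)
  have imV: "snd c ` fst d = V"
  proof
    show "V \<subseteq> snd c ` fst d"
    proof
      fix q assume q: "q \<in> V"
      then have "q = snd c (chart_inv c q)" "chart_inv c q \<in> fst c"
        using V chart_inv_right chart_inv_in by (metis subsetD)+
      then show "q \<in> snd c ` fst d" using q by (intro image_eqI[of _ _ "chart_inv c q"]) (simp_all add: fd)
    qed
  qed (auto simp: fd)
  have "range_of d = \<psi> ` snd c ` fst d" by (simp add: range_of_def sd image_image)
  then show range: "range_of d = D" by (simp only: imV \<psi>V)
  show inv: "\<Phi> (snd d p) = snd c p" if "p \<in> fst d" for p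
    using that \<Phi>\<psi> by (simp add: fd sd)
  have od: "openin T (fst d)" unfolding fd by (rule is_chart_open_preimage[OF cc oV])
  have cd: "is_chart T d"
    unfolding is_chart_def
  proof (intro conjI od)
    show "open (range_of d)" by (simp add: range oD)
    have "snd c ` (topspace (subtopology T (fst c)) \<inter> fst d) = topspace (top_of_set (range_of c)) \<inter> V"
    proof -
      have "topspace (subtopology T (fst c)) \<inter> fst d = fst d"
        using sub is_chart_subset[OF cc] by auto
      then show ?thesis using imV V by auto
    qed
    moreover have "homeomorphic_map (subtopology T (fst c)) (top_of_set (range_of c)) (snd c)"
      using cc by (simp add: is_chart_def)
    ultimately have "homeomorphic_map (subtopology (subtopology T (fst c)) (fst d))
        (subtopology (top_of_set (range_of c)) V) (snd c)"
      by (rule homeomorphic_map_subtopologies[rotated])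
    moreover have "subtopology (subtopology T (fst c)) (fst d) = subtopology T (fst d)"
      using sub by (simp add: subtopology_subtopology inf_absorb2)
    moreover have "subtopology (top_of_set (range_of c)) V = top_of_set V"
      using V by (simp add: subtopology_subtopology inf_absorb2)
    ultimately have h1: "homeomorphic_map (subtopology T (fst d)) (top_of_set V) (snd c)" by simp
    have "homeomorphic_maps (top_of_set V) (top_of_set D) \<psi> \<Phi>"
      unfolding homeomorphic_maps_def
      using \<psi>V \<Phi>D \<Phi>\<psi> \<psi>\<Phi> smooth_on_continuous[OF sm(1)] smooth_on_continuous[OF sm(2)]
      by (auto simp: continuous_map_in_subtopology)
    then have "homeomorphic_map (top_of_set V) (top_of_set D) \<psi>" using homeomorphic_map_maps by blast
    from homeomorphic_map_compose[OF h1 this]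
    show "homeomorphic_map (subtopology T (fst d)) (top_of_set (range_of d)) (snd d)"
      by (simp add: range sd o_def)
  qed
  have trd: "transition d b (snd d p) = transition c b (\<Phi> (snd d p))" if "p \<in> fst d" for b p
  proof -
    have "p \<in> fst c" using that sub by blast
    then show ?thesis by (simp only: transition_apply[OF cd that] inv[OF that] transition_apply[OF cc])
  qed
  have compat: "compatible d b" if b: "b \<in> A" for b
    unfolding compatible_def
  proof
    note bs = atlas_coordinate_system[OF b] and cb = coordinate_system_chart[OF atlas_coordinate_system[OF b]]
    have oW: "openin T (fst d \<inter> fst b)" using od cb by (auto simp: is_chart_def)
    have o1: "open (snd d ` (fst d \<inter> fst b))" by (rule is_chart_open_image[OF cd oW]) blast
    have o2: "open (snd b ` (fst d \<inter> fst b))" by (rule is_chart_open_image[OF cb oW]) blast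
    have o3: "open (snd c ` (fst c \<inter> fst b))" by (rule open_overlap[OF c cb])
    have "snd d ` (fst d \<inter> fst b) \<subseteq> D" using range by (auto simp: range_of_def)
    then have s: "smooth_on (snd d ` (fst d \<inter> fst b)) \<Phi>" by (rule smooth_on_subset[OF sm(2)])
    have "\<Phi> ` snd d ` (fst d \<inter> fst b) = snd c ` (fst d \<inter> fst b)"
      unfolding image_image by (rule image_cong[OF refl]) (simp add: inv)
    then have "\<Phi> ` snd d ` (fst d \<inter> fst b) \<subseteq> snd c ` (fst c \<inter> fst b)" using sub by blast
    from smooth_on_compose[OF smooth_transition[OF c bs] s o1 o3 this]
    show "smooth_on (snd d ` (fst d \<inter> fst b)) (transition d b)"
      by (rule smooth_on_cong[OF _ o1]) (elim imageE IntE, simp only: trd)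
    have "snd b ` (fst d \<inter> fst b) \<subseteq> snd b ` (fst b \<inter> fst c)" using sub by blast
    then have s2: "smooth_on (snd b ` (fst d \<inter> fst b)) (transition b c)"
      by (rule smooth_on_subset[OF smooth_transition[OF bs c]])
    have tr: "transition b e (snd b p) = snd e p" if "p \<in> fst d \<inter> fst b" for e p
      using that by (simp add: transition_apply[OF cb])
    have "transition b c ` snd b ` (fst d \<inter> fst b) = snd c ` (fst d \<inter> fst b)"
      unfolding image_image by (rule image_cong[OF refl]) (rule tr)
    then have "transition b c ` snd b ` (fst d \<inter> fst b) \<subseteq> V" using imV by blast
    from smooth_on_compose[OF sm(1) s2 o2 oV this]
    show "smooth_on (snd b ` (fst d \<inter> fst b)) (transition b d)"
      by (rule smooth_on_cong[OF _ o2]) (elim imageE, simp only: tr sd)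
  qed
  then show ds: "coordinate_system T A d" using cd by (simp add: coordinate_system_def)
  show "(\<Phi> has_derivative jacobian d c p) (at (snd d p))" if p: "p \<in> fst d" for p
  proof (rule has_derivative_transform_within_open)
    show "(transition d c has_derivative jacobian d c p) (at (snd d p))"
      using transition_has_derivative[OF ds c p] p sub by blast
    show "open D" "snd d p \<in> D" using oD in_range_of[OF p] range by simp_all
    show "transition d c z = \<Phi> z" if "z \<in> D" for z
    proof -
      obtain r where r: "r \<in> fst d" "z = snd d r" using \<open>z \<in> D\<close> unfolding range[symmetric] range_of_def by blast
      have "r \<in> fst c" using r(1) sub by blast
      then show ?thesis by (simp only: r(2) trd[OF r(1)] inv[OF r(1)] transition_apply[OF cc])
    qed
  qed
qed

lemma coordinates_local_integral:
  assumes g: "pseudo_riemannian_metric T A g" and F: "geodesic_integral T A g F" and c: "coordinate_system T A c"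
  shows "local_integral (range_of c) (in_tangent_coords T A c g)
    (in_canonical_coords T A c (kinetic_energy T A g)) (in_canonical_coords T A c F)"
proof
  show "open (range_of c)" using coordinate_system_chart[OF c] by (simp add: is_chart_def)
  fix q assume q: "q \<in> range_of c"
  show "\<exists>g11 g12 g22. g11 * g22 - g12\<^sup>2 \<noteq> 0 \<and>
      (\<forall>dx dy. in_tangent_coords T A c g (q, (dx, dy)) = g11 * dx\<^sup>2 + 2 * g12 * dx * dy + g22 * dy\<^sup>2)"
    using g c q unfolding pseudo_riemannian_metric_def by metis
  fix p
  show "in_canonical_coords T A c (kinetic_energy T A g) (q, p) =
      half_inverse_form (\<lambda>u. in_tangent_coords T A c g (q, u)) p"
    using kinetic_energy_coords[OF g c chart_inv_in[OF q]] by (simp add: chart_inv_right[OF q])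
  show "poisson_bracket (in_canonical_coords T A c (kinetic_energy T A g)) (in_canonical_coords T A c F) (q, p) = 0"
    using F c q unfolding geodesic_integral_def by blast
qed

lemma kinetic_energy_frame_form:
  assumes g: "pseudo_riemannian_metric T A g" and c: "coordinate_system T A c"
  obtains h11 h12 h22 where "smooth_on (range_of c) h11" "smooth_on (range_of c) h12" "smooth_on (range_of c) h22"
    "\<And>q. q \<in> range_of c \<Longrightarrow> 4 * h11 q * h22 q - (h12 q)\<^sup>2 \<noteq> 0"
    "\<And>q p. q \<in> range_of c \<Longrightarrow>
      in_canonical_coords T A c (kinetic_energy T A g) (q, p) = frame_form e_x e_y h11 h12 h22 (q, p)"
proof -
  obtain g11 g12 g22 where sm: "smooth_on (range_of c) g11" "smooth_on (range_of c) g12" "smooth_on (range_of c) g22"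
    and gr: "\<forall>q\<in>range_of c. g11 q * g22 q - (g12 q)\<^sup>2 \<noteq> 0 \<and>
      (\<forall>dx dy. in_tangent_coords T A c g (q, (dx, dy)) = g11 q * dx\<^sup>2 + 2 * g12 q * dx * dy + g22 q * dy\<^sup>2)"
    using g c unfolding pseudo_riemannian_metric_def by blast
  have oR: "open (range_of c)" using coordinate_system_chart[OF c] by (simp add: is_chart_def)
  define \<Delta> where "\<Delta> q = g11 q * g22 q - (g12 q)\<^sup>2" for q
  have \<Delta>: "\<Delta> q \<noteq> 0" if "q \<in> range_of c" for q using gr that by (simp add: \<Delta>_def)
  have sm\<Delta>: "smooth_on (range_of c) \<Delta>" unfolding \<Delta>_def by (intro smooth_intros oR sm)
  show thesis
  proof (rule that)
    show "smooth_on (range_of c) (\<lambda>q. g22 q / (2 * \<Delta> q))" "smooth_on (range_of c) (\<lambda>q. - (g12 q / \<Delta> q))"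
      "smooth_on (range_of c) (\<lambda>q. g11 q / (2 * \<Delta> q))"
      by (intro smooth_intros oR sm sm\<Delta>; simp add: \<Delta>)+
    fix q assume q: "q \<in> range_of c"
    have "4 * (g22 q / (2 * \<Delta> q)) * (g11 q / (2 * \<Delta> q)) - (- (g12 q / \<Delta> q))\<^sup>2 = \<Delta> q / (\<Delta> q)\<^sup>2"
    proof -
      have "4 * (x / (2 * D)) * (y / (2 * D)) - (- (z / D))\<^sup>2 = (y * x - z\<^sup>2) / D\<^sup>2" for x y z D :: real
        by (simp add: power2_eq_square diff_divide_distrib mult.commute)
      then show ?thesis by (simp only: \<Delta>_def[of q, symmetric])
    qed
    then show "4 * (g22 q / (2 * \<Delta> q)) * (g11 q / (2 * \<Delta> q)) - (- (g12 q / \<Delta> q))\<^sup>2 \<noteq> 0"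
      using \<Delta>[OF q] by simp
    fix p :: "real \<times> real"
    obtain x y where p: "p = (x, y)" by force
    have "in_canonical_coords T A c (kinetic_energy T A g) (q, p) =
        half_inverse_form (\<lambda>u. in_tangent_coords T A c g (q, u)) p"
      using kinetic_energy_coords[OF g c chart_inv_in[OF q]] by (simp add: chart_inv_right[OF q])
    also have "\<dots> = (g22 q * x\<^sup>2 - 2 * g12 q * x * y + g11 q * y\<^sup>2) / \<Delta> q / 2"
      using gr q by (simp add: half_inverse_form_def p \<Delta>_def Let_def)
    also have "\<dots> = frame_form e_x e_y (\<lambda>q. g22 q / (2 * \<Delta> q)) (\<lambda>q. - (g12 q / \<Delta> q)) (\<lambda>q. g11 q / (2 * \<Delta> q)) (q, p)"
      by (simp add: frame_form_def p add_divide_distrib diff_divide_distrib mult.commute)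
    finally show "in_canonical_coords T A c (kinetic_energy T A g) (q, p) =
      frame_form e_x e_y (\<lambda>q. g22 q / (2 * \<Delta> q)) (\<lambda>q. - (g12 q / \<Delta> q)) (\<lambda>q. g11 q / (2 * \<Delta> q)) (q, p)" .
  qed
qed

lemma quadratic_frame_form:
  assumes F: "quadratic_in_momenta T A F" and c: "coordinate_system T A c"
  obtains a b e where "smooth_on (range_of c) a" "smooth_on (range_of c) b" "smooth_on (range_of c) e"
    "\<And>q p. q \<in> range_of c \<Longrightarrow> in_canonical_coords T A c F (q, p) = frame_form e_x e_y a b e (q, p)"
proof -
  obtain a b e where sm: "smooth_on (range_of c) a" "smooth_on (range_of c) b" "smooth_on (range_of c) e"
    and F': "\<forall>q\<in>range_of c. \<forall>px py. in_canonical_coords T A c F (q, (px, py)) =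
           a q * px\<^sup>2 + b q * px * py + e q * py\<^sup>2"
    using F c unfolding quadratic_in_momenta_def by blast
  have "in_canonical_coords T A c F (q, p) = frame_form e_x e_y a b e (q, p)" if "q \<in> range_of c" for q p
    using F' that by (cases p) (simp add: frame_form_def)
  with sm show thesis by (rule that)
qed

end

lemma normal_form_cong:
  assumes "\<And>z u. z \<in> D \<Longrightarrow> G (z, u) = G' (z, u)" "\<And>z p. z \<in> D \<Longrightarrow> f (z, p) = f' (z, p)"
  shows "normal_form D G f \<longleftrightarrow> normal_form D G' f'"
proof -
  have l: "liouville_form \<epsilon> D G (\<lambda>z. \<sigma> * f z) \<longleftrightarrow> liouville_form \<epsilon> D G' (\<lambda>z. \<sigma> * f' z)" for \<epsilon> \<sigma>
    unfolding liouville_form_def by (intro ex_cong1 conj_cong refl ball_cong) (auto simp: assms split: prod.splits)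
  have c: "complex_liouville_form D G f \<longleftrightarrow> complex_liouville_form D G' f'"
    unfolding complex_liouville_form_def by (intro ex_cong1 conj_cong refl ball_cong) (auto simp: assms split: prod.splits)
  have j: "jordan_block_form D G (\<lambda>z. \<sigma> * f z) \<longleftrightarrow> jordan_block_form D G' (\<lambda>z. \<sigma> * f' z)" for \<sigma>
    unfolding jordan_block_form_def by (intro ex_cong1 conj_cong refl ball_cong) (auto simp: assms split: prod.splits)
  show ?thesis unfolding normal_form_def using l[of 1 1] l j c by simp
qed

lemma normal_form_in_iff:
  "normal_form_in T A c g F \<longleftrightarrow>
     normal_form (range_of c) (in_tangent_coords T A c g) (in_canonical_coords T A c F)"
  by (simp add: normal_form_in_def normal_form_def Let_def)

context surface
begin

text \<open>Because \<open>\<Phi>\<close> straightens the frame, the Jacobian from the new system to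
  \<open>c\<close> has the frame vectors as columns. Hence \<open>pull_metric\<close> and
  \<open>pull_form\<close> are the expressions of \<open>g\<close> and \<open>F\<close> in the new
  system.\<close>

lemma normal_form_coordinate_system:
  assumes c: "coordinate_system T A c" and "U \<subseteq> range_of c"
    and "admits_coordinates normal_form U (in_tangent_coords T A c g) (in_canonical_coords T A c F)"
  obtains d where "coordinate_system T A d" "fst d \<noteq> {}" "fst d \<subseteq> fst c" "snd c ` fst d \<subseteq> U"
    "normal_form_in T A d g F"
proof -
  let ?G = "in_tangent_coords T A c g" and ?F = "in_canonical_coords T A c F"
  obtain V D \<psi> \<Phi> e1 e2 where V: "V \<noteq> {}" "V \<subseteq> U" and ch: "coordinate_change V D \<psi> \<Phi>"
    and frame: "\<And>q. q \<in> V \<Longrightarrow> frame_at (e1 q) (e2 q)" and st: "straightens D \<Phi> e1 e2"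
    and nf: "normal_form D (pull_metric ?G \<Phi> e1 e2) (pull_form ?F \<Phi> e1 e2)"
    using assms(3) unfolding admits_coordinates_def by blast
  have VR: "V \<subseteq> range_of c" using V assms(2) by blast
  define d where "d = ({p \<in> fst c. snd c p \<in> V}, \<psi> \<circ> snd c)"
  note d = changed_coordinate_system[OF c ch VR, folded d_def]
  have dc: "fst d \<subseteq> fst c" and dV: "snd c ` fst d \<subseteq> V" by (auto simp: d_def)
  obtain q where q: "q \<in> V" using V(1) by blast
  then have "chart_inv c q \<in> fst d"
    using VR chart_inv_in chart_inv_right by (fastforce simp: d_def)
  then have ne: "fst d \<noteq> {}" by blast
  have jac: "jacobian d c p u = fst u *\<^sub>R e1 (\<Phi> (snd d p)) + snd u *\<^sub>R e2 (\<Phi> (snd d p))" if p: "p \<in> fst d" for p u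
  proof -
    have "snd d p \<in> D" using in_range_of[OF p] d(2) by simp
    then have "(\<Phi> has_derivative (\<lambda>v. fst v *\<^sub>R e1 (\<Phi> (snd d p)) + snd v *\<^sub>R e2 (\<Phi> (snd d p)))) (at (snd d p))"
      using st by (simp add: straightens_def)
    then have "jacobian d c p = (\<lambda>v. fst v *\<^sub>R e1 (\<Phi> (snd d p)) + snd v *\<^sub>R e2 (\<Phi> (snd d p)))"
      using d(4)[OF p] has_derivative_unique by blast
    then show ?thesis by simp
  qed
  have "normal_form_in T A d g F"
    unfolding normal_form_in_iff d(2)
  proof (rule normal_form_cong[THEN iffD1, OF _ _ nf])
    fix z assume "z \<in> D"
    then obtain p where p: "p \<in> fst d" "z = snd d p" unfolding d(2)[symmetric] range_of_def by blast
    have pc: "p \<in> fst c" using p dc by blast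
    show "pull_metric ?G \<Phi> e1 e2 (z, u) = in_tangent_coords T A d g (z, u)" for u
      using in_tangent_coords_change[OF d(1) p(1) c pc, of g u] jac[OF p(1)] d(3)[OF p(1)]
      by (simp add: pull_metric_def p(2))
    have fr: "frame_at (e1 (\<Phi> z)) (e2 (\<Phi> z))"
    proof -
      have "\<Phi> z \<in> V" using d(3)[OF p(1)] dV p by auto
      then show ?thesis by (rule frame)
    qed
    fix w
    have "w \<bullet> u = dual_covector (e1 (\<Phi> z)) (e2 (\<Phi> z)) w \<bullet> jacobian d c p u" for u
      by (simp add: jac[OF p(1)] p(2)[symmetric] inner_add_right dual_covector_inner[OF fr] inner_prod_def[of w u] mult.commute)
    from in_canonical_coords_change[OF d(1) p(1) c pc this, of F]
    show "pull_form ?F \<Phi> e1 e2 (z, w) = in_canonical_coords T A d F (z, w)"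
      using d(3)[OF p(1)] by (simp add: pull_form_def p(2))
  qed
  moreover have "snd c ` fst d \<subseteq> U" using dV V(2) by blast
  ultimately show thesis using that d(1) ne dc by blast
qed

end

section \<open>From local to global proportionality\<close>

lemma poisson_bracket_diff_scale:
  assumes "F differentiable at z" "H differentiable at z"
  shows "poisson_bracket H (\<lambda>z. F z - k * H z) z = poisson_bracket H F z"
proof -
  have "((\<lambda>z. F z - k * H z) has_derivative
      (\<lambda>v. frechet_derivative F (at z) v - k * frechet_derivative H (at z) v)) (at z)"
    using assms by (intro has_derivative_diff has_derivative_mult_right) (simp_all add: frechet_derivative_works)
  note fd = frechet_derivative_at[OF this, symmetric]
  show ?thesis unfolding poisson_bracket_def Let_def fd by (simp add: algebra_simps)
qed

context surface
begin

text \<open>The difference \<open>F - k H\<close> is again a quadratic integral because the bracket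
  of \<open>H\<close> with itself vanishes; unique continuation applies to its coefficients
  \<open>a'\<close>, \<open>b'\<close>, \<open>e'\<close>.\<close>

lemma integral_minus_energy_unique_continuation:
  assumes g: "pseudo_riemannian_metric T A g" and q: "quadratic_in_momenta T A F"
    and i: "geodesic_integral T A g F" and c: "coordinate_system T A c"
    and S: "open S" "convex S" "S \<subseteq> range_of c" and U: "open U" "U \<noteq> {}" "U \<subseteq> S"
    and zero: "\<And>z w. z \<in> U \<Longrightarrow>
      in_canonical_coords T A c F (z, w) = k * in_canonical_coords T A c (kinetic_energy T A g) (z, w)"
    and z: "z \<in> S"
  shows "in_canonical_coords T A c F (z, w) = k * in_canonical_coords T A c (kinetic_energy T A g) (z, w)"
proof -
  let ?K = "in_canonical_coords T A c (kinetic_energy T A g)" and ?F = "in_canonical_coords T A c F"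
  obtain h11 h12 h22 where h: "smooth_on (range_of c) h11" "smooth_on (range_of c) h12" "smooth_on (range_of c) h22"
    "\<And>q. q \<in> range_of c \<Longrightarrow> 4 * h11 q * h22 q - (h12 q)\<^sup>2 \<noteq> 0"
    "\<And>q p. q \<in> range_of c \<Longrightarrow> ?K (q, p) = frame_form e_x e_y h11 h12 h22 (q, p)"
    using kinetic_energy_frame_form[OF g c] by blast
  obtain a b e where f: "smooth_on (range_of c) a" "smooth_on (range_of c) b" "smooth_on (range_of c) e"
    "\<And>q p. q \<in> range_of c \<Longrightarrow> ?F (q, p) = frame_form e_x e_y a b e (q, p)"
    using quadratic_frame_form[OF q c] by blast
  have hS: "smooth_on S h11" "smooth_on S h12" "smooth_on S h22" and fS: "smooth_on S a" "smooth_on S b" "smooth_on S e"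
    using h(1-3) f(1-3) S(3) smooth_on_subset by blast+
  define a' where "a' q = a q - k * h11 q" for q
  define b' where "b' q = b q - k * h12 q" for q
  define e' where "e' q = e q - k * h22 q" for q
  have sm': "smooth_on S a'" "smooth_on S b'" "smooth_on S e'"
    unfolding a'_def b'_def e'_def by (intro smooth_intros S hS fS)+
  have ff: "frame_form e_x e_y a' b' e' = (\<lambda>z. frame_form e_x e_y a b e z - k * frame_form e_x e_y h11 h12 h22 z)"
    by (auto simp: fun_eq_iff frame_form_def a'_def b'_def e'_def algebra_simps)
  note cx = smooth_on_const[OF S(1), of "(1::real, 0::real)"] and cy = smooth_on_const[OF S(1), of "(0::real, 1::real)"]
  have int: "poisson_bracket (frame_form e_x e_y h11 h12 h22) (frame_form e_x e_y a' b' e') (q, p) = 0"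
    if "q \<in> S" for q p
  proof -
    have "frame_form e_x e_y a b e differentiable at (q, p)"
      using frame_form_has_derivative[OF cx cy fS that] by (rule differentiableI)
    moreover have "frame_form e_x e_y h11 h12 h22 differentiable at (q, p)"
      using frame_form_has_derivative[OF cx cy hS that] by (rule differentiableI)
    ultimately have "poisson_bracket (frame_form e_x e_y h11 h12 h22) (frame_form e_x e_y a' b' e') (q, p) =
        poisson_bracket (frame_form e_x e_y h11 h12 h22) (frame_form e_x e_y a b e) (q, p)"
      unfolding ff by (rule poisson_bracket_diff_scale)
    also have "\<dots> = poisson_bracket ?K ?F (q, p)"
    proof (rule poisson_bracket_cong[OF S(1) that])
      fix q p assume "q \<in> S"
      then have "q \<in> range_of c" using S(3) by blast
      then show "frame_form e_x e_y h11 h12 h22 (q, p) = ?K (q, p)" "frame_form e_x e_y a b e (q, p) = ?F (q, p)"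
        using h(5) f(4) by simp_all
    qed
    also have "\<dots> = 0"
      using i c that S(3) unfolding geodesic_integral_def by blast
    finally show ?thesis .
  qed
  have zero': "a' q = 0 \<and> b' q = 0 \<and> e' q = 0" if "q \<in> U" for q
  proof -
    have qR: "q \<in> range_of c" using that U(3) S(3) by blast
    have v: "frame_form e_x e_y a' b' e' (q, p) = 0" for p
      using zero[OF that, of p] h(5)[OF qR] f(4)[OF qR] by (simp add: ff)
    show ?thesis using v[of "(1, 0)"] v[of "(0, 1)"] v[of "(1, 1)"] by (simp add: frame_form_def)
  qed
  have nd: "4 * h11 q * h22 q - (h12 q)\<^sup>2 \<noteq> 0" if "q \<in> S" for q using h(4) that S(3) by blast
  have "a' z = 0 \<and> b' z = 0 \<and> e' z = 0"
    by (rule quadratic_integral_unique_continuation[OF S(1,2) U hS sm' nd int zero' z])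
  then have "frame_form e_x e_y a' b' e' (z, w) = 0" by (simp add: frame_form_def)
  moreover have "z \<in> range_of c" using z S(3) by blast
  ultimately show ?thesis using h(5) f(4) by (simp add: ff)
qed

text \<open>The interior \<open>Z\<close> of the set of points over which \<open>F = k H\<close> is
  open and nonempty. It is also closed: a chart ball that meets \<open>Z\<close> does so in an open
  set, and continuation fills the ball. Connectedness finishes the argument.\<close>

lemma proportional_locally_imp_globally:
  assumes g: "pseudo_riemannian_metric T A g" and q: "quadratic_in_momenta T A F"
    and i: "geodesic_integral T A g F" and c: "coordinate_system T A c"
    and B: "open B" "B \<noteq> {}" "B \<subseteq> range_of c"
    and proportional: "\<And>z w. z \<in> B \<Longrightarrow>
      in_canonical_coords T A c F (z, w) = k * in_canonical_coords T A c (kinetic_energy T A g) (z, w)"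
    and \<xi>: "\<xi> \<in> cotangent_bundle_on T A (topspace T)"
  shows "F \<xi> = k * kinetic_energy T A g \<xi>"
proof -
  define P where "P p \<longleftrightarrow> (\<forall>\<omega>\<in>cotangent_space T A p. F (p, \<omega>) = k * kinetic_energy T A g (p, \<omega>))" for p
  have P_coords: "P p \<longleftrightarrow> (\<forall>w. in_canonical_coords T A d F (snd d p, w) =
      k * in_canonical_coords T A d (kinetic_energy T A g) (snd d p, w))"
    if d: "coordinate_system T A d" "p \<in> fst d" for d p
  proof -
    have "\<exists>w. \<omega> = cotangent_vector p d w" if "\<omega> \<in> cotangent_space T A p" for \<omega>
    proof
      show "\<omega> = cotangent_vector p d (\<omega> d)"
        by (rule cotangent_space_eqI[OF that cotangent_vector_in[OF d], of d])
          (use d in \<open>simp_all add: coordinate_systems_at_def cotangent_vector_self[OF d]\<close>)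
    qed
    then show ?thesis
      unfolding P_def in_canonical_coords_apply[OF d] using cotangent_vector_in[OF d] by metis
  qed
  define Z where "Z = {p. \<exists>N. openin T N \<and> p \<in> N \<and> (\<forall>r\<in>N. P r)}"
  have oZ: "openin T Z"
    unfolding Z_def by (subst openin_subopen) blast
  have "openin T (topspace T - Z)"
  proof (subst openin_subopen, intro ballI)
    fix p assume p: "p \<in> topspace T - Z"
    then obtain d where d: "coordinate_system T A d" "p \<in> fst d" using atlas_at by blast
    note cd = coordinate_system_chart[OF d(1)]
    have "open (range_of d)" using cd by (simp add: is_chart_def)
    \<comment> \<open>A ball in the chart is convex, so continuation along segments reaches all of
      it.\<close>
    then obtain s where s: "s > 0" "ball (snd d p) s \<subseteq> range_of d"
      using in_range_of[OF d(2)] open_contains_ball by blast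
    define N where "N = {r \<in> fst d. snd d r \<in> ball (snd d p) s}"
    have N: "openin T N" "p \<in> N" "N \<subseteq> fst d"
      unfolding N_def using is_chart_open_preimage[OF cd open_ball] d s by auto
    have "N \<inter> Z = {}"
    proof (rule ccontr)
      assume "N \<inter> Z \<noteq> {}"
      then obtain r M where r: "r \<in> N" "openin T M" "r \<in> M" "\<forall>r\<in>M. P r" by (auto simp: Z_def)
      define U where "U = snd d ` (N \<inter> M)"
      have oU: "open U"
        unfolding U_def by (rule is_chart_open_image[OF cd]) (use N r in auto)
      have U: "U \<noteq> {}" "U \<subseteq> ball (snd d p) s" using r by (auto simp: U_def N_def)
      have Uz: "in_canonical_coords T A d F (z, w) = k * in_canonical_coords T A d (kinetic_energy T A g) (z, w)"
        if z: "z \<in> U" for z w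
      proof -
        obtain x where x: "x \<in> N" "x \<in> M" "z = snd d x" using z by (auto simp: U_def)
        then have "x \<in> fst d" "P x" using N(3) r(4) by blast+
        then show ?thesis using P_coords[OF d(1)] x(3) by blast
      qed
      have "P x" if "x \<in> N" for x
      proof -
        have "x \<in> fst d" "snd d x \<in> ball (snd d p) s" using that by (simp_all add: N_def)
        then show ?thesis
          using P_coords[OF d(1)]
            integral_minus_energy_unique_continuation[OF g q i d(1) open_ball convex_ball s(2) oU U Uz] by blast
      qed
      then have "p \<in> Z" using N unfolding Z_def by blast
      then show False using p by blast
    qed
    then show "\<exists>N. openin T N \<and> p \<in> N \<and> N \<subseteq> topspace T - Z"
      using N openin_subset[OF N(1)] by blast
  qed
  moreover have "Z \<noteq> {}"
  proof -
    obtain z where z: "z \<in> B" using B(2) by blast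
    note cc = coordinate_system_chart[OF c]
    define N where "N = {r \<in> fst c. snd c r \<in> B}"
    have "openin T N" unfolding N_def by (rule is_chart_open_preimage[OF cc B(1)])
    moreover have "chart_inv c z \<in> N"
    proof -
      have "z \<in> range_of c" using z B(3) by blast
      then show ?thesis using z by (simp add: N_def chart_inv_in chart_inv_right)
    qed
    moreover have "P r" if "r \<in> N" for r
    proof -
      have "r \<in> fst c" "snd c r \<in> B" using that by (simp_all add: N_def)
      then show ?thesis using P_coords[OF c] proportional by blast
    qed
    ultimately show ?thesis unfolding Z_def by blast
  qed
  moreover have "connected_space T" using surface by (simp add: smooth_surface_def)
  moreover have "Z \<subseteq> topspace T" by (rule openin_subset[OF oZ])
  ultimately have "Z = topspace T"
    using oZ unfolding connected_space_clopen_in closedin_def by blast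
  then have "P p" if "p \<in> topspace T" for p using that unfolding Z_def by blast
  then show ?thesis using \<xi> by (auto simp: cotangent_bundle_on_def P_def)
qed

end

text \<open>Almost every point is taken in the sense of a dense open set. The good points form an
  open set, since the whole domain of a coordinate system in normal form consists of them; they are
  dense, since the local result applies to the chart image of any nonempty open set.\<close>

theorem theoremB:
  fixes T :: "'a topology" and A :: "'a chart set"
    and g F :: "'a bundle_point \<Rightarrow> real"
  assumes "smooth_surface T A"
    and "pseudo_riemannian_metric T A g"
    and "quadratic_in_momenta T A F"
    and "geodesic_integral T A g F"
    and "nontrivial_integral T A g F"
  shows "\<exists>W. openin T W \<and> T closure_of W = topspace T \<and>
           (\<forall>p\<in>W. \<exists>c\<in>coordinate_systems_at T A p. normal_form_in T A c g F)"
proof -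
  interpret surface T A by (unfold_locales) (rule assms(1))
  define W where "W = {p. \<exists>c\<in>coordinate_systems_at T A p. normal_form_in T A c g F}"
  have "openin T W"
  proof (subst openin_subopen, intro ballI)
    fix p assume "p \<in> W"
    then obtain c where c: "coordinate_system T A c" "p \<in> fst c" "normal_form_in T A c g F"
      by (auto simp: W_def coordinate_systems_at_def)
    then have "fst c \<subseteq> W" unfolding W_def coordinate_systems_at_def by blast
    moreover have "openin T (fst c)" using coordinate_system_chart[OF c(1)] by (simp add: is_chart_def)
    ultimately show "\<exists>N. openin T N \<and> p \<in> N \<and> N \<subseteq> W" using c(2) by blast
  qed
  moreover have "W \<inter> U \<noteq> {}" if U: "openin T U" "U \<noteq> {}" for U
  proof -
    obtain p where p: "p \<in> U" using U(2) by blast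
    then have "p \<in> topspace T" using openin_subset[OF U(1)] by blast
    then obtain c where c: "coordinate_system T A c" "p \<in> fst c" using atlas_at by blast
    note cc = coordinate_system_chart[OF c(1)]
    let ?K = "in_canonical_coords T A c (kinetic_energy T A g)" and ?F = "in_canonical_coords T A c F"
      and ?G = "in_tangent_coords T A c g"
    define S where "S = snd c ` (U \<inter> fst c)"
    have oS: "open S"
      unfolding S_def by (rule is_chart_open_image[OF cc]) (use U(1) cc in \<open>auto simp: is_chart_def\<close>)
    have SR: "S \<subseteq> range_of c" by (auto simp: S_def range_of_def)
    have "S \<noteq> {}" using p c(2) by (auto simp: S_def)
    interpret R: local_integral "range_of c" ?G ?K ?F
      by (rule coordinates_local_integral[OF assms(2,4) c(1)])
    interpret L: local_integral S ?G ?K ?F by (rule R.subset[OF oS SR])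
    obtain h11 h12 h22 where h: "smooth_on (range_of c) h11" "smooth_on (range_of c) h12" "smooth_on (range_of c) h22"
      "\<And>q. q \<in> range_of c \<Longrightarrow> 4 * h11 q * h22 q - (h12 q)\<^sup>2 \<noteq> 0"
      "\<And>q p. q \<in> range_of c \<Longrightarrow> ?K (q, p) = frame_form e_x e_y h11 h12 h22 (q, p)"
      using kinetic_energy_frame_form[OF assms(2) c(1)] by blast
    obtain a b e where f: "smooth_on (range_of c) a" "smooth_on (range_of c) b" "smooth_on (range_of c) e"
      "\<And>q p. q \<in> range_of c \<Longrightarrow> ?F (q, p) = frame_form e_x e_y a b e (q, p)"
      using quadratic_frame_form[OF assms(3) c(1)] by blast
    have sm: "smooth_on S h11" "smooth_on S h12" "smooth_on S h22" "smooth_on S a" "smooth_on S b" "smooth_on S e"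
      using h(1-3) f(1-3) SR smooth_on_subset by blast+
    have "admits_coordinates normal_form S ?G ?F \<or> L.proportional_somewhere"
      by (intro L.local_normal_form[OF sm] h(4,5) f(4) \<open>S \<noteq> {}\<close> subsetD[OF SR])
    \<comment> \<open>Nontriviality enters here: proportionality on any small open set would spread
      over the whole cotangent bundle with the same constant.\<close>
    moreover have "\<not> L.proportional_somewhere"
    proof
      assume "L.proportional_somewhere"
      then obtain k B where B: "open B" "B \<noteq> {}" "B \<subseteq> S" "\<And>q p. q \<in> B \<Longrightarrow> ?F (q, p) = k * ?K (q, p)"
        unfolding L.proportional_somewhere_def by blast
      have "B \<subseteq> range_of c" using B(3) SR by blast
      from proportional_locally_imp_globally[OF assms(2-4) c(1) B(1,2) this B(4)]
      show False using assms(5) unfolding nontrivial_integral_def by blast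
    qed
    ultimately have "admits_coordinates normal_form S ?G ?F" by blast
    from normal_form_coordinate_system[OF c(1) SR this]
    obtain d where d: "coordinate_system T A d" "fst d \<noteq> {}" "fst d \<subseteq> fst c" "snd c ` fst d \<subseteq> S"
      "normal_form_in T A d g F" .
    then obtain r where r: "r \<in> fst d" by blast
    then have "snd c r \<in> snd c ` (U \<inter> fst c)" "r \<in> fst c" using d(3,4) unfolding S_def by blast+
    then have "r \<in> U" using is_chart_inj[OF cc] by (auto dest: inj_onD)
    moreover have "r \<in> W" using d(1,5) r unfolding W_def coordinate_systems_at_def by blast
    ultimately show ?thesis by blast
  qed
  then have "T closure_of W = topspace T" unfolding dense_intersects_open by blast
  ultimately show ?thesis unfolding W_def by blast
qed

end
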